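(* Let $0<a<b<1$ and let $H:\mathbb{R}\to[a,b]$ be a (deterministic) function such that for every $t\in\mathbb{R}$ there exist $\gamma\ge H(t)$, $R_t>0$ and $c_t>0$ such that $|H(s)-H(t)|\le c_t|s-t|^{\gamma}$ for all $s\in\mathbb{R}$ with $|s-t|\le R_t$. Let $B_H(t)=B(t,H(t))$, $t\in\mathbb{R}$, be the Multifractional Brownian Motion with Hurst function $H$. Then almost surely, for every non-empty open interval $I$ of $\mathbb{R}$, there exists $t\in I$ such that $$\limsup_{s\to t}\frac{|B_H(s)-B_H(t)|}{|s-t|^{H(t)}}<\infty .$$
   Context: The generator of Multifractional Brownian Motion is the real Gaussian field on $\mathbb{R}\times(0,1)$ defined by $$B(t,\theta)=\int_{\mathbb{R}}\frac{e^{it\xi}-1}{|\xi|^{\theta+\frac12}}\,d\widehat W(\xi),$$ where $d\widehat W$ is the "Fourier transform" of the real-valued white noise measure $dW$, i.e. $\int_{\mathbb{R}} f\,dW=\int_{\mathbb{R}}\widehat f\,d\widehat W$ almost surely for all $f\in L^2(\mathbb{R})$. Throughout, $B$ denotes the continuous version given by the wavelet-type expansion $$B(t,\theta)=\sum_{j\in\mathbb{Z}}\sum_{k\in\mathbb{Z}}2^{-j\theta}\varepsilon_{j,k}\big(\Psi(2^jt-k,\theta)-\Psi(-k,\theta)\big),$$ which converges almost surely uniformly on compact subsets of $\mathbb{R}\times(0,1)$. Here $(\varepsilon_{j,k})_{(j,k)\in\mathbb{Z}^2}$ are i.i.d. $\mathcal N(0,1)$ random variables, $\psi$ is the Lemarié–Meyer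 mother wavelet (so $\{2^{j/2}\psi(2^j\cdot-k):(j,k)\in\mathbb{Z}^2\}$ is an orthonormal basis of $L^2(\mathbb{R})$, $\psi$ is in the Schwartz class, and $\widehat\psi$ is compactly supported and vanishes in a neighbourhood of $0$), and $$\Psi(t,\theta)=\int_{\mathbb{R}}\frac{e^{it\xi}\widehat\psi(\xi)}{|\xi|^{\theta+\frac12}}\,d\xi .$$ *)

theory Defs
  imports "HOL-Probability.Probability"
begin

definition square_integrable :: "(real \<Rightarrow> real) \<Rightarrow> bool" where
  "square_integrable f \<longleftrightarrow> f \<in> borel_measurable lborel \<and> integrable lborel (\<lambda>x. (f x)\<^sup>2)"

definition L2_inner :: "(real \<Rightarrow> real) \<Rightarrow> (real \<Rightarrow> real) \<Rightarrow> real" where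
  "L2_inner f g = (LINT x|lborel. f x * g x)"

text \<open>The library has no space \<open>L\<^sup>2(\<real>)\<close>; the expansion below is
  unconditional convergence in \<open>L\<^sup>2\<close>-norm, for representatives of the classes.\<close>

definition orthonormal_basis_L2 :: "('i \<Rightarrow> real \<Rightarrow> real) \<Rightarrow> bool" where
  "orthonormal_basis_L2 e \<longleftrightarrow>
     (\<forall>i. square_integrable (e i)) \<and>
     (\<forall>i i'. L2_inner (e i) (e i') = (if i = i' then 1 else 0)) \<and>
     (\<forall>f. square_integrable f \<longrightarrow>
        ((\<lambda>F. LINT x|lborel. (f x - (\<Sum>i\<in>F. L2_inner f (e i) * e i x))\<^sup>2) \<longlongrightarrow> 0)
          (finite_subsets_at_top UNIV))"

definition schwartz :: "(real \<Rightarrow> real) \<Rightarrow> bool" where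
  "schwartz f \<longleftrightarrow>
     (\<forall>n x. (deriv ^^ n) f differentiable (at x)) \<and>
     (\<forall>m n. bounded (range (\<lambda>x. x ^ m * (deriv ^^ n) f x)))"

text \<open>Unitary normalisation, so that Plancherel's identity has no constant.\<close>

definition fourier :: "(real \<Rightarrow> real) \<Rightarrow> real \<Rightarrow> complex" where
  "fourier f \<xi> = (LINT x|lborel. cis (- (x * \<xi>)) * complex_of_real (f x)) / complex_of_real (sqrt (2 * pi))"

definition wavelet :: "(real \<Rightarrow> real) \<Rightarrow> int \<Rightarrow> int \<Rightarrow> real \<Rightarrow> real" where
  "wavelet \<psi> j k x = 2 powr (real_of_int j / 2) * \<psi> (2 powi j * x - real_of_int k)"

text \<open>The Lemarie--Meyer construction depends on the choice of a cut-off function; the predicate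
  records the properties shared by all wavelets it yields, so it admits each of them.\<close>

definition lemarie_meyer :: "(real \<Rightarrow> real) \<Rightarrow> bool" where
  "lemarie_meyer \<psi> \<longleftrightarrow>
     schwartz \<psi> \<and>
     orthonormal_basis_L2 (\<lambda>(j, k). wavelet \<psi> j k) \<and>
     compact (closure {\<xi>. fourier \<psi> \<xi> \<noteq> 0}) \<and>
     (\<forall>\<^sub>F \<xi> in nhds 0. fourier \<psi> \<xi> = 0)"

definition Psi :: "(real \<Rightarrow> real) \<Rightarrow> real \<Rightarrow> real \<Rightarrow> complex" where
  "Psi \<psi> t \<theta> =
     (LINT \<xi>|lborel. cis (t * \<xi>) * fourier \<psi> \<xi> / complex_of_real (\<bar>\<xi>\<bar> powr (\<theta> + 1/2)))"

lemma cnj_fourier: "cnj (fourier f \<xi>) = fourier f (- \<xi>)"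
  unfolding fourier_def by (simp add: cis_cnj flip: Bochner_Integration.integral_cnj)

lemma Psi_real: "Psi \<psi> t \<theta> \<in> \<real>"
proof -
  have "cnj (Psi \<psi> t \<theta>) =
      (LINT \<xi>|lborel. cis (- (t * \<xi>)) * fourier \<psi> (- \<xi>) / complex_of_real (\<bar>\<xi>\<bar> powr (\<theta> + 1/2)))"
    unfolding Psi_def by (simp add: cis_cnj cnj_fourier flip: Bochner_Integration.integral_cnj)
  also have "\<dots> = Psi \<psi> t \<theta>"
    unfolding Psi_def by (subst lborel_integral_real_affine[where c = "-1" and t = 0]) auto
  finally show ?thesis
    by (simp add: Reals_cnj_iff)
qed

text \<open>The terms are real by \<open>Psi_real\<close>, so taking real parts only changes the type. The series is
  almost surely absolutely convergent for \<open>0 < \<theta> < 1\<close>, so that the order of summation is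
  immaterial outside a null set.\<close>

definition mBm_generator ::
  "(real \<Rightarrow> real) \<Rightarrow> (int \<Rightarrow> int \<Rightarrow> 'a \<Rightarrow> real) \<Rightarrow> 'a \<Rightarrow> real \<Rightarrow> real \<Rightarrow> real" where
  "mBm_generator \<psi> \<epsilon> \<omega> t \<theta> =
     (\<Sum>\<^sub>\<infinity>j. \<Sum>\<^sub>\<infinity>k.
        2 powr (- (real_of_int j * \<theta>)) * \<epsilon> j k \<omega> *
        Re (Psi \<psi> (2 powi j * t - real_of_int k) \<theta> - Psi \<psi> (- real_of_int k) \<theta>))"

definition mBm ::
  "(real \<Rightarrow> real) \<Rightarrow> (int \<Rightarrow> int \<Rightarrow> 'a \<Rightarrow> real) \<Rightarrow> (real \<Rightarrow> real) \<Rightarrow> 'a \<Rightarrow> real \<Rightarrow> real" where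
  "mBm \<psi> \<epsilon> H \<omega> t = mBm_generator \<psi> \<epsilon> \<omega> t (H t)"

definition iid_std_normal :: "'a measure \<Rightarrow> (int \<Rightarrow> int \<Rightarrow> 'a \<Rightarrow> real) \<Rightarrow> bool" where
  "iid_std_normal M \<epsilon> \<longleftrightarrow>
     prob_space.indep_vars M (\<lambda>_. borel) (\<lambda>(j, k). \<epsilon> j k) UNIV \<and>
     (\<forall>j k. distributed M lborel (\<epsilon> j k) std_normal_density)"

end

theory Submission
  imports Defs
begin

text \<open>
The proof looks for \<^emph>\<open>slow points\<close>: points \<open>t\<close> all of whose surrounding wavelet coefficients are
small, in the sense that, for a fixed power \<open>0 < p < a\<close> and a constant \<open>\<mu>\<close> that may depend on \<open>\<omega>\<close>,
\<open>\<bar>\<epsilon>\<^sub>j\<^sub>k\<bar> \<le> \<mu> (1 + max 0 (-j)) (1 + \<bar>k - 2^j t\<bar>)^p\<close> for all \<open>j\<close> and \<open>k\<close>.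

\<^bold>\<open>A slow point is good enough.\<close> Let \<open>h = \<bar>s - t\<bar>\<close>. The functions \<open>\<Psi>(\<cdot>, \<theta>)\<close> decay quadratically,
uniformly in \<open>\<theta> \<in> [a, b]\<close>, and so do their increments, with an additional factor \<open>min 1 \<bar>x - y\<bar>\<close>
(\<open>wavelet_profile_Psi\<close>). Hence level \<open>j\<close> contributes at most a constant times
\<open>2^(-j \<theta>) min 1 (2^j h) (1 + 2^j h)^p\<close> to \<open>B(s,\<theta>) - B(t,\<theta>)\<close>. As \<open>p < a \<le> \<theta> \<le> b < 1\<close>, this is \<open>h^\<theta>\<close>
times a quantity that decays geometrically in \<open>\<bar>j + log 2 h\<bar>\<close>: small levels gain from \<open>\<theta> < 1\<close>,
large levels from \<open>p < \<theta>\<close>. Summing over \<open>j\<close> gives \<open>O(h^\<theta>)\<close> for all \<open>\<theta>\<close> simultaneously. The same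
computation for differences in \<open>\<theta>\<close> shows that \<open>B(s, \<cdot>)\<close> is Lipschitz on \<open>[a, b]\<close>, uniformly in \<open>s\<close>
near \<open>t\<close> (\<open>field_at_slow_point\<close>). With \<open>\<theta> = H t\<close>, the hypothesis \<open>\<bar>H s - H t\<bar> = O(h^(H t))\<close> finishes
the argument.

\<^bold>\<open>Slow points exist.\<close> A given \<open>t\<close> is almost surely not slow, so slow points have to be found by
a branching argument in the spirit of Kahane. One descends the dyadic tree below some
interval and discards an interval \<open>[l 2^(-j), (l+1) 2^(-j)]\<close> as soon as
\<open>\<bar>\<epsilon>\<^sub>j\<^sub>k\<bar> > \<mu> (1 + \<bar>k - l\<bar>)^p\<close> for some \<open>k\<close>. The number of intervals discarded at a level is
dominated by a sum of independent variables, namely of even powers of the coefficients with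
summable weights, so that for \<open>\<mu>\<close> large Chebyshev's inequality shows: of \<open>N\<close> intervals at most a
quarter is discarded, except with probability \<open>O(1/N)\<close>. Different levels are independent, the
number of intervals grows at least like \<open>(3/2)^n\<close>, and so the tree started from \<open>N\<close> intervals
dies out with probability \<open>O(1/N)\<close> only (\<open>extinction_bound\<close>). The tree can be started as deep as
one wishes, i.e. with \<open>N\<close> as large as one wishes: the finitely many levels that are skipped,
the negative levels and the far-away coefficients of each level are handled by a crude
almost sure polynomial bound on all coefficients (\<open>AE_global_bound\<close>, \<open>slow_at_of_tame\<close>). Hence
almost surely some tree survives, and a point in the intersection of its levels is slow
(\<open>AE_slow_point_in_dyadic_interval\<close>).
\<close>

section \<open>Sums over the lattice and over dyadic scales\<close>

lemma summable_on_int_of_nat: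
  fixes g :: "nat \<Rightarrow> real"
  assumes "summable g" "\<And>n. 0 \<le> g n"
  shows "(\<lambda>k::int. g (nat \<bar>k\<bar>)) summable_on UNIV"
proof -
  have g: "g summable_on UNIV"
    using assms by (intro norm_summable_imp_summable_on) auto
  have "(\<lambda>k::int. g (nat \<bar>k\<bar>)) summable_on {0..}"
    by (rule summable_on_reindex_bij_witness[THEN iffD1, OF _ _ _ _ _ g, of nat int]) auto
  moreover have "(\<lambda>k::int. g (nat \<bar>k\<bar>)) summable_on {..0}"
    by (rule summable_on_reindex_bij_witness[THEN iffD1, OF _ _ _ _ _ g,
          of "\<lambda>k. nat (- k)" "\<lambda>n. - int n"]) auto
  then have "(\<lambda>k::int. g (nat \<bar>k\<bar>)) summable_on {..<0}"
    by (rule summable_on_subset_banach) auto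
  ultimately have "(\<lambda>k::int. g (nat \<bar>k\<bar>)) summable_on ({0..} \<union> {..<0})"
    by (intro summable_on_Un_disjoint) auto
  moreover have "{0..} \<union> {..<0} = (UNIV :: int set)" by auto
  ultimately show ?thesis by simp
qed

text \<open>Translating the lattice by the integer part of \<open>\<tau>\<close> reduces \<open>\<tau>\<close> to its fractional part, which
  makes the bound uniform in \<open>\<tau>\<close>.\<close>

lemma lattice_sum_bounded:
  fixes g :: "real \<Rightarrow> real" and h :: "nat \<Rightarrow> real"
  assumes h: "summable h" "\<And>n. 0 \<le> h n" and g: "\<And>u. 0 \<le> g u"
    and gh: "\<And>k f. 0 \<le> f \<Longrightarrow> f < 1 \<Longrightarrow> g (real_of_int k + f) \<le> h (nat \<bar>k\<bar>)"
  shows "\<exists>A\<ge>0. \<forall>\<tau>. (\<lambda>k::int. g (real_of_int k + \<tau>)) summable_on UNIV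
            \<and> (\<Sum>\<^sub>\<infinity>k. g (real_of_int k + \<tau>)) \<le> A"
proof (intro exI conjI allI)
  have H: "(\<lambda>k::int. h (nat \<bar>k\<bar>)) summable_on UNIV"
    using h by (rule summable_on_int_of_nat)
  show "0 \<le> (\<Sum>\<^sub>\<infinity>k::int. h (nat \<bar>k\<bar>))" by (intro infsum_nonneg h)
  fix \<tau> :: real
  have bij: "bij_betw (\<lambda>k::int. k + \<lfloor>\<tau>\<rfloor>) UNIV UNIV"
    by (rule bij_betwI[of _ _ _ "\<lambda>k. k - \<lfloor>\<tau>\<rfloor>"]) auto
  have le: "g (real_of_int k + \<tau>) \<le> h (nat \<bar>k + \<lfloor>\<tau>\<rfloor>\<bar>)" for k
  proof -
    have "real_of_int k + \<tau> = real_of_int (k + \<lfloor>\<tau>\<rfloor>) + frac \<tau>" by (simp add: frac_def)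
    then show ?thesis using gh[of "frac \<tau>" "k + \<lfloor>\<tau>\<rfloor>"] frac_lt_1[of \<tau>] frac_ge_0[of \<tau>] by metis
  qed
  have H': "(\<lambda>k::int. h (nat \<bar>k + \<lfloor>\<tau>\<rfloor>\<bar>)) summable_on UNIV"
    using summable_on_reindex_bij_betw[OF bij, of "\<lambda>k. h (nat \<bar>k\<bar>)"] H by simp
  show *: "(\<lambda>k::int. g (real_of_int k + \<tau>)) summable_on UNIV"
    by (rule summable_on_comparison_test[OF H']) (use le g in auto)
  have "(\<Sum>\<^sub>\<infinity>k. g (real_of_int k + \<tau>)) \<le> (\<Sum>\<^sub>\<infinity>k. h (nat \<bar>k + \<lfloor>\<tau>\<rfloor>\<bar>))"
    by (rule infsum_mono[OF * H']) (use le in auto)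
  also have "\<dots> = (\<Sum>\<^sub>\<infinity>k. h (nat \<bar>k\<bar>))"
    using infsum_reindex_bij_betw[OF bij, of "\<lambda>k. h (nat \<bar>k\<bar>)"] by simp
  finally show "(\<Sum>\<^sub>\<infinity>k. g (real_of_int k + \<tau>)) \<le> (\<Sum>\<^sub>\<infinity>k::int. h (nat \<bar>k\<bar>))" .
qed

definition decay :: "real \<Rightarrow> real" where
  "decay u = 1 / (1 + \<bar>u\<bar>)\<^sup>2"

lemma decay_pos: "0 < decay u"
  by (auto simp: decay_def)

lemma lattice_sum_three_halves:
  "\<exists>A\<ge>0. \<forall>y. (\<lambda>k::int. (1 + \<bar>real_of_int k - y\<bar>) powr (-3/2)) summable_on UNIV
       \<and> (\<Sum>\<^sub>\<infinity>k::int. (1 + \<bar>real_of_int k - y\<bar>) powr (-3/2)) \<le> A"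
proof -
  define h where "h n = ((1 + real n) / 2) powr (-3/2)" for n :: nat
  have "summable (\<lambda>n. real (Suc n) powr (-3/2))"
    using summable_Suc_iff[of "\<lambda>n. real n powr (-3/2)"] by (simp add: summable_real_powr_iff)
  then have "summable (\<lambda>n. real (Suc n) powr (-3/2) * (1/2) powr (-3/2))"
    by (rule summable_mult2)
  then have h: "summable h"
    unfolding h_def by (simp add: powr_mult[symmetric] add.commute field_simps)
  have "\<exists>A\<ge>0. \<forall>\<tau>. (\<lambda>k::int. (1 + \<bar>real_of_int k + \<tau>\<bar>) powr (-3/2)) summable_on UNIV
            \<and> (\<Sum>\<^sub>\<infinity>k. (1 + \<bar>real_of_int k + \<tau>\<bar>) powr (-3/2)) \<le> A"
  proof (rule lattice_sum_bounded[OF h])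
    fix k :: int and f :: real assume f: "0 \<le> f" "f < 1"
    have "(1 + real (nat \<bar>k\<bar>)) / 2 \<le> 1 + \<bar>real_of_int k + f\<bar>"
      using f by (cases "k \<ge> 0") (auto simp: abs_if)
    then show "(1 + \<bar>real_of_int k + f\<bar>) powr (-3/2) \<le> h (nat \<bar>k\<bar>)"
      unfolding h_def by (intro powr_mono2') auto
  qed (auto simp: h_def)
  then obtain A where A: "A \<ge> 0" "\<And>\<tau>. (\<lambda>k::int. (1 + \<bar>real_of_int k + \<tau>\<bar>) powr (-3/2)) summable_on UNIV
            \<and> (\<Sum>\<^sub>\<infinity>k. (1 + \<bar>real_of_int k + \<tau>\<bar>) powr (-3/2)) \<le> A" by auto
  show ?thesis
    using A(1) A(2)[of "- _"] by (intro exI[of _ A]) simp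
qed

text \<open>The weight is submultiplicative: \<open>1 + \<bar>k - x\<bar> \<le> (1 + \<bar>k - y\<bar>) (1 + \<bar>x - y\<bar>)\<close>. Moving it from \<open>x\<close>
  to the centre \<open>y\<close> of the bump costs the factor on the right-hand side, and the restriction
  \<open>p \<le> 1/2\<close> leaves a power \<open>-3/2\<close>, which is summable.\<close>

lemma weighted_lattice_sum:
  fixes p :: real
  assumes p: "0 \<le> p" "p \<le> 1/2"
  shows "\<exists>A\<ge>0. \<forall>x y. (\<lambda>k::int. (1 + \<bar>real_of_int k - x\<bar>) powr p * decay (y - real_of_int k)) summable_on UNIV
       \<and> (\<Sum>\<^sub>\<infinity>k::int. (1 + \<bar>real_of_int k - x\<bar>) powr p * decay (y - real_of_int k))
           \<le> A * (1 + \<bar>x - y\<bar>) powr p"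
proof -
  obtain A where A: "A \<ge> 0"
    "\<And>y. (\<lambda>k::int. (1 + \<bar>real_of_int k - y\<bar>) powr (-3/2)) summable_on UNIV"
    "\<And>y. (\<Sum>\<^sub>\<infinity>k::int. (1 + \<bar>real_of_int k - y\<bar>) powr (-3/2)) \<le> A"
    using lattice_sum_three_halves by auto
  have le: "(1 + \<bar>real_of_int k - x\<bar>) powr p * decay (y - real_of_int k)
      \<le> (1 + \<bar>x - y\<bar>) powr p * (1 + \<bar>real_of_int k - y\<bar>) powr (-3/2)" for x y k
  proof -
    let ?u = "1 + \<bar>real_of_int k - y\<bar>"
    have d: "decay (y - real_of_int k) = ?u powr (-2)"
      by (simp add: decay_def powr_minus_divide powr_numeral abs_minus_commute)
    have "0 \<le> \<bar>x - y\<bar> * \<bar>real_of_int k - y\<bar>" by simp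
    then have "1 + \<bar>real_of_int k - x\<bar> \<le> (1 + \<bar>x - y\<bar>) * ?u"
      unfolding distrib_left distrib_right by (smt (verit))
    then have "(1 + \<bar>real_of_int k - x\<bar>) powr p \<le> ((1 + \<bar>x - y\<bar>) * ?u) powr p"
      using p by (intro powr_mono2) auto
    also have "\<dots> = (1 + \<bar>x - y\<bar>) powr p * ?u powr p"
      by (simp add: powr_mult)
    also have "\<dots> \<le> (1 + \<bar>x - y\<bar>) powr p * ?u powr (1/2)"
      using p by (intro mult_left_mono powr_mono) auto
    finally have "(1 + \<bar>real_of_int k - x\<bar>) powr p * ?u powr (-2)
        \<le> (1 + \<bar>x - y\<bar>) powr p * ?u powr (1/2) * ?u powr (-2)"
      by (rule mult_right_mono) auto
    also have "\<dots> = (1 + \<bar>x - y\<bar>) powr p * ?u powr (-3/2)"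
      by (simp add: mult.assoc powr_add[symmetric])
    finally show ?thesis unfolding d .
  qed
  show ?thesis
  proof (intro exI[of _ A] conjI allI A(1))
    fix x y :: real
    have s: "(\<lambda>k::int. (1 + \<bar>x - y\<bar>) powr p * (1 + \<bar>real_of_int k - y\<bar>) powr (-3/2)) summable_on UNIV"
      by (intro summable_on_cmult_right A)
    show 1: "(\<lambda>k::int. (1 + \<bar>real_of_int k - x\<bar>) powr p * decay (y - real_of_int k)) summable_on UNIV"
      by (rule summable_on_comparison_test[OF s le]) (simp add: decay_def)
    have "(\<Sum>\<^sub>\<infinity>k::int. (1 + \<bar>real_of_int k - x\<bar>) powr p * decay (y - real_of_int k))
       \<le> (\<Sum>\<^sub>\<infinity>k::int. (1 + \<bar>x - y\<bar>) powr p * (1 + \<bar>real_of_int k - y\<bar>) powr (-3/2))"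
      by (rule infsum_mono[OF 1 s le])
    also have "\<dots> \<le> (1 + \<bar>x - y\<bar>) powr p * A"
      unfolding infsum_cmult_right' by (intro mult_left_mono A) simp
    finally show "(\<Sum>\<^sub>\<infinity>k::int. (1 + \<bar>real_of_int k - x\<bar>) powr p * decay (y - real_of_int k))
           \<le> A * (1 + \<bar>x - y\<bar>) powr p" by (simp add: mult.commute)
  qed
qed

text \<open>All series below are of this form: at level \<open>j\<close> the terms are concentrated around the two
  positions \<open>x j = 2^j t\<close> and \<open>y j = 2^j s\<close>, while the coefficients are controlled by the distance
  to \<open>x j\<close> alone. Absolute summability over pairs makes the order of summation irrelevant.\<close>

lemma double_sum_bound:
  fixes G :: "int \<Rightarrow> int \<Rightarrow> real" and b c :: "int \<Rightarrow> real"
  assumes A: "A \<ge> 0" "\<And>x y. (\<lambda>k::int. (1 + \<bar>real_of_int k - x\<bar>) powr p * decay (y - real_of_int k)) summable_on UNIV"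
       "\<And>x y. (\<Sum>\<^sub>\<infinity>k::int. (1 + \<bar>real_of_int k - x\<bar>) powr p * decay (y - real_of_int k))
           \<le> A * (1 + \<bar>x - y\<bar>) powr p"
    and p: "0 \<le> p"
    and c: "\<And>j. 0 \<le> c j"
    and G: "\<And>j k. \<bar>G j k\<bar> \<le> c j * (1 + \<bar>real_of_int k - x j\<bar>) powr p *
               (decay (y j - real_of_int k) + decay (x j - real_of_int k))"
    and b: "b summable_on UNIV" "\<And>j. c j * (1 + \<bar>x j - y j\<bar>) powr p \<le> b j"
  shows "(\<lambda>(j,k). G j k) summable_on UNIV"
    and "\<bar>\<Sum>\<^sub>\<infinity>(j,k). G j k\<bar> \<le> 2 * A * (\<Sum>\<^sub>\<infinity>j. b j)"
proof -
  define M where "M j k = c j * ((1 + \<bar>real_of_int k - x j\<bar>) powr p * decay (y j - real_of_int k)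
        + (1 + \<bar>real_of_int k - x j\<bar>) powr p * decay (x j - real_of_int k))" for j k
  have GM: "\<bar>G j k\<bar> \<le> M j k" for j k
    using G[of j k] by (simp add: M_def algebra_simps)
  have M0: "0 \<le> M j k" for j k using GM[of j k] by linarith
  have s: "M j summable_on UNIV" for j
    unfolding M_def by (intro summable_on_cmult_right summable_on_add A)
  have le: "(\<Sum>\<^sub>\<infinity>k. M j k) \<le> 2 * A * b j" for j
  proof -
    have "(\<Sum>\<^sub>\<infinity>k. M j k) = c j * ((\<Sum>\<^sub>\<infinity>k. (1 + \<bar>real_of_int k - x j\<bar>) powr p * decay (y j - real_of_int k))
        + (\<Sum>\<^sub>\<infinity>k. (1 + \<bar>real_of_int k - x j\<bar>) powr p * decay (x j - real_of_int k)))"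
      unfolding M_def by (subst infsum_cmult_right', subst infsum_add) (auto intro!: A)
    also have "\<dots> \<le> c j * (A * (1 + \<bar>x j - y j\<bar>) powr p + A * (1 + \<bar>x j - x j\<bar>) powr p)"
      by (intro mult_left_mono add_mono A c)
    also have "\<dots> \<le> c j * (A * (1 + \<bar>x j - y j\<bar>) powr p + A * (1 + \<bar>x j - y j\<bar>) powr p)"
      using p by (intro mult_left_mono add_mono powr_mono2 A c order_refl) auto
    also have "\<dots> = 2 * A * (c j * (1 + \<bar>x j - y j\<bar>) powr p)" by simp
    also have "\<dots> \<le> 2 * A * b j" by (intro mult_left_mono b) (use A in auto)
    finally show ?thesis .
  qed
  have sb: "(\<lambda>j. 2 * A * b j) summable_on UNIV" by (intro summable_on_cmult_right b)
  have sj: "(\<lambda>j. \<Sum>\<^sub>\<infinity>k. M j k) summable_on UNIV"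
    by (rule summable_on_comparison_test[OF sb le]) (auto intro: infsum_nonneg M0)
  have sM: "(\<lambda>(j,k). M j k) summable_on (UNIV \<times> UNIV)"
    by (rule summable_on_SigmaI[where g = "\<lambda>j. \<Sum>\<^sub>\<infinity>k. M j k"])
       (auto intro: sj M0 has_sum_infsum s)
  have absG: "(\<lambda>z. norm (case z of (j,k) \<Rightarrow> G j k)) summable_on (UNIV \<times> UNIV)"
    by (rule Infinite_Sum.abs_summable_on_comparison_test'[OF sM]) (auto simp: GM)
  then show "(\<lambda>(j,k). G j k) summable_on UNIV"
    by (simp add: abs_summable_summable)
  have "\<bar>\<Sum>\<^sub>\<infinity>(j,k)\<in>UNIV\<times>UNIV. G j k\<bar> \<le> (\<Sum>\<^sub>\<infinity>z\<in>UNIV\<times>UNIV. norm (case z of (j,k) \<Rightarrow> G j k))"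
    using norm_infsum_bound[OF absG] by simp
  also have "\<dots> \<le> (\<Sum>\<^sub>\<infinity>(j,k)\<in>UNIV\<times>UNIV. M j k)"
    by (rule infsum_mono[OF absG sM]) (auto simp: GM)
  also have "\<dots> = (\<Sum>\<^sub>\<infinity>j. \<Sum>\<^sub>\<infinity>k. M j k)"
    using infsum_Sigma'_banach[OF sM] by simp
  also have "\<dots> \<le> (\<Sum>\<^sub>\<infinity>j. 2 * A * b j)"
    by (rule infsum_mono[OF sj sb le])
  also have "\<dots> = 2 * A * (\<Sum>\<^sub>\<infinity>j. b j)"
    by (rule infsum_cmult_right')
  finally show "\<bar>\<Sum>\<^sub>\<infinity>(j,k). G j k\<bar> \<le> 2 * A * (\<Sum>\<^sub>\<infinity>j. b j)" by simp
qed

text \<open>The heart of the scaling argument. In terms of \<open>x = 2^j h\<close> the left-hand side is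
  \<open>h^\<theta> x^(-\<theta>) min 1 x (1 + x)^p\<close>, which is of order \<open>h^\<theta> x^(1 - \<theta>)\<close> for \<open>x \<le> 1\<close> and \<open>h^\<theta> x^(p - \<theta>)\<close>
  for \<open>x \<ge> 1\<close>; since \<open>1 - \<theta> \<ge> c\<close> and \<open>\<theta> - p \<ge> c\<close>, this is geometric decay on both sides once \<open>c > 0\<close>.\<close>

lemma dyadic_term_bound:
  fixes j :: int and h \<theta> a b p :: real
  assumes h: "h > 0" and \<theta>: "a \<le> \<theta>" "\<theta> \<le> b" and p: "0 \<le> p" "p \<le> 1" "p \<le> a - c" "c \<le> 1 - b"
  shows "2 powr (- (of_int j * \<theta>)) * min 1 (2 powi j * h) * (1 + 2 powi j * h) powr p
     \<le> 2 * h powr \<theta> * 2 powr (- c * \<bar>of_int j + log 2 h\<bar>)"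
proof -
  define x where "x = 2 powi j * h"
  define \<tau> where "\<tau> = of_int j + log 2 h"
  have x: "x = 2 powr \<tau>" 
    using h by (simp add: x_def \<tau>_def powr_add powr_real_of_int')
  have x0: "x > 0" using x by simp
  have j: "2 powr (- (of_int j * \<theta>)) = h powr \<theta> * x powr (- \<theta>)"
    using h by (simp add: x_def powr_mult powr_minus powr_real_of_int'[symmetric] powr_powr)
  have "x powr (- \<theta>) * (min 1 x * (1 + x) powr p) \<le> 2 * 2 powr (- c * \<bar>\<tau>\<bar>)"
  proof (cases "x \<le> 1")
    case True
    have "2 powr \<tau> \<le> 2 powr 0" using True x by simp
    then have \<tau>: "\<tau> \<le> 0" by (subst (asm) powr_le_cancel_iff) auto
    have "(1 + x) powr p \<le> 2 powr 1"
      using True x0 p by (intro order_trans[OF powr_mono2[of p "1+x" 2] powr_mono]) auto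
    then have "x powr (- \<theta>) * (min 1 x * (1 + x) powr p) \<le> x powr (-\<theta>) * (x * 2)"
      using True x0 by (intro mult_left_mono mult_mono) auto
    also have "\<dots> = 2 * (x powr (-\<theta>) * x powr 1)" using x0 by simp
    also have "\<dots> = 2 * 2 powr (\<tau> * (1 - \<theta>))"
      unfolding x by (simp add: powr_powr powr_add[symmetric] algebra_simps)
    also have "\<tau> * (1 - \<theta>) \<le> \<tau> * c" using \<tau> \<theta> p by (intro mult_left_mono_neg) auto
    finally show ?thesis using \<tau> by (simp add: mult.commute)
  next
    case False
    have "2 powr 0 \<le> 2 powr \<tau>" using False x by simp
    then have \<tau>: "\<tau> \<ge> 0" by (subst (asm) powr_le_cancel_iff) auto
    have "(1 + x) powr p \<le> (2 * x) powr p"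
      using False p by (intro powr_mono2) auto
    also have "\<dots> = 2 powr p * x powr p" using x0 by (simp add: powr_mult)
    also have "\<dots> \<le> 2 powr 1 * x powr p" using p by (intro mult_right_mono powr_mono) auto
    finally have "x powr (- \<theta>) * (min 1 x * (1 + x) powr p) \<le> x powr (-\<theta>) * (2 * x powr p)"
      using False x0 by (intro mult_left_mono) auto
    also have "\<dots> = 2 * 2 powr (\<tau> * (p - \<theta>))"
      unfolding x by (simp add: powr_powr powr_add[symmetric] algebra_simps)
    also have "\<tau> * (p - \<theta>) \<le> \<tau> * (-c)" using \<tau> \<theta> p by (intro mult_left_mono) auto
    finally show ?thesis using \<tau> by (simp add: mult.commute)
  qed
  then have "h powr \<theta> * (x powr (- \<theta>) * (min 1 x * (1 + x) powr p)) \<le> h powr \<theta> * (2 * 2 powr (- c * \<bar>\<tau>\<bar>))"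
    by (intro mult_left_mono) auto
  then show ?thesis unfolding j x_def[symmetric] \<tau>_def[symmetric] by (simp add: mult_ac)
qed

text \<open>The factor \<open>4 / (c * ln 2)\<close> comes from \<open>1 + v \<le> exp v\<close> with \<open>v = (c / 4) \<bar>u\<bar> ln 2\<close>.\<close>

lemma quadratic_le_powr:
  fixes c u :: real
  assumes "c > 0"
  shows "(1 + \<bar>u\<bar>)\<^sup>2 * 2 powr (- c * \<bar>u\<bar>)
           \<le> (max 1 (4 / (c * ln 2)))\<^sup>2 * 2 powr (- (c / 2) * \<bar>u\<bar>)"
proof -
  define K where "K = max 1 (4 / (c * ln 2))"
  have K: "K \<ge> 1" "K * (c / 4 * ln 2) \<ge> 1"
    using assms mult_right_mono[of "4 / (c * ln 2)" K "c / 4 * ln 2"] by (auto simp: K_def)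
  have "1 + \<bar>u\<bar> \<le> K * 1 + K * (c / 4 * ln 2) * \<bar>u\<bar>"
    using K mult_right_mono[OF K(2), of "\<bar>u\<bar>"] by (intro add_mono) auto
  also have "\<dots> = K * (1 + c / 4 * \<bar>u\<bar> * ln 2)" by (simp add: algebra_simps)
  also have "\<dots> \<le> K * 2 powr (c / 4 * \<bar>u\<bar>)"
    using K unfolding powr_def by (intro mult_left_mono) (auto simp: exp_ge_add_one_self)
  finally have "(1 + \<bar>u\<bar>)\<^sup>2 \<le> (K * 2 powr (c / 4 * \<bar>u\<bar>))\<^sup>2"
    by (intro power_mono) auto
  also have "\<dots> = K\<^sup>2 * 2 powr (c / 2 * \<bar>u\<bar>)"
    by (simp add: power_mult_distrib power2_eq_square powr_add[symmetric])
  finally have "(1 + \<bar>u\<bar>)\<^sup>2 * 2 powr (- c * \<bar>u\<bar>) \<le> K\<^sup>2 * 2 powr (c / 2 * \<bar>u\<bar>) * 2 powr (- c * \<bar>u\<bar>)"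
    by (intro mult_right_mono) auto
  then show ?thesis
    by (simp add: K_def[symmetric] mult.assoc powr_add[symmetric])
qed

lemma dyadic_lattice_sum:
  fixes c :: real
  assumes c: "c > 0"
  shows "\<exists>A\<ge>0. \<forall>\<tau>. (\<lambda>j::int. (1 + \<bar>real_of_int j + \<tau>\<bar>)\<^sup>2 * 2 powr (- c * \<bar>real_of_int j + \<tau>\<bar>)) summable_on UNIV
       \<and> (\<Sum>\<^sub>\<infinity>j::int. (1 + \<bar>real_of_int j + \<tau>\<bar>)\<^sup>2 * 2 powr (- c * \<bar>real_of_int j + \<tau>\<bar>)) \<le> A"
proof -
  define K where "K = (max 1 (4 / (c * ln 2)))\<^sup>2"
  define h where "h n = K * 2 powr (- (c / 2) * (real n - 1))" for n :: nat
  have K: "K \<ge> 0" by (simp add: K_def)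
  have "summable (\<lambda>n. K * 2 powr (c / 2) * (2 powr (- (c / 2))) ^ n)"
    using c by (intro summable_mult summable_geometric) (auto simp: powr_less_one)
  also have "(\<lambda>n. K * 2 powr (c / 2) * (2 powr (- (c / 2))) ^ n) = h"
  proof -
    have "2 powr d * (2 powr (- d)) ^ n = 2 powr (- d * (real n - 1))" for d :: real and n
      by (simp add: powr_power powr_add[symmetric] algebra_simps)
    then show ?thesis by (simp only: h_def fun_eq_iff mult.assoc) simp
  qed
  finally have h: "summable h" .
  show ?thesis
  proof (rule lattice_sum_bounded[OF h])
    fix k :: int and f :: real assume f: "0 \<le> f" "f < 1"
    have "real (nat \<bar>k\<bar>) - 1 \<le> \<bar>real_of_int k + f\<bar>"
      using f by (cases "k \<ge> 0") (auto simp: abs_if)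
    then have "K * 2 powr (- (c / 2) * \<bar>real_of_int k + f\<bar>) \<le> h (nat \<bar>k\<bar>)"
      unfolding h_def using c by (intro mult_left_mono powr_mono K mult_left_mono_neg) auto
    with quadratic_le_powr[OF c, of "real_of_int k + f"]
    show "(1 + \<bar>real_of_int k + f\<bar>)\<^sup>2 * 2 powr (- c * \<bar>real_of_int k + f\<bar>) \<le> h (nat \<bar>k\<bar>)"
      by (simp add: K_def)
  qed (use K in \<open>auto simp: h_def\<close>)
qed

section \<open>Increments of the field at a slow point\<close>

lemma powr_diff_bound:
  fixes u v :: real
  shows "\<bar>2 powr u - 2 powr v\<bar> \<le> \<bar>u - v\<bar> * (2 powr u + 2 powr v)"
proof -
  have main: "2 powr u - 2 powr v \<le> (u - v) * 2 powr u" if "v \<le> u" for u v :: real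
  proof -
    have ln2: "0 \<le> ln (2::real)" "ln (2::real) \<le> 1" using ln_2_less_1 by auto
    have "1 - (u - v) * ln 2 \<le> exp ((v - u) * ln 2)"
      using exp_ge_add_one_self[of "(v - u) * ln 2"] by (simp add: algebra_simps)
    also have "\<dots> = 2 powr v / 2 powr u"
      by (simp add: powr_def exp_diff[symmetric] algebra_simps)
    finally have "(1 - (u - v) * ln 2) * 2 powr u \<le> 2 powr v" by (simp add: field_simps)
    moreover have "(u - v) * ln 2 * 2 powr u \<le> (u - v) * 1 * 2 powr u"
      using that ln2 by (intro mult_right_mono mult_left_mono) auto
    ultimately show ?thesis by (simp add: algebra_simps)
  qed
  have main': "\<bar>2 powr u - 2 powr v\<bar> \<le> (u - v) * (2 powr u + 2 powr v)" if "v \<le> u" for u v :: real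
  proof -
    have "2 powr v \<le> 2 powr u" using that by simp
    moreover have "0 \<le> (u - v) * 2 powr v" using that by simp
    ultimately show ?thesis using main[OF that] unfolding distrib_left by linarith
  qed
  show ?thesis
  proof (cases "v \<le> u")
    case True
    then show ?thesis using main'[of v u] by simp
  next
    case False
    then show ?thesis using main'[of u v] by (simp add: abs_minus_commute add.commute)
  qed
qed

text \<open>The factor \<open>1 + max 0 (- j)\<close> leaves room for growth in \<open>\<bar>j\<bar>\<close> at the coarse levels, where it is
  harmless because these levels contribute to an increment only through \<open>2^j \<bar>s - t\<bar>\<close>.\<close>

definition slow_at :: "(int \<Rightarrow> int \<Rightarrow> real) \<Rightarrow> real \<Rightarrow> real \<Rightarrow> real \<Rightarrow> bool" where
  "slow_at e p \<mu> t \<longleftrightarrow>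
     (\<forall>j k. \<bar>e j k\<bar> \<le> \<mu> * (1 + real_of_int (max 0 (- j))) * (1 + \<bar>real_of_int k - 2 powi j * t\<bar>) powr p)"

lemma infsum_diff_real:
  fixes f g :: "'i \<Rightarrow> real"
  assumes "f summable_on A" "g summable_on A"
  shows "(\<lambda>x. f x - g x) summable_on A"
    and "infsum (\<lambda>x. f x - g x) A = infsum f A - infsum g A"
  using infsum_add[OF assms(1), of "\<lambda>x. - g x"] summable_on_add[OF assms(1), of "\<lambda>x. - g x"] assms(2)
  by (simp_all add: infsum_uminus summable_on_uminus)

text \<open>What the estimates need to know about \<open>\<Psi>\<close>: its increments in \<open>x\<close>, and the increments in \<open>x\<close> of its
  increments in \<open>\<theta>\<close>, are local.\<close>

locale wavelet_profile =
  fixes P :: "real \<Rightarrow> real \<Rightarrow> real" and C a b :: real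
  assumes range: "0 < a" "a \<le> b" "b < 1" and C: "0 \<le> C"
    and incr: "\<And>x y \<theta>. \<theta> \<in> {a..b} \<Longrightarrow>
      \<bar>P x \<theta> - P y \<theta>\<bar> \<le> C * min 1 \<bar>x - y\<bar> * (decay x + decay y)"
    and mixed: "\<And>x y \<theta> \<theta>'. \<theta> \<in> {a..b} \<Longrightarrow> \<theta>' \<in> {a..b} \<Longrightarrow>
      \<bar>(P x \<theta> - P y \<theta>) - (P x \<theta>' - P y \<theta>')\<bar> \<le> C * \<bar>\<theta> - \<theta>'\<bar> * min 1 \<bar>x - y\<bar> * (decay x + decay y)"
begin

definition field :: "(int \<Rightarrow> int \<Rightarrow> real) \<Rightarrow> real \<Rightarrow> real \<Rightarrow> real" where
  "field e s \<theta> = (\<Sum>\<^sub>\<infinity>j. \<Sum>\<^sub>\<infinity>k. 2 powr (- (real_of_int j * \<theta>)) * e j k *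
      (P (2 powi j * s - real_of_int k) \<theta> - P (- real_of_int k) \<theta>))"

definition increment :: "(int \<Rightarrow> int \<Rightarrow> real) \<Rightarrow> real \<Rightarrow> real \<Rightarrow> real \<Rightarrow> int \<Rightarrow> int \<Rightarrow> real" where
  "increment e t s \<theta> j k = 2 powr (- (real_of_int j * \<theta>)) * e j k *
      (P (2 powi j * s - real_of_int k) \<theta> - P (2 powi j * t - real_of_int k) \<theta>)"

text \<open>The increments are taken from the slow point \<open>t\<close>, because only there the coefficients are
  controlled by the distance \<open>\<bar>k - 2^j t\<bar>\<close>. The logarithm in the first bound comes from the
  factor \<open>1 + max 0 (- j)\<close> and disappears for \<open>\<bar>s - t\<bar> \<le> 1\<close>; the bound is used with \<open>\<bar>s - t\<bar> > 1\<close>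
  only to show that the series converges. In the second bound, differentiating \<open>2^(- j \<theta>)\<close> costs
  a factor \<open>\<bar>j\<bar>\<close>, which the geometric decay absorbs.\<close>

lemma increment_bounds:
  assumes p: "0 \<le> p" "p \<le> 1/2" "p < a" and \<mu>: "0 \<le> \<mu>" and slow: "slow_at e p \<mu> t"
  shows "\<exists>K\<ge>0. \<forall>s. \<forall>\<theta>\<in>{a..b}. (\<lambda>(j,k). increment e t s \<theta> j k) summable_on UNIV
      \<and> \<bar>\<Sum>\<^sub>\<infinity>(j,k). increment e t s \<theta> j k\<bar> \<le> K * (1 + max 0 (log 2 \<bar>s - t\<bar>)) * \<bar>s - t\<bar> powr \<theta>"
    (is ?A)
    and "1 \<le> T \<Longrightarrow> \<exists>K\<ge>0. \<forall>s. \<forall>\<theta>\<in>{a..b}. \<forall>\<theta>'\<in>{a..b}. \<bar>s - t\<bar> \<le> T \<longrightarrow>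
      \<bar>\<Sum>\<^sub>\<infinity>(j,k). (increment e t s \<theta> j k - increment e t s \<theta>' j k)\<bar> \<le> K * \<bar>\<theta> - \<theta>'\<bar>" (is "_ \<Longrightarrow> ?B")
proof -
  \<comment> \<open>the gain per level: \<open>1 - b\<close> for coarse levels, \<open>a - p\<close> for fine ones\<close>
  define c where "c = min (1 - b) (a - p)"
  have c: "c > 0" "p \<le> a - c" "c \<le> 1 - b" using p range by (auto simp: c_def)
  obtain A where A: "A \<ge> 0"
    "\<And>x y. (\<lambda>k::int. (1 + \<bar>real_of_int k - x\<bar>) powr p * decay (y - real_of_int k)) summable_on UNIV"
    "\<And>x y. (\<Sum>\<^sub>\<infinity>k::int. (1 + \<bar>real_of_int k - x\<bar>) powr p * decay (y - real_of_int k))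
           \<le> A * (1 + \<bar>x - y\<bar>) powr p"
    using weighted_lattice_sum[of p] p by auto
  define g where "g u = (1 + \<bar>u\<bar>)\<^sup>2 * 2 powr (- c * \<bar>u\<bar>)" for u :: real
  obtain A' where A': "A' \<ge> 0" "\<And>\<tau>. (\<lambda>j::int. g (real_of_int j + \<tau>)) summable_on UNIV"
     "\<And>\<tau>. (\<Sum>\<^sub>\<infinity>j::int. g (real_of_int j + \<tau>)) \<le> A'"
    using dyadic_lattice_sum[OF c(1)] unfolding g_def by auto
  define n where "n j = 1 + real_of_int (max 0 (- j))" for j
  have n0: "n j \<ge> 1" for j by (simp add: n_def)
  have slow': "\<bar>e j k\<bar> \<le> \<mu> * n j * (1 + \<bar>real_of_int k - 2 powi j * t\<bar>) powr p" for j k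
    using slow by (auto simp: slow_at_def n_def)
  have dist: "\<bar>2 powi j * t - 2 powi j * s\<bar> = 2 powi j * \<bar>s - t\<bar>" for j s
    by (simp add: right_diff_distrib[symmetric] abs_mult abs_minus_commute)
  have dist': "\<bar>2 powi j * s - real_of_int k - (2 powi j * t - real_of_int k)\<bar> = 2 powi j * \<bar>s - t\<bar>" for j s k
    by (simp add: right_diff_distrib[symmetric] abs_mult)
  show ?A
  proof (intro exI[of _ "4 * A * A' * \<mu> * C"] conjI allI ballI)
    show "0 \<le> 4 * A * A' * \<mu> * C" using A(1) A'(1) \<mu> C by simp
    fix s \<theta> assume \<theta>: "\<theta> \<in> {a..b}"
    have "(\<lambda>(j,k). increment e t s \<theta> j k) summable_on UNIV \<and>
       \<bar>\<Sum>\<^sub>\<infinity>(j,k). increment e t s \<theta> j k\<bar> \<le> 4 * A * A' * \<mu> * C * (1 + max 0 (log 2 \<bar>s - t\<bar>)) * \<bar>s - t\<bar> powr \<theta>"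
    proof (cases "s = t")
      case True
      then have "(\<lambda>(j,k). increment e t s \<theta> j k) = (\<lambda>_. 0)"
        by (auto simp: increment_def)
      then show ?thesis using True by simp
    next
      case False
      define h where "h = \<bar>s - t\<bar>"
      define \<tau> where "\<tau> = log 2 h"
      have h: "h > 0" using False by (simp add: h_def)
      define \<kappa> where "\<kappa> = 2 * \<mu> * C * (1 + max 0 \<tau>) * h powr \<theta>"
      have \<kappa>: "\<kappa> \<ge> 0" using \<mu> C by (simp add: \<kappa>_def)
      \<comment> \<open>what remains of the level-\<open>j\<close> terms without the weight and the two bumps\<close>
      define cc where "cc j = \<mu> * n j * C * (2 powr (- (real_of_int j * \<theta>)) * min 1 (2 powi j * h))" for j
      have cc0: "cc j \<ge> 0" for j using \<mu> C n0[of j] h by (auto simp: cc_def)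
      have inc: "\<bar>increment e t s \<theta> j k\<bar> \<le> cc j * (1 + \<bar>real_of_int k - 2 powi j * t\<bar>) powr p *
              (decay (2 powi j * s - real_of_int k) + decay (2 powi j * t - real_of_int k))" for j k
      proof -
        have "\<bar>increment e t s \<theta> j k\<bar> = 2 powr (- (real_of_int j * \<theta>)) * (\<bar>e j k\<bar> *
             \<bar>P (2 powi j * s - real_of_int k) \<theta> - P (2 powi j * t - real_of_int k) \<theta>\<bar>)"
          by (simp add: increment_def abs_mult)
        also have "\<dots> \<le> 2 powr (- (real_of_int j * \<theta>)) *
           ((\<mu> * n j * (1 + \<bar>real_of_int k - 2 powi j * t\<bar>) powr p) *
            (C * min 1 (2 powi j * h) * (decay (2 powi j * s - real_of_int k) + decay (2 powi j * t - real_of_int k))))"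
          using incr[OF \<theta>, of "2 powi j * s - real_of_int k" "2 powi j * t - real_of_int k"]
          unfolding dist' h_def[symmetric] using \<mu> n0[of j]
          by (intro mult_left_mono mult_mono slow') auto
        finally show ?thesis by (simp add: cc_def mult_ac)
      qed
      have nj: "n j \<le> (1 + max 0 \<tau>) * (1 + \<bar>real_of_int j + \<tau>\<bar>)\<^sup>2" for j
      proof -
        have "0 \<le> max 0 \<tau> * \<bar>real_of_int j + \<tau>\<bar>" by simp
        moreover have "n j \<le> 1 + max 0 \<tau> + \<bar>real_of_int j + \<tau>\<bar>"
          unfolding n_def by (auto simp: max_def)
        moreover have "m \<le> (1 + r) * (1 + q)" if "0 \<le> r * q" "m \<le> 1 + r + q" for m r q :: real
          using that by (simp add: algebra_simps)
        ultimately have "n j \<le> (1 + max 0 \<tau>) * (1 + \<bar>real_of_int j + \<tau>\<bar>)" by blast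
        also have "\<dots> \<le> (1 + max 0 \<tau>) * (1 + \<bar>real_of_int j + \<tau>\<bar>)\<^sup>2"
          by (intro mult_left_mono self_le_power) auto
        finally show ?thesis .
      qed
      have b: "cc j * (1 + \<bar>2 powi j * t - 2 powi j * s\<bar>) powr p \<le> \<kappa> * g (real_of_int j + \<tau>)" for j
      proof -
        have "cc j * (1 + \<bar>2 powi j * t - 2 powi j * s\<bar>) powr p = \<mu> * C * (n j *
           (2 powr (- (real_of_int j * \<theta>)) * min 1 (2 powi j * h) * (1 + 2 powi j * h) powr p))"
          unfolding dist h_def[symmetric] by (simp add: cc_def mult_ac)
        also have "\<dots> \<le> \<mu> * C * ((1 + max 0 \<tau>) * (1 + \<bar>real_of_int j + \<tau>\<bar>)\<^sup>2 *
            (2 * h powr \<theta> * 2 powr (- c * \<bar>real_of_int j + \<tau>\<bar>)))"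
        proof -
          have "2 powr (- (real_of_int j * \<theta>)) * min 1 (2 powi j * h) * (1 + 2 powi j * h) powr p
              \<le> 2 * h powr \<theta> * 2 powr (- c * \<bar>real_of_int j + \<tau>\<bar>)"
            unfolding \<tau>_def by (rule dyadic_term_bound[OF h, of a \<theta> b p c j]) (use \<theta> p c in auto)
          then show ?thesis using \<mu> C h
            by (intro mult_left_mono mult_mono[OF nj]) auto
        qed
        also have "\<dots> = \<kappa> * g (real_of_int j + \<tau>)" by (simp add: \<kappa>_def g_def mult_ac)
        finally show ?thesis .
      qed
      note ds = double_sum_bound[OF A p(1) cc0 inc summable_on_cmult_right[OF A'(2)] b]
      have "\<bar>\<Sum>\<^sub>\<infinity>(j,k). increment e t s \<theta> j k\<bar> \<le> 2 * A * (\<Sum>\<^sub>\<infinity>j::int. \<kappa> * g (real_of_int j + \<tau>))"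
        by (rule ds(2))
      also have "\<dots> \<le> 2 * A * (\<kappa> * A')"
        unfolding infsum_cmult_right' by (intro mult_left_mono A' \<kappa>) (use A in auto)
      finally show ?thesis using ds(1) by (simp add: \<kappa>_def h_def \<tau>_def algebra_simps)
    qed
    then show "(\<lambda>(j,k). increment e t s \<theta> j k) summable_on UNIV"
      "\<bar>\<Sum>\<^sub>\<infinity>(j,k). increment e t s \<theta> j k\<bar> \<le> 4 * A * A' * \<mu> * C * (1 + max 0 (log 2 \<bar>s - t\<bar>)) * \<bar>s - t\<bar> powr \<theta>"
      by auto
  qed
  assume T: "1 \<le> T"
  define \<tau> where "\<tau> = log 2 T"
  have \<tau>: "\<tau> \<ge> 0" using T by (simp add: \<tau>_def)
  define L where "L = \<mu> * C * (1 + \<tau>)\<^sup>2 * (4 * T)"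
  have L: "L \<ge> 0" using \<mu> C T by (simp add: L_def)
  show ?B
  proof (intro exI[of _ "2 * A * (L * A')"] conjI allI ballI impI)
    show "0 \<le> 2 * A * (L * A')" using A(1) A'(1) L by simp
    fix s \<theta> \<theta>' assume \<theta>: "\<theta> \<in> {a..b}" and \<theta>': "\<theta>' \<in> {a..b}" and sT: "\<bar>s - t\<bar> \<le> T"
    define v where "v \<theta> j = 2 powr (- (real_of_int j * \<theta>))" for \<theta> j
    define cc where "cc j = \<mu> * n j * (C * \<bar>\<theta> - \<theta>'\<bar> * (1 + \<bar>real_of_int j\<bar>)) * ((v \<theta> j + v \<theta>' j) * min 1 (2 powi j * T))" for j
    have v0: "v \<theta> j \<ge> 0" for \<theta> j by (simp add: v_def)
    have cc0: "cc j \<ge> 0" for j using \<mu> C n0[of j] T v0 by (auto simp: cc_def)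
    have inc: "\<bar>increment e t s \<theta> j k - increment e t s \<theta>' j k\<bar> \<le> cc j * (1 + \<bar>real_of_int k - 2 powi j * t\<bar>) powr p *
              (decay (2 powi j * s - real_of_int k) + decay (2 powi j * t - real_of_int k))" for j k
    proof -
      define D where "D \<theta> = P (2 powi j * s - real_of_int k) \<theta> - P (2 powi j * t - real_of_int k) \<theta>" for \<theta>
      define dd where "dd = decay (2 powi j * s - real_of_int k) + decay (2 powi j * t - real_of_int k)"
      have dd: "dd \<ge> 0" unfolding dd_def by (simp add: decay_pos less_imp_le add_nonneg_nonneg)
      define m where "m = min 1 (2 powi j * T)"
      have m: "min 1 (2 powi j * \<bar>s - t\<bar>) \<le> m" unfolding m_def using sT
        by (intro min.mono mult_left_mono) auto
      have m0: "m \<ge> 0" using T by (simp add: m_def)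
      have D: "\<bar>D \<theta>\<bar> \<le> C * m * dd"
        using incr[OF \<theta>, of "2 powi j * s - real_of_int k" "2 powi j * t - real_of_int k"]
        unfolding dist' D_def[symmetric] dd_def[symmetric]
        by (rule order_trans) (intro mult_right_mono mult_left_mono m C dd)
      have DD: "\<bar>D \<theta> - D \<theta>'\<bar> \<le> C * \<bar>\<theta> - \<theta>'\<bar> * m * dd"
        using mixed[OF \<theta> \<theta>', of "2 powi j * s - real_of_int k" "2 powi j * t - real_of_int k"]
        unfolding dist' D_def[symmetric] dd_def[symmetric]
        by (rule order_trans) (intro mult_right_mono mult_left_mono m dd, use C in auto)
      have vv: "\<bar>v \<theta> j - v \<theta>' j\<bar> \<le> \<bar>real_of_int j\<bar> * \<bar>\<theta> - \<theta>'\<bar> * (v \<theta> j + v \<theta>' j)"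
        using powr_diff_bound[of "- (real_of_int j * \<theta>)" "- (real_of_int j * \<theta>')"]
        by (simp add: v_def abs_mult[symmetric] right_diff_distrib abs_minus_commute)
      have "v \<theta> j * D \<theta> - v \<theta>' j * D \<theta>' = (v \<theta> j - v \<theta>' j) * D \<theta> + v \<theta>' j * (D \<theta> - D \<theta>')"
        by (simp add: algebra_simps)
      then have "\<bar>v \<theta> j * D \<theta> - v \<theta>' j * D \<theta>'\<bar> \<le> \<bar>v \<theta> j - v \<theta>' j\<bar> * \<bar>D \<theta>\<bar> + v \<theta>' j * \<bar>D \<theta> - D \<theta>'\<bar>"
        using abs_triangle_ineq[of "(v \<theta> j - v \<theta>' j) * D \<theta>" "v \<theta>' j * (D \<theta> - D \<theta>')"] v0[of \<theta>' j]
        by (simp add: abs_mult)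
      also have "\<dots> \<le> (\<bar>real_of_int j\<bar> * \<bar>\<theta> - \<theta>'\<bar> * (v \<theta> j + v \<theta>' j)) * (C * m * dd) + (v \<theta> j + v \<theta>' j) * (C * \<bar>\<theta> - \<theta>'\<bar> * m * dd)"
        by (intro add_mono mult_mono vv D DD) (use v0 C m0 dd in auto)
      also have "\<dots> = (C * \<bar>\<theta> - \<theta>'\<bar> * (1 + \<bar>real_of_int j\<bar>)) * ((v \<theta> j + v \<theta>' j) * m) * dd"
        by (simp add: algebra_simps)
      finally have *: "\<bar>v \<theta> j * D \<theta> - v \<theta>' j * D \<theta>'\<bar> \<le> \<dots>" .
      have "\<bar>increment e t s \<theta> j k - increment e t s \<theta>' j k\<bar> = \<bar>e j k\<bar> * \<bar>v \<theta> j * D \<theta> - v \<theta>' j * D \<theta>'\<bar>"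
        unfolding increment_def D_def[symmetric] v_def[symmetric]
        by (simp add: abs_mult[symmetric] right_diff_distrib mult_ac)
      also have "\<dots> \<le> (\<mu> * n j * (1 + \<bar>real_of_int k - 2 powi j * t\<bar>) powr p) * ((C * \<bar>\<theta> - \<theta>'\<bar> * (1 + \<bar>real_of_int j\<bar>)) * ((v \<theta> j + v \<theta>' j) * m) * dd)"
        by (intro mult_mono slow' *) (use \<mu> n0[of j] in auto)
      finally show ?thesis by (simp add: cc_def m_def dd_def mult_ac)
    qed
    have nj: "n j * (1 + \<bar>real_of_int j\<bar>) \<le> (1 + \<tau>)\<^sup>2 * (1 + \<bar>real_of_int j + \<tau>\<bar>)\<^sup>2" for j
    proof -
      have "0 \<le> \<tau> * \<bar>real_of_int j + \<tau>\<bar>" using \<tau> by simp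
      moreover have "1 + \<bar>real_of_int j\<bar> \<le> 1 + \<tau> + \<bar>real_of_int j + \<tau>\<bar>" using \<tau> by linarith
      moreover have "m \<le> (1 + r) * (1 + q)" if "0 \<le> r * q" "m \<le> 1 + r + q" for m r q :: real
        using that by (simp add: algebra_simps)
      ultimately have 1: "1 + \<bar>real_of_int j\<bar> \<le> (1 + \<tau>) * (1 + \<bar>real_of_int j + \<tau>\<bar>)" by blast
      have "n j \<le> 1 + \<bar>real_of_int j\<bar>" by (auto simp: n_def)
      then have "n j * (1 + \<bar>real_of_int j\<bar>) \<le> ((1 + \<tau>) * (1 + \<bar>real_of_int j + \<tau>\<bar>)) * ((1 + \<tau>) * (1 + \<bar>real_of_int j + \<tau>\<bar>))"
        using 1 \<tau> by (intro mult_mono) auto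
      then show ?thesis by (simp add: power2_eq_square mult_ac)
    qed
    have b: "cc j * (1 + \<bar>2 powi j * t - 2 powi j * s\<bar>) powr p \<le> (L * \<bar>\<theta> - \<theta>'\<bar>) * g (real_of_int j + \<tau>)" for j
    proof -
      have vb: "v \<theta> j * min 1 (2 powi j * T) * (1 + 2 powi j * T) powr p \<le> 2 * T * 2 powr (- c * \<bar>real_of_int j + \<tau>\<bar>)"
        if "\<theta> \<in> {a..b}" for \<theta>
      proof -
        have "v \<theta> j * min 1 (2 powi j * T) * (1 + 2 powi j * T) powr p \<le> 2 * T powr \<theta> * 2 powr (- c * \<bar>real_of_int j + \<tau>\<bar>)"
          unfolding v_def \<tau>_def by (rule dyadic_term_bound[of T a \<theta> b p c j]) (use that T p c range in auto)
        also have "\<dots> \<le> 2 * T powr 1 * 2 powr (- c * \<bar>real_of_int j + \<tau>\<bar>)"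
          using that T range by (intro mult_right_mono mult_left_mono powr_mono) auto
        finally show ?thesis using T by simp
      qed
      have "cc j * (1 + \<bar>2 powi j * t - 2 powi j * s\<bar>) powr p \<le> cc j * (1 + 2 powi j * T) powr p"
        unfolding dist using sT p by (intro mult_left_mono cc0 powr_mono2 add_left_mono) auto
      also have "\<dots> = \<mu> * C * \<bar>\<theta> - \<theta>'\<bar> * ((n j * (1 + \<bar>real_of_int j\<bar>)) *
         (v \<theta> j * min 1 (2 powi j * T) * (1 + 2 powi j * T) powr p + v \<theta>' j * min 1 (2 powi j * T) * (1 + 2 powi j * T) powr p))"
        by (simp add: cc_def algebra_simps)
      also have "\<dots> \<le> \<mu> * C * \<bar>\<theta> - \<theta>'\<bar> * (((1 + \<tau>)\<^sup>2 * (1 + \<bar>real_of_int j + \<tau>\<bar>)\<^sup>2) *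
         (2 * T * 2 powr (- c * \<bar>real_of_int j + \<tau>\<bar>) + 2 * T * 2 powr (- c * \<bar>real_of_int j + \<tau>\<bar>)))"
        by (intro mult_left_mono mult_mono add_mono nj vb \<theta> \<theta>') (use \<mu> C v0 T in auto)
      also have "\<dots> = (L * \<bar>\<theta> - \<theta>'\<bar>) * g (real_of_int j + \<tau>)" by (simp add: L_def g_def mult_ac)
      finally show ?thesis .
    qed
    note ds = double_sum_bound[OF A p(1) cc0 inc summable_on_cmult_right[OF A'(2)] b]
    have "\<bar>\<Sum>\<^sub>\<infinity>(j,k). (increment e t s \<theta> j k - increment e t s \<theta>' j k)\<bar> \<le> 2 * A * (\<Sum>\<^sub>\<infinity>j::int. L * \<bar>\<theta> - \<theta>'\<bar> * g (real_of_int j + \<tau>))"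
      by (rule ds(2))
    also have "\<dots> \<le> 2 * A * (L * \<bar>\<theta> - \<theta>'\<bar> * A')"
      unfolding infsum_cmult_right' by (intro mult_left_mono A') (use A L in auto)
    finally show "\<bar>\<Sum>\<^sub>\<infinity>(j,k). (increment e t s \<theta> j k - increment e t s \<theta>' j k)\<bar> \<le> 2 * A * (L * A') * \<bar>\<theta> - \<theta>'\<bar>"
      by (simp add: mult_ac)
  qed
qed

text \<open>The series for \<open>B(s, \<theta>)\<close> is the difference of the increments from \<open>t\<close> to \<open>s\<close> and from \<open>t\<close> to \<open>0\<close>, so
  that both estimates follow from the bounds on increments based at \<open>t\<close>.\<close>

theorem field_at_slow_point:
  assumes p: "0 \<le> p" "p \<le> 1/2" "p < a" and \<mu>: "0 \<le> \<mu>" and slow: "slow_at e p \<mu> t"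
  shows "\<exists>K\<ge>0. \<forall>s. \<bar>s - t\<bar> \<le> 1 \<longrightarrow> (\<forall>\<theta>\<in>{a..b}. \<bar>field e s \<theta> - field e t \<theta>\<bar> \<le> K * \<bar>s - t\<bar> powr \<theta>
       \<and> (\<forall>\<theta>'\<in>{a..b}. \<bar>field e s \<theta> - field e s \<theta>'\<bar> \<le> K * \<bar>\<theta> - \<theta>'\<bar>))"
proof -
  let ?I = "\<lambda>s \<theta> (j,k). increment e t s \<theta> j k"
  obtain K1 where K1: "K1 \<ge> 0" "\<And>s \<theta>. \<theta> \<in> {a..b} \<Longrightarrow> ?I s \<theta> summable_on UNIV"
    "\<And>s \<theta>. \<theta> \<in> {a..b} \<Longrightarrow> \<bar>infsum (?I s \<theta>) UNIV\<bar> \<le> K1 * (1 + max 0 (log 2 \<bar>s - t\<bar>)) * \<bar>s - t\<bar> powr \<theta>"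
    using increment_bounds(1)[OF p \<mu> slow] by blast
  obtain K2 where K2: "K2 \<ge> 0" 
    "\<And>s \<theta> \<theta>'. \<theta> \<in> {a..b} \<Longrightarrow> \<theta>' \<in> {a..b} \<Longrightarrow> \<bar>s - t\<bar> \<le> 1 + \<bar>t\<bar> \<Longrightarrow> 
       \<bar>\<Sum>\<^sub>\<infinity>(j,k). (increment e t s \<theta> j k - increment e t s \<theta>' j k)\<bar> \<le> K2 * \<bar>\<theta> - \<theta>'\<bar>"
    using increment_bounds(2)[OF p \<mu> slow, of "1 + \<bar>t\<bar>"] by auto
  have K2': "\<bar>infsum (?I s \<theta>) UNIV - infsum (?I s \<theta>') UNIV\<bar> \<le> K2 * \<bar>\<theta> - \<theta>'\<bar>"
    if "\<theta> \<in> {a..b}" "\<theta>' \<in> {a..b}" "\<bar>s - t\<bar> \<le> 1 + \<bar>t\<bar>" for s \<theta> \<theta>'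
  proof -
    have "infsum (?I s \<theta>) UNIV - infsum (?I s \<theta>') UNIV = infsum (\<lambda>z. ?I s \<theta> z - ?I s \<theta>' z) UNIV"
      using infsum_diff_real(2)[OF K1(2) K1(2)] that by simp
    also have "(\<lambda>z. ?I s \<theta> z - ?I s \<theta>' z) = (\<lambda>(j,k). increment e t s \<theta> j k - increment e t s \<theta>' j k)"
      by auto
    finally show ?thesis using K2(2)[OF that] by simp
  qed
  have field: "field e s \<theta> = infsum (?I s \<theta>) UNIV - infsum (?I 0 \<theta>) UNIV" if \<theta>: "\<theta> \<in> {a..b}" for s \<theta>
  proof -
    have eq: "2 powr (- (real_of_int j * \<theta>)) * e j k *
      (P (2 powi j * s - real_of_int k) \<theta> - P (- real_of_int k) \<theta>) = ?I s \<theta> (j,k) - ?I 0 \<theta> (j,k)" for j k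
      by (simp add: increment_def algebra_simps)
    have "(\<lambda>z. ?I s \<theta> z - ?I 0 \<theta> z) summable_on UNIV"
      by (intro infsum_diff_real(1) K1 \<theta>)
    then have "(\<lambda>z. ?I s \<theta> z - ?I 0 \<theta> z) summable_on (UNIV \<times> UNIV)" by simp
    from infsum_Sigma_banach[OF this]
    have "field e s \<theta> = infsum (\<lambda>z. ?I s \<theta> z - ?I 0 \<theta> z) UNIV"
      unfolding field_def eq by simp
    then show ?thesis using infsum_diff_real(2)[OF K1(2) K1(2)] \<theta> by simp
  qed
  have zero: "infsum (?I t \<theta>) UNIV = 0" for \<theta>
  proof -
    have "?I t \<theta> = (\<lambda>_. 0)" by (auto simp: increment_def)
    then show ?thesis by simp
  qed
  show ?thesis
  proof (intro exI[of _ "K1 + 2 * K2"] conjI allI ballI impI)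
    show "0 \<le> K1 + 2 * K2" using K1(1) K2(1) by simp
    fix s \<theta> assume s: "\<bar>s - t\<bar> \<le> 1" and \<theta>: "\<theta> \<in> {a..b}"
    have "ln \<bar>s - t\<bar> \<le> 0" using s by (cases "s = t") simp_all
    then have "log 2 \<bar>s - t\<bar> \<le> 0" by (simp add: log_def divide_nonpos_pos)
    then have "\<bar>infsum (?I s \<theta>) UNIV\<bar> \<le> K1 * \<bar>s - t\<bar> powr \<theta>"
      using K1(3)[OF \<theta>, of s] by (simp only: max_absorb1) simp
    also have "\<dots> \<le> (K1 + 2 * K2) * \<bar>s - t\<bar> powr \<theta>"
      using K2(1) by (intro mult_right_mono) auto
    finally show "\<bar>field e s \<theta> - field e t \<theta>\<bar> \<le> (K1 + 2 * K2) * \<bar>s - t\<bar> powr \<theta>"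
      by (simp add: field[OF \<theta>] zero)
    fix \<theta>' assume \<theta>': "\<theta>' \<in> {a..b}"
    have "\<bar>infsum (?I s \<theta>) UNIV - infsum (?I s \<theta>') UNIV\<bar> \<le> K2 * \<bar>\<theta> - \<theta>'\<bar>"
      "\<bar>infsum (?I 0 \<theta>) UNIV - infsum (?I 0 \<theta>') UNIV\<bar> \<le> K2 * \<bar>\<theta> - \<theta>'\<bar>"
      using s by (auto intro!: K2' \<theta> \<theta>')
    moreover have "0 \<le> K1 * \<bar>\<theta> - \<theta>'\<bar>" using K1(1) by simp
    ultimately show "\<bar>field e s \<theta> - field e s \<theta>'\<bar> \<le> (K1 + 2 * K2) * \<bar>\<theta> - \<theta>'\<bar>"
      unfolding field[OF \<theta>] field[OF \<theta>'] by (simp add: algebra_simps)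
  qed
qed

end

section \<open>A calculus of second differences\<close>

text \<open>A derivative-free substitute for a bound on the \<open>C\<^sup>2\<close>-norm. It is stable under products and
  under superposition of characters, so that it applies to Fourier transforms without
  differentiating under the integral.\<close>

definition C2_bound :: "real set \<Rightarrow> real \<Rightarrow> (real \<Rightarrow> complex) \<Rightarrow> bool" where
  "C2_bound S A f \<longleftrightarrow>
     (\<forall>x\<in>S. norm (f x) \<le> A) \<and>
     (\<forall>x\<in>S. \<forall>y\<in>S. norm (f x - f y) \<le> A * \<bar>x - y\<bar>) \<and>
     (\<forall>x h. x \<in> S \<and> x + h \<in> S \<and> x - h \<in> S \<longrightarrow> norm (f (x + h) + f (x - h) - 2 * f x) \<le> A * h\<^sup>2)"

lemma C2_boundD:
  assumes "C2_bound S A f"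
  shows "x \<in> S \<Longrightarrow> norm (f x) \<le> A"
    and "x \<in> S \<Longrightarrow> y \<in> S \<Longrightarrow> norm (f x - f y) \<le> A * \<bar>x - y\<bar>"
    and "x \<in> S \<Longrightarrow> x + h \<in> S \<Longrightarrow> x - h \<in> S \<Longrightarrow> norm (f (x + h) + f (x - h) - 2 * f x) \<le> A * h\<^sup>2"
  using assms by (auto simp: C2_bound_def)

lemma C2_bound_mono:
  assumes f: "C2_bound S A f" and AB: "A \<le> B" and TS: "T \<subseteq> S"
  shows "C2_bound T B f"
proof -
  note F = C2_boundD[OF f]
  show ?thesis unfolding C2_bound_def
  proof (intro conjI ballI allI impI)
    fix x assume "x \<in> T"
    then show "norm (f x) \<le> B" using F(1)[of x] AB TS by auto
    fix y assume "y \<in> T"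
    then have "norm (f x - f y) \<le> A * \<bar>x - y\<bar>" using F(2) TS \<open>x \<in> T\<close> by blast
    also have "\<dots> \<le> B * \<bar>x - y\<bar>" using AB by (intro mult_right_mono) auto
    finally show "norm (f x - f y) \<le> B * \<bar>x - y\<bar>" .
  next
    fix x h assume "x \<in> T \<and> x + h \<in> T \<and> x - h \<in> T"
    then have "norm (f (x + h) + f (x - h) - 2 * f x) \<le> A * h\<^sup>2" using F(3) TS by blast
    also have "\<dots> \<le> B * h\<^sup>2" using AB by (intro mult_right_mono) auto
    finally show "norm (f (x + h) + f (x - h) - 2 * f x) \<le> B * h\<^sup>2" .
  qed
qed

lemma C2_bound_nonneg: "C2_bound S A f \<Longrightarrow> x \<in> S \<Longrightarrow> 0 \<le> A"
  using C2_boundD(1)[of S A f x] norm_ge_zero[of "f x"] by linarith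

lemma C2_bound_cong: "C2_bound S A f \<Longrightarrow> (\<And>x. x \<in> S \<Longrightarrow> f x = g x) \<Longrightarrow> C2_bound S A g"
  unfolding C2_bound_def by simp

lemma second_difference_product:
  fixes a b c d u v :: "'a::comm_ring"
  shows "a * b + c * d - (u * v + u * v)
    = (a + c - (u + u)) * v + u * (b + d - (v + v)) + (a - u) * (b - v) + (c - u) * (d - v)"
  by (simp add: algebra_simps)

text \<open>A discrete Leibniz rule: the second difference of a product consists of two second
  differences and two products of first differences.\<close>

lemma C2_bound_mult:
  assumes f: "C2_bound S A f" and g: "C2_bound S B g"
  shows "C2_bound S (4 * A * B) (\<lambda>x. f x * g x)"
proof (cases "S = {}")
  case False
  then have A: "A \<ge> 0" and B: "B \<ge> 0" using f g C2_bound_nonneg by auto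
  note F = C2_boundD[OF f] and G = C2_boundD[OF g]
  show ?thesis unfolding C2_bound_def
  proof (intro conjI ballI allI impI)
    fix x assume x: "x \<in> S"
    have "norm (f x * g x) \<le> A * B" unfolding norm_mult
      by (intro mult_mono F G x A) auto
    also have "\<dots> \<le> 4 * A * B" using A B by simp
    finally show "norm (f x * g x) \<le> 4 * A * B" .
    fix y assume y: "y \<in> S"
    have "f x * g x - f y * g y = f x * (g x - g y) + (f x - f y) * g y" by (simp add: algebra_simps)
    also have "norm \<dots> \<le> norm (f x) * norm (g x - g y) + norm (f x - f y) * norm (g y)"
      unfolding norm_mult[symmetric] by (rule norm_triangle_ineq)
    also have "\<dots> \<le> A * (B * \<bar>x - y\<bar>) + (A * \<bar>x - y\<bar>) * B"
      by (intro add_mono mult_mono F G x y A mult_nonneg_nonneg) auto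
    also have "\<dots> \<le> 4 * A * B * \<bar>x - y\<bar>" using A B by (simp add: mult_ac)
    finally show "norm (f x * g x - f y * g y) \<le> 4 * A * B * \<bar>x - y\<bar>" .
  next
    fix x h assume x: "x \<in> S \<and> x + h \<in> S \<and> x - h \<in> S"
    have eq: "f (x + h) * g (x + h) + f (x - h) * g (x - h) - 2 * (f x * g x)
       = (f (x + h) + f (x - h) - 2 * f x) * g x + f x * (g (x + h) + g (x - h) - 2 * g x)
        + (f (x + h) - f x) * (g (x + h) - g x) + (f (x - h) - f x) * (g (x - h) - g x)"
      unfolding mult_2 by (rule second_difference_product)
    have "norm (f (x + h) * g (x + h) + f (x - h) * g (x - h) - 2 * (f x * g x)) \<le> norm (f (x + h) + f (x - h) - 2 * f x) * norm (g x) + norm (f x) * norm (g (x + h) + g (x - h) - 2 * g x)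
        + norm (f (x + h) - f x) * norm (g (x + h) - g x) + norm (f (x - h) - f x) * norm (g (x - h) - g x)"
      unfolding eq norm_mult[symmetric] by (intro norm_triangle_mono order_refl)
    also have "\<dots> \<le> A * B * h\<^sup>2 + A * B * h\<^sup>2 + A * B * h\<^sup>2 + A * B * h\<^sup>2"
    proof -
      have xS: "x \<in> S" "x + h \<in> S" "x - h \<in> S" using x by auto
      have sq: "(A * \<bar>k\<bar>) * (B * \<bar>k\<bar>) = A * B * k\<^sup>2" for k :: real
        unfolding power2_abs[of k, symmetric] power2_eq_square by (simp only: mult_ac)
      have Ah: "0 \<le> A * h\<^sup>2" "0 \<le> A * \<bar>h\<bar>" using A by simp_all
      have 1: "norm (f (x + h) + f (x - h) - 2 * f x) * norm (g x) \<le> (A * h\<^sup>2) * B"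
        by (rule mult_mono[OF F(3)[OF xS] G(1)[OF xS(1)] Ah(1) norm_ge_zero])
      have 2: "norm (f x) * norm (g (x + h) + g (x - h) - 2 * g x) \<le> A * (B * h\<^sup>2)"
        by (rule mult_mono[OF F(1)[OF xS(1)] G(3)[OF xS] A norm_ge_zero])
      have 3: "norm (f (x + h) - f x) * norm (g (x + h) - g x) \<le> (A * \<bar>h\<bar>) * (B * \<bar>h\<bar>)"
        using mult_mono[OF F(2)[OF xS(2,1)] G(2)[OF xS(2,1)] _ norm_ge_zero] Ah(2) by simp
      have 4: "norm (f (x - h) - f x) * norm (g (x - h) - g x) \<le> (A * \<bar>h\<bar>) * (B * \<bar>h\<bar>)"
        using mult_mono[OF F(2)[OF xS(3,1)] G(2)[OF xS(3,1)] _ norm_ge_zero] Ah(2) by simp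
      have 5: "(A * h\<^sup>2) * B = A * B * h\<^sup>2" "A * (B * h\<^sup>2) = A * B * h\<^sup>2" by simp_all
      show ?thesis by (rule add_mono[OF add_mono[OF add_mono[OF 1[unfolded 5] 2[unfolded 5]] 3[unfolded sq]] 4[unfolded sq]])
    qed
    also have "\<dots> = 4 * A * B * h\<^sup>2" by simp
    finally show "norm (f (x + h) * g (x + h) + f (x - h) * g (x - h) - 2 * (f x * g x)) \<le> 4 * A * B * h\<^sup>2" .
  qed
qed (simp add: C2_bound_def)

lemma C2_bound_reflect:
  assumes "C2_bound S A f"
  shows "C2_bound {x. - x \<in> S} A (\<lambda>x. f (- x))"
  unfolding C2_bound_def
proof (intro conjI ballI allI impI)
  fix x assume x: "x \<in> {x. - x \<in> S}"
  then show "norm (f (- x)) \<le> A" using C2_boundD(1)[OF assms] by auto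
  fix y assume y: "y \<in> {x. - x \<in> S}"
  show "norm (f (- x) - f (- y)) \<le> A * \<bar>x - y\<bar>"
    using C2_boundD(2)[OF assms, of "- x" "- y"] x y by (simp add: abs_minus_commute)
next
  fix x h assume "x \<in> {x. - x \<in> S} \<and> x + h \<in> {x. - x \<in> S} \<and> x - h \<in> {x. - x \<in> S}"
  then have "norm (f (- x + h) + f (- x - h) - 2 * f (- x)) \<le> A * h\<^sup>2"
    by (intro C2_boundD(3)[OF assms]) simp_all
  moreover have "- (x + h) = - x - h" "- (x - h) = - x + h" by simp_all
  ultimately show "norm (f (- (x + h)) + f (- (x - h)) - 2 * f (- x)) \<le> A * h\<^sup>2"
    by (simp only: add.commute)
qed

lemma C2_bound_of_derivatives:
  fixes f f' f'' :: "real \<Rightarrow> real"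
  assumes d1: "\<And>x. x \<in> {l..u} \<Longrightarrow> (f has_real_derivative f' x) (at x)"
    and d2: "\<And>x. x \<in> {l..u} \<Longrightarrow> (f' has_real_derivative f'' x) (at x)"
    and b: "\<And>x. x \<in> {l..u} \<Longrightarrow> \<bar>f x\<bar> \<le> A" "\<And>x. x \<in> {l..u} \<Longrightarrow> \<bar>f' x\<bar> \<le> A" "\<And>x. x \<in> {l..u} \<Longrightarrow> \<bar>f'' x\<bar> \<le> A"
  shows "C2_bound {l..u} (2 * A) (\<lambda>x. complex_of_real (f x))"
proof (cases "l \<le> u")
  case True
  then have A: "A \<ge> 0" using b(1)[of l] by auto
  have lip: "\<bar>f x - f y\<bar> \<le> A * \<bar>x - y\<bar>" if "x \<in> {l..u}" "y \<in> {l..u}" for x y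
    using field_differentiable_bound[OF convex_real_interval(5) has_field_derivative_at_within[OF d1], of l u A x y]
      that b(2) by simp
  have lip': "\<bar>f' x - f' y\<bar> \<le> A * \<bar>x - y\<bar>" if "x \<in> {l..u}" "y \<in> {l..u}" for x y
    using field_differentiable_bound[OF convex_real_interval(5) has_field_derivative_at_within[OF d2], of l u A x y]
      that b(3) by simp
  have second: "\<bar>f (x + h) + f (x - h) - 2 * f x\<bar> \<le> 2 * A * h\<^sup>2"
    if x: "x + h \<in> {l..u}" "x - h \<in> {l..u}" and h: "0 < h" for x h
  proof -
    have "\<exists>z. x < z \<and> z < x + h \<and> f (x + h) - f x = (x + h - x) * f' z"
      by (rule MVT2) (use x h in \<open>auto intro!: d1\<close>)
    then obtain z1 where z1: "x < z1" "z1 < x + h" "f (x + h) - f x = h * f' z1" by auto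
    have "\<exists>z. x - h < z \<and> z < x \<and> f x - f (x - h) = (x - (x - h)) * f' z"
      by (rule MVT2) (use x h in \<open>auto intro!: d1\<close>)
    then obtain z2 where z2: "x - h < z2" "z2 < x" "f x - f (x - h) = h * f' z2" by auto
    have "f (x + h) + f (x - h) - 2 * f x = h * (f' z1 - f' z2)"
      using z1 z2 by (simp add: algebra_simps)
    then have "\<bar>f (x + h) + f (x - h) - 2 * f x\<bar> = h * \<bar>f' z1 - f' z2\<bar>" using h by (simp add: abs_mult)
    also have "\<dots> \<le> h * (A * \<bar>z1 - z2\<bar>)" using x z1 z2 h by (intro mult_left_mono lip') auto
    also have "\<dots> \<le> h * (A * (2 * h))" using z1 z2 h A by (intro mult_left_mono) auto
    finally show ?thesis by (simp add: power2_eq_square mult_ac)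
  qed
  show ?thesis unfolding C2_bound_def
  proof (intro conjI ballI allI impI)
    fix x assume x: "x \<in> {l..u}"
    show "norm (complex_of_real (f x)) \<le> 2 * A" using b(1)[OF x] A by simp
    fix y assume y: "y \<in> {l..u}"
    have "\<bar>f x - f y\<bar> \<le> A * \<bar>x - y\<bar>" by (rule lip[OF x y])
    also have "\<dots> \<le> 2 * A * \<bar>x - y\<bar>" using A by (intro mult_right_mono) auto
    finally show "norm (complex_of_real (f x) - complex_of_real (f y)) \<le> 2 * A * \<bar>x - y\<bar>"
      by (simp only: norm_of_real flip: of_real_diff)
  next
    fix x h assume x: "x \<in> {l..u} \<and> x + h \<in> {l..u} \<and> x - h \<in> {l..u}"
    have "\<bar>f (x + h) + f (x - h) - 2 * f x\<bar> \<le> 2 * A * h\<^sup>2"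
      using second[of x h] second[of x "- h"] x by (cases h "0::real" rule: linorder_cases) (auto simp: add.commute)
    moreover have "complex_of_real (f (x + h)) + complex_of_real (f (x - h)) - 2 * complex_of_real (f x)
       = complex_of_real (f (x + h) + f (x - h) - 2 * f x)" by simp
    ultimately show "norm (complex_of_real (f (x + h)) + complex_of_real (f (x - h)) - 2 * complex_of_real (f x)) \<le> 2 * A * h\<^sup>2"
      by (simp only: norm_of_real)
  qed
qed (simp add: C2_bound_def)

lemma powr_le_power_of_window:
  fixes x Q :: real
  assumes "1 \<le> Q" "x \<in> {1/Q..Q}" "\<bar>e\<bar> \<le> real n"
  shows "x powr e \<le> Q ^ n"
proof -
  have x: "x > 0" using assms by (auto intro: less_le_trans[of 0 "1 / Q"])
  have "x powr e \<le> Q powr \<bar>e\<bar>"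
  proof (cases "e \<ge> 0")
    case True
    then show ?thesis using assms x by (auto intro: powr_mono2)
  next
    case False
    have "x powr e = (1/x) powr (-e)" using x by (simp add: powr_minus_divide powr_divide)
    also have "\<dots> \<le> Q powr (-e)" using False x assms by (intro powr_mono2) (auto simp: field_simps)
    finally show ?thesis using False by simp
  qed
  also have "\<dots> \<le> Q powr (real n)" using assms by (intro powr_mono) auto
  also have "\<dots> = Q ^ n" using assms by (simp add: powr_realpow)
  finally show ?thesis .
qed

text \<open>It is essential that the bound is linear in \<open>u\<close>: for \<open>u = \<theta> - \<theta>'\<close> it yields the Lipschitz
  dependence on the exponent. Since \<open>1\<close> lies in the interval and the function vanishes there,
  bounds on the first two derivatives suffice.\<close>

lemma C2_bound_powr:
  fixes Q u :: real
  assumes Q: "1 \<le> Q" and u: "\<bar>u\<bar> \<le> 2"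
  shows "C2_bound {1/Q..Q} (6 * Q ^ 4 * \<bar>u\<bar>) (\<lambda>x. complex_of_real (x powr (- u) - 1))"
proof -
  have pos: "x > 0" if "x \<in> {1/Q..Q}" for x
    using Q that by (auto intro: less_le_trans[of 0 "1 / Q"])
  have f1: "((\<lambda>x. x powr (- u) - 1) has_real_derivative (- u) * x powr (- u - 1)) (at x)" if "x > 0" for x
    using that by (auto intro!: derivative_eq_intros)
  have f2: "((\<lambda>x. (- u) * x powr (- u - 1)) has_real_derivative u * (u + 1) * x powr (- u - 2)) (at x)" if "x > 0" for x
    using that by (auto intro!: derivative_eq_intros simp: algebra_simps)
  have b1: "\<bar>(- u) * x powr (- u - 1)\<bar> \<le> \<bar>u\<bar> * Q ^ 3" if "x \<in> {1/Q..Q}" for x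
    using powr_le_power_of_window[OF Q that, of "- u - 1" 3] u by (auto simp: abs_mult intro!: mult_left_mono)
  have b2: "\<bar>u * (u + 1) * x powr (- u - 2)\<bar> \<le> \<bar>u\<bar> * 3 * Q ^ 4" if "x \<in> {1/Q..Q}" for x
    using powr_le_power_of_window[OF Q that, of "- u - 2" 4] u
    unfolding abs_mult by (intro mult_mono) auto
  have one: "1 \<in> {1/Q..Q}" using Q by auto
  have b0: "\<bar>x powr (- u) - 1\<bar> \<le> \<bar>u\<bar> * Q ^ 4" if x: "x \<in> {1/Q..Q}" for x
  proof -
    have "norm ((x powr (- u) - 1) - (1 powr (- u) - 1)) \<le> (\<bar>u\<bar> * Q ^ 3) * norm (x - 1)"
      by (rule field_differentiable_bound[where S = "{1/Q..Q}" and f' = "\<lambda>x. (- u) * x powr (- u - 1)"])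
         (use b1 x one f1 pos in \<open>auto intro: has_field_derivative_at_within\<close>)
    also have "\<dots> \<le> (\<bar>u\<bar> * Q ^ 3) * Q"
      using x Q pos[OF x] by (intro mult_left_mono) auto
    finally show ?thesis by (simp add: power_Suc2[symmetric] eval_nat_numeral)
  qed
  have Q34: "Q ^ 3 \<le> Q ^ 4" "0 \<le> Q ^ 4" using Q by (auto intro: power_increasing)
  have "C2_bound {1/Q..Q} (2 * (\<bar>u\<bar> * (3 * Q ^ 4))) (\<lambda>x. complex_of_real (x powr (- u) - 1))"
  proof (rule C2_bound_of_derivatives)
    fix x assume x: "x \<in> {1/Q..Q}"
    show "((\<lambda>x. x powr (- u) - 1) has_real_derivative (- u) * x powr (- u - 1)) (at x)"
      "((\<lambda>x. (- u) * x powr (- u - 1)) has_real_derivative u * (u + 1) * x powr (- u - 2)) (at x)"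
      using f1 f2 pos[OF x] by auto
    show "\<bar>x powr (- u) - 1\<bar> \<le> \<bar>u\<bar> * (3 * Q ^ 4)" 
      using Q34 by (intro order_trans[OF b0[OF x]] mult_left_mono) auto
    show "\<bar>(- u) * x powr (- u - 1)\<bar> \<le> \<bar>u\<bar> * (3 * Q ^ 4)" 
    proof (rule order_trans[OF b1[OF x]], rule mult_left_mono)
      show "Q ^ 3 \<le> 3 * Q ^ 4" using Q34 by linarith
    qed simp
    show "\<bar>u * (u + 1) * x powr (- u - 2)\<bar> \<le> \<bar>u\<bar> * (3 * Q ^ 4)" using b2[OF x] by (simp add: mult_ac)
  qed
  then show ?thesis by (simp add: mult_ac)
qed

lemma norm_cis_minus_one: "norm (cis u - 1) \<le> \<bar>u\<bar>"
  using iexp_approx1[of u 0] by (simp add: cis_conv_exp)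

lemma cis_diff_le: "norm (cis u - cis v) \<le> \<bar>u - v\<bar>"
proof -
  have "cis u - cis v = cis v * (cis (u - v) - 1)" by (simp add: right_diff_distrib cis_mult)
  then show ?thesis using norm_cis_minus_one[of "u - v"] by (simp add: norm_mult)
qed

lemma cis_second_difference: "cis (u + v) + cis (u - v) - 2 * cis u = of_real (2 * cos v - 2) * cis u"
  by (simp add: complex_eq_iff cos_add sin_add cos_diff sin_diff algebra_simps)

lemma cis_second_difference_le: "norm (cis (u + v) + cis (u - v) - 2 * cis u) \<le> v\<^sup>2"
proof -
  have "1 - cos v = 2 * (sin (v / 2))\<^sup>2" using cos_double_sin[of "v / 2"] by simp
  moreover have "(sin (v / 2))\<^sup>2 \<le> (v / 2)\<^sup>2"
    using abs_sin_x_le_abs_x[of "v / 2"] by (simp only: abs_le_square_iff)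
  ultimately have "\<bar>2 * cos v - 2\<bar> \<le> v\<^sup>2" by (simp add: power_divide)
  then show ?thesis unfolding cis_second_difference norm_mult norm_of_real by simp
qed

text \<open>As for powers, the bound is linear in the parameter \<open>h\<close>, which will be a difference of two
  positions.\<close>

lemma C2_bound_cis:
  assumes Q: "1 \<le> Q" and h: "\<bar>h\<bar> \<le> 1"
  shows "C2_bound {- Q..Q} (Q * \<bar>h\<bar>) (\<lambda>x. cis (h * x) - 1)"
  unfolding C2_bound_def
proof (intro conjI ballI allI impI)
  fix x assume x: "x \<in> {- Q..Q}"
  have "norm (cis (h * x) - 1) \<le> \<bar>x\<bar> * \<bar>h\<bar>" using norm_cis_minus_one[of "h * x"] by (simp add: abs_mult mult.commute)
  also have "\<dots> \<le> Q * \<bar>h\<bar>" using x by (intro mult_right_mono) auto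
  finally show "norm (cis (h * x) - 1) \<le> Q * \<bar>h\<bar>" .
  fix y
  have "norm (cis (h * x) - cis (h * y)) \<le> \<bar>h * x - h * y\<bar>" by (rule cis_diff_le)
  also have "\<dots> = 1 * (\<bar>h\<bar> * \<bar>x - y\<bar>)" by (simp add: right_diff_distrib[symmetric] abs_mult)
  also have "\<dots> \<le> Q * (\<bar>h\<bar> * \<bar>x - y\<bar>)" using Q by (intro mult_right_mono) auto
  finally show "norm (cis (h * x) - 1 - (cis (h * y) - 1)) \<le> Q * \<bar>h\<bar> * \<bar>x - y\<bar>" by (simp add: mult.assoc)
next
  fix x k
  have "norm (cis (h * x + h * k) + cis (h * x - h * k) - 2 * cis (h * x)) \<le> (h * k)\<^sup>2"
    by (rule cis_second_difference_le)
  also have "\<dots> = \<bar>h\<bar> * \<bar>h\<bar> * k\<^sup>2" by (simp add: power_mult_distrib power2_eq_square)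
  also have "\<dots> \<le> Q * \<bar>h\<bar> * k\<^sup>2" using Q h by (intro mult_right_mono) auto
  finally show "norm (cis (h * (x + k)) - 1 + (cis (h * (x - k)) - 1) - 2 * (cis (h * x) - 1)) \<le> Q * \<bar>h\<bar> * k\<^sup>2"
    by (simp add: algebra_simps)
qed

section \<open>Decay of the integrals defining the wavelet profile\<close>

text \<open>Functions that live on \<open>1/Q \<le> \<bar>\<xi>\<bar> \<le> Q\<close>. They vanish on a somewhat larger set than the
  complement of this window, so that shifts by at most \<open>1/Q\<close> never relate a point of the support
  to a point outside the window.\<close>

definition windowed :: "real \<Rightarrow> real \<Rightarrow> (real \<Rightarrow> complex) \<Rightarrow> bool" where
  "windowed Q A f \<longleftrightarrow> f \<in> borel_measurable borel \<and>
     (\<forall>\<xi>. \<bar>\<xi>\<bar> \<le> 3 / Q \<or> Q - 2 / Q \<le> \<bar>\<xi>\<bar> \<longrightarrow> f \<xi> = 0) \<and>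
     C2_bound {1 / Q..Q} A f \<and> C2_bound {- Q..- (1 / Q)} A f"

lemma windowed_nonneg:
  assumes "windowed Q A f" "1 \<le> Q"
  shows "0 \<le> A"
proof (rule C2_bound_nonneg)
  show "C2_bound {1 / Q..Q} A f" using assms(1) by (simp add: windowed_def)
  have "1 * 1 \<le> Q * Q" using assms(2) by (intro mult_mono) auto
  then show "Q \<in> {1 / Q..Q}" using assms(2) by (simp add: field_simps)
qed

lemma windows_subset:
  fixes Q :: real
  assumes "1 \<le> Q"
  shows "{1 / Q..Q} \<subseteq> {- Q..Q}" "{- Q..- (1 / Q)} \<subseteq> {- Q..Q}"
proof -
  define r where "r = 1 / Q"
  have "0 < r" using assms by (simp add: r_def)
  then show "{1 / Q..Q} \<subseteq> {- Q..Q}" "{- Q..- (1 / Q)} \<subseteq> {- Q..Q}"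
    unfolding r_def[symmetric] using assms by auto
qed

lemma integrable_window:
  fixes A Q :: real
  shows "integrable lborel (\<lambda>\<xi>. A * indicator {- Q..Q} \<xi> :: real)"
  by (intro integrable_mult_right integrable_real_indicator) (auto simp: emeasure_lborel_Icc_eq)

lemma windowed_mult:
  assumes "windowed Q A f" "g \<in> borel_measurable borel"
    "C2_bound {1 / Q..Q} B g" "C2_bound {- Q..- (1 / Q)} B g"
  shows "windowed Q (4 * A * B) (\<lambda>\<xi>. f \<xi> * g \<xi>)"
  using assms C2_bound_mult unfolding windowed_def by auto

lemma windowed_norm_le:
  assumes f: "windowed Q A f" and Q: "1 \<le> Q"
  shows "norm (f \<xi>) \<le> A * indicator {- Q..Q} \<xi>"
proof -
  have A: "0 \<le> A" by (rule windowed_nonneg[OF f Q])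
  have z: "f \<xi> = 0" if "\<bar>\<xi>\<bar> \<le> 3 / Q \<or> Q - 2 / Q \<le> \<bar>\<xi>\<bar>" using f that by (auto simp: windowed_def)
  have r: "0 < 1 / Q" using Q by simp
  have "\<xi> \<in> {1 / Q..Q} \<or> \<xi> \<in> {- Q..- (1 / Q)}" if "f \<xi> \<noteq> 0"
  proof -
    have *: "3 * (1 / Q) < \<bar>\<xi>\<bar>" "\<bar>\<xi>\<bar> < Q - 2 * (1 / Q)" using that z by force+
    show ?thesis unfolding atLeastAtMost_iff using * r by linarith
  qed
  then consider "f \<xi> = 0" | "\<xi> \<in> {1 / Q..Q}" | "\<xi> \<in> {- Q..- (1 / Q)}" by blast
  then show ?thesis
  proof cases
    case 2
    then have "norm (f \<xi>) \<le> A" using f C2_boundD(1) by (auto simp: windowed_def)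
    then show ?thesis using 2 windows_subset(1)[OF Q] by (simp add: subset_iff)
  next
    case 3
    then have "norm (f \<xi>) \<le> A" using f C2_boundD(1) by (auto simp: windowed_def)
    then show ?thesis using 3 windows_subset(2)[OF Q] by (simp add: subset_iff)
  qed (use A in auto)
qed

text \<open>Near the edges of the window, and beyond, all three values vanish; elsewhere the three
  points lie in the same half of the window.\<close>

lemma windowed_second_difference_le:
  assumes f: "windowed Q A f" and Q: "1 \<le> Q" and h: "0 < h" "h \<le> 1 / Q"
  shows "norm (f (\<xi> + h) + f (\<xi> - h) - 2 * f \<xi>) \<le> A * h\<^sup>2 * indicator {- Q..Q} \<xi>"
proof -
  have A: "0 \<le> A" by (rule windowed_nonneg[OF f Q])
  have z: "f x = 0" if "\<bar>x\<bar> \<le> 3 * (1 / Q) \<or> Q - 2 * (1 / Q) \<le> \<bar>x\<bar>" for x using f that by (auto simp: windowed_def)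
  define r where "r = 1 / Q"
  have r: "0 < r" "h \<le> r" using Q h by (auto simp: r_def)
  note z = z[folded r_def]
  consider "\<bar>\<xi>\<bar> \<le> 2 * r" | "Q - r \<le> \<bar>\<xi>\<bar>" | "2 * r < \<xi>" "\<xi> < Q - r" | "2 * r < - \<xi>" "- \<xi> < Q - r"
    by linarith
  then show ?thesis
  proof cases
    case 1
    then have "f (\<xi> + h) = 0" "f (\<xi> - h) = 0" "f \<xi> = 0" using r h by (auto intro!: z)
    then show ?thesis using A by simp
  next
    case 2
    then have "f (\<xi> + h) = 0" "f (\<xi> - h) = 0" "f \<xi> = 0" using r h by (auto intro!: z)
    then show ?thesis using A by simp
  next
    case 3
    have "norm (f (\<xi> + h) + f (\<xi> - h) - 2 * f \<xi>) \<le> A * h\<^sup>2"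
      by (rule C2_boundD(3)[of "{1 / Q..Q}"]) (use f 3 r h in \<open>auto simp: windowed_def r_def[symmetric]\<close>)
    then show ?thesis using 3 r by (auto simp: indicator_def)
  next
    case 4
    have "norm (f (\<xi> + h) + f (\<xi> - h) - 2 * f \<xi>) \<le> A * h\<^sup>2"
      by (rule C2_boundD(3)[of "{- Q..- (1 / Q)}"]) (use f 4 r h in \<open>auto simp: windowed_def r_def[symmetric]\<close>)
    then show ?thesis using 4 r by (auto simp: indicator_def)
  qed
qed

lemma cis_linear_measurable [measurable]: "(\<lambda>\<xi>. cis (x * \<xi>)) \<in> borel_measurable borel"
  by (intro borel_measurable_continuous_onI continuous_intros)

definition osc :: "(real \<Rightarrow> complex) \<Rightarrow> real \<Rightarrow> complex" where
  "osc f x = (LINT \<xi>|lborel. cis (x * \<xi>) * f \<xi>)"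

lemma windowed_integrable:
  assumes f: "windowed Q A f" and Q: "1 \<le> Q"
  shows "integrable lborel (\<lambda>\<xi>. cis (x * \<xi>) * f \<xi>)"
proof (rule Bochner_Integration.integrable_bound)
  show "integrable lborel (\<lambda>\<xi>. A * indicator {- Q..Q} \<xi> :: real)" by (rule integrable_window)
  have [measurable]: "f \<in> borel_measurable borel" using f by (simp add: windowed_def)
  show "(\<lambda>\<xi>. cis (x * \<xi>) * f \<xi>) \<in> borel_measurable lborel" by measurable
  show "AE \<xi> in lborel. norm (cis (x * \<xi>) * f \<xi>) \<le> norm (A * indicator {- Q..Q} \<xi>)"
    using windowed_norm_le[OF f Q] by (auto simp: norm_mult intro: order_trans[OF _ abs_ge_self])
qed

lemma norm_integral_window_le:
  fixes g :: "real \<Rightarrow> complex"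
  assumes g: "integrable lborel g" and le: "\<And>\<xi>. norm (g \<xi>) \<le> B * indicator {- Q..Q} \<xi>" and Q: "1 \<le> Q"
  shows "norm (LINT \<xi>|lborel. g \<xi>) \<le> 2 * Q * B"
proof -
  have "norm (LINT \<xi>|lborel. g \<xi>) \<le> (LINT \<xi>|lborel. B * indicator {- Q..Q} \<xi>)"
    by (rule Bochner_Integration.integral_norm_bound_integral[OF g integrable_window]) (rule le)
  also have "\<dots> = 2 * Q * B" using Q by simp
  finally show ?thesis .
qed

text \<open>Shifting the frequency by half a period \<open>h = pi / \<bar>x\<bar>\<close> of the character reverses its sign.
  Therefore the integral of the second difference of \<open>f\<close> against the character is \<open>-4\<close> times the
  integral itself, while it is bounded by \<open>2 Q A h\<^sup>2\<close>. For \<open>\<bar>x\<bar> < pi Q\<close>, where the shift would be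
  too large, the trivial bound is sufficient.\<close>

lemma osc_decay:
  assumes f: "windowed Q A f" and Q: "1 \<le> Q"
  shows "norm (osc f x) \<le> 2 * Q * (1 + pi * Q)\<^sup>2 * A * decay x"
proof -
  have A: "0 \<le> A" by (rule windowed_nonneg[OF f Q])
  note int = windowed_integrable[OF f Q]
  show ?thesis
  proof (cases "\<bar>x\<bar> < pi * Q")
    case True
    have "norm (osc f x) \<le> 2 * Q * A" unfolding osc_def
      by (rule norm_integral_window_le[OF int _ Q]) (use windowed_norm_le[OF f Q] in \<open>simp add: norm_mult\<close>)
    also have "\<dots> = 2 * Q * A * ((1 + \<bar>x\<bar>)\<^sup>2 * decay x)" by (simp add: decay_def)
    also have "\<dots> \<le> 2 * Q * A * ((1 + pi * Q)\<^sup>2 * decay x)"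
      using True A Q by (intro mult_left_mono mult_right_mono power_mono) (auto simp: decay_def)
    finally show ?thesis by (simp add: mult_ac)
  next
    case False
    have piQ: "pi * Q \<ge> 1" using mult_mono[of 1 pi 1 Q] pi_gt3 Q by auto
    then have x: "\<bar>x\<bar> \<ge> 1" using False by auto
    \<comment> \<open>half a period: the shift by \<open>h\<close> reverses the sign of the kernel\<close>
    define h where "h = pi / \<bar>x\<bar>"
    have h0: "0 < h" using x by (auto simp: h_def)
    have hQ: "h \<le> 1 / Q" using False Q x by (auto simp: h_def field_simps not_less)
    have xh: "x * h = pi \<or> x * h = - pi" using x by (auto simp: h_def abs_if)
    then have cis: "cis (x * h) = -1" "cis (x * (- h)) = -1" by (auto simp: complex_eq_iff)
    have shift: "(LINT \<xi>|lborel. cis (x * \<xi>) * f (\<xi> + k)) = - osc f x"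
      "integrable lborel (\<lambda>\<xi>. cis (x * \<xi>) * f (\<xi> + k))"
      if k: "cis (x * k) = -1" for k
    proof -
      have e: "cis (x * (k + 1 * \<xi>)) * f (k + 1 * \<xi>) = - (cis (x * \<xi>) * f (\<xi> + k))" for \<xi>
      proof -
        have "cis (x * (k + 1 * \<xi>)) = - cis (x * \<xi>)"
          using cis_mult[of "x * k" "x * \<xi>"] k by (simp add: distrib_left)
        then show ?thesis by (simp add: add.commute)
      qed
      show "(LINT \<xi>|lborel. cis (x * \<xi>) * f (\<xi> + k)) = - osc f x"
        unfolding osc_def by (subst (2) lborel_integral_real_affine[where c = 1 and t = k]) (simp_all only: e, simp_all)
      have "integrable lborel (\<lambda>\<xi>. cis (x * (k + 1 * \<xi>)) * f (k + 1 * \<xi>))"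
        by (rule lborel_integrable_real_affine[OF int]) simp
      then show "integrable lborel (\<lambda>\<xi>. cis (x * \<xi>) * f (\<xi> + k))" unfolding e by simp
    qed
    have split: "cis (x * \<xi>) * (f (\<xi> + h) + f (\<xi> - h) - 2 * f \<xi>)
        = cis (x * \<xi>) * f (\<xi> + h) + cis (x * \<xi>) * f (\<xi> + (- h)) - 2 * (cis (x * \<xi>) * f \<xi>)" for \<xi>
      by (simp add: distrib_left right_diff_distrib)
    note i = shift(2)[OF cis(1)] shift(2)[OF cis(2)]
    have int2: "integrable lborel (\<lambda>\<xi>. cis (x * \<xi>) * (f (\<xi> + h) + f (\<xi> - h) - 2 * f \<xi>))"
      unfolding split
      by (rule Bochner_Integration.integrable_diff[OF Bochner_Integration.integrable_add[OF i] integrable_mult_right[OF int]])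
    have "(LINT \<xi>|lborel. cis (x * \<xi>) * (f (\<xi> + h) + f (\<xi> - h) - 2 * f \<xi>)) = - osc f x + - osc f x - 2 * osc f x"
      unfolding split
        Bochner_Integration.integral_diff[OF Bochner_Integration.integrable_add[OF i] integrable_mult_right[OF int]]
        Bochner_Integration.integral_add[OF i] shift(1)[OF cis(1)] shift(1)[OF cis(2)]
      by (simp add: osc_def)
    then have "(LINT \<xi>|lborel. cis (x * \<xi>) * (f (\<xi> + h) + f (\<xi> - h) - 2 * f \<xi>)) = - 4 * osc f x"
      by simp
    moreover have "norm (LINT \<xi>|lborel. cis (x * \<xi>) * (f (\<xi> + h) + f (\<xi> - h) - 2 * f \<xi>)) \<le> 2 * Q * (A * h\<^sup>2)"
      by (rule norm_integral_window_le[OF int2 _ Q])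
         (use windowed_second_difference_le[OF f Q h0 hQ] in \<open>simp add: norm_mult\<close>)
    ultimately have "4 * norm (osc f x) \<le> 2 * Q * A * h\<^sup>2" by (simp add: norm_mult)
    also have "\<dots> = 2 * Q * A * (pi\<^sup>2 * (1 / \<bar>x\<bar>)\<^sup>2)" by (simp add: h_def power_divide)
    also have "\<dots> \<le> 2 * Q * A * ((1 + pi * Q)\<^sup>2 * (2 / (1 + \<bar>x\<bar>))\<^sup>2)"
    proof (intro mult_left_mono mult_mono power_mono)
      have "pi * 1 \<le> pi * Q" using Q by (intro mult_left_mono) auto
      then show "pi \<le> 1 + pi * Q" by linarith
      show "1 / \<bar>x\<bar> \<le> 2 / (1 + \<bar>x\<bar>)" using x by (simp add: field_simps)
    qed (use Q A in auto)
    also have "\<dots> = 4 * (2 * Q * (1 + pi * Q)\<^sup>2 * A * decay x)" by (simp add: decay_def power_divide)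
    finally show ?thesis by linarith
  qed
qed

text \<open>For \<open>\<bar>x - y\<bar> \<le> 1\<close> the difference is, up to sign, again such an integral, namely of \<open>f\<close> times
  \<open>cis (h \<xi>) - 1\<close> with \<open>h = y - x\<close>; otherwise the two terms are estimated separately.\<close>

lemma osc_increment:
  assumes f: "windowed Q A f" and Q: "1 \<le> Q"
  shows "norm (osc f x - osc f y) \<le> 8 * Q\<^sup>2 * (1 + pi * Q)\<^sup>2 * A * min 1 \<bar>x - y\<bar> * (decay x + decay y)"
proof -
  have A: "0 \<le> A" by (rule windowed_nonneg[OF f Q])
  define L where "L = 2 * Q * (1 + pi * Q)\<^sup>2"
  have L: "L \<ge> 0" using Q by (simp add: L_def)
  have LQ: "8 * Q\<^sup>2 * (1 + pi * Q)\<^sup>2 = 4 * Q * L" by (simp add: L_def power2_eq_square)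
  have d: "decay x > 0" "decay y > 0" by (rule decay_pos)+
  show ?thesis
  proof (cases "\<bar>x - y\<bar> \<le> 1")
    case True
    define h where "h = y - x"
    have h: "\<bar>h\<bar> \<le> 1" using True by (simp add: h_def)
    have c: "C2_bound {- Q..Q} (Q * \<bar>h\<bar>) (\<lambda>\<xi>. cis (h * \<xi>) - 1)" by (rule C2_bound_cis[OF Q h])
    have g: "windowed Q (4 * A * (Q * \<bar>h\<bar>)) (\<lambda>\<xi>. f \<xi> * (cis (h * \<xi>) - 1))"
      by (rule windowed_mult[OF f]) (auto intro!: C2_bound_mono[OF c order_refl] windows_subset Q)
    have "osc (\<lambda>\<xi>. f \<xi> * (cis (h * \<xi>) - 1)) x = (LINT \<xi>|lborel. cis (y * \<xi>) * f \<xi> - cis (x * \<xi>) * f \<xi>)"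
      unfolding osc_def
    proof (rule Bochner_Integration.integral_cong[OF refl])
      fix \<xi>
      have "cis (y * \<xi>) = cis (x * \<xi>) * cis (h * \<xi>)"
        by (simp add: cis_mult h_def algebra_simps)
      then show "cis (x * \<xi>) * (f \<xi> * (cis (h * \<xi>) - 1)) = cis (y * \<xi>) * f \<xi> - cis (x * \<xi>) * f \<xi>"
        by (simp add: algebra_simps)
    qed
    also have "\<dots> = osc f y - osc f x"
      unfolding osc_def by (rule Bochner_Integration.integral_diff) (rule windowed_integrable[OF f Q])+
    finally have "norm (osc f x - osc f y) = norm (osc (\<lambda>\<xi>. f \<xi> * (cis (h * \<xi>) - 1)) x)"
      by (simp add: norm_minus_commute)
    also have "\<dots> \<le> L * (4 * A * (Q * \<bar>h\<bar>)) * decay x"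
      unfolding L_def by (rule osc_decay[OF g Q])
    also have "\<dots> \<le> L * (4 * A * (Q * \<bar>h\<bar>)) * (decay x + decay y)"
      using d A L Q by (intro mult_left_mono) auto
    finally show ?thesis using True unfolding LQ by (simp add: h_def abs_minus_commute mult_ac)
  next
    case False
    have "norm (osc f x - osc f y) \<le> norm (osc f x) + norm (osc f y)" by (rule norm_triangle_ineq4)
    also have "\<dots> \<le> L * A * decay x + L * A * decay y"
      unfolding L_def by (intro add_mono osc_decay f Q)
    also have "\<dots> = 1 * (L * A * (decay x + decay y))" by (simp add: distrib_left)
    also have "\<dots> \<le> (4 * Q) * (L * A * (decay x + decay y))"
      using d A L Q by (intro mult_right_mono) auto
    finally show ?thesis using False unfolding LQ by (simp add: mult_ac)
  qed
qed

lemma integrable_schwartz_moments: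
  assumes "schwartz \<psi>" "n \<le> 2"
  shows "integrable lborel (\<lambda>x. \<bar>x\<bar> ^ n * \<bar>\<psi> x\<bar>)" and "\<psi> \<in> borel_measurable borel"
proof -
  have "\<psi> differentiable (at x)" for x
  proof -
    have "(deriv ^^ 0) \<psi> differentiable (at x)" using assms(1) unfolding schwartz_def by blast
    then show ?thesis by simp
  qed
  then have "continuous_on UNIV \<psi>"
    by (simp add: continuous_at_imp_continuous_on differentiable_imp_continuous_within)
  then show [measurable]: "\<psi> \<in> borel_measurable borel" by (rule borel_measurable_continuous_onI)
  have b: "bounded (range (\<lambda>x. x ^ m * \<psi> x))" for m
  proof -
    have "bounded (range (\<lambda>x. x ^ m * (deriv ^^ 0) \<psi> x))" using assms(1) unfolding schwartz_def by blast
    then show ?thesis by simp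
  qed
  obtain B0 where B0: "\<And>x. \<bar>\<psi> x\<bar> \<le> B0" using b[of 0] by (auto simp: bounded_iff)
  obtain B4 where B4: "\<And>x. \<bar>x ^ 4 * \<psi> x\<bar> \<le> B4" using b[of 4] by (auto simp: bounded_iff)
  have BB: "B0 \<ge> 0" "B4 \<ge> 0" using B0[of 0] B4[of 0] by auto
  have "set_integrable lborel (einterval (- \<infinity>) \<infinity>) (\<lambda>x. inverse (1 + x\<^sup>2))"
    by (rule integrable_inverse_1_plus_square)
  then have i: "integrable lborel (\<lambda>x::real. 2 * (B0 + B4) * inverse (1 + x\<^sup>2))"
    by (intro integrable_mult_right) (simp add: set_integrable_def)
  have le: "\<bar>x\<bar> ^ n * \<bar>\<psi> x\<bar> \<le> 2 * (B0 + B4) * inverse (1 + x\<^sup>2)" for x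
  proof -
    have n: "\<bar>x\<bar> ^ n \<le> 1 + x\<^sup>2"
    proof -
      consider "n = 0" | "n = 1" | "n = 2" using assms(2) by linarith
      then show ?thesis
      proof cases
        case 2
        have "0 \<le> (\<bar>x\<bar> - 1)\<^sup>2" by simp
        then have "2 * \<bar>x\<bar> \<le> 1 + x\<^sup>2" by (simp add: power2_diff)
        then show ?thesis using 2 by simp
      qed auto
    qed
    have sq: "(1 + x\<^sup>2)\<^sup>2 \<le> 2 * (1 + x ^ 4)"
    proof -
      have *: "(1 + y)\<^sup>2 \<le> 2 * (1 + y\<^sup>2)" for y :: real
      proof -
        have "2 * (1 + y\<^sup>2) - (1 + y)\<^sup>2 = (1 - y)\<^sup>2" by (simp add: power2_eq_square algebra_simps)
        then show ?thesis by (smt (verit) zero_le_power2)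
      qed
      show ?thesis using *[of "x\<^sup>2"] by simp
    qed
    have "(1 + x ^ 4) * \<bar>\<psi> x\<bar> \<le> B0 + B4"
      using B0[of x] B4[of x] by (simp add: abs_mult distrib_right)
    have "(\<bar>x\<bar> ^ n * \<bar>\<psi> x\<bar>) * (1 + x\<^sup>2) \<le> ((1 + x\<^sup>2) * \<bar>\<psi> x\<bar>) * (1 + x\<^sup>2)"
      using n by (intro mult_right_mono) auto
    also have "\<dots> = (1 + x\<^sup>2)\<^sup>2 * \<bar>\<psi> x\<bar>" by (simp add: power2_eq_square mult_ac)
    also have "\<dots> \<le> 2 * (1 + x ^ 4) * \<bar>\<psi> x\<bar>" using sq by (intro mult_right_mono) auto
    also have "\<dots> \<le> 2 * (B0 + B4)" unfolding mult.assoc by (intro mult_left_mono \<open>(1 + x ^ 4) * \<bar>\<psi> x\<bar> \<le> B0 + B4\<close>) simp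
    finally have "(\<bar>x\<bar> ^ n * \<bar>\<psi> x\<bar>) * (1 + x\<^sup>2) \<le> 2 * (B0 + B4)" .
    moreover have "0 < 1 + x\<^sup>2" by (simp add: add_pos_nonneg)
    ultimately show ?thesis unfolding divide_inverse[symmetric] by (subst pos_le_divide_eq)
  qed
  show "integrable lborel (\<lambda>x. \<bar>x\<bar> ^ n * \<bar>\<psi> x\<bar>)"
    by (rule Bochner_Integration.integrable_bound[OF i]) (use le BB in \<open>auto intro: order_trans[OF _ abs_ge_self]\<close>)
qed

text \<open>The three moments of \<open>\<bar>\<psi>\<bar>\<close> of order at most two bound the function, its first and its second
  differences.\<close>

lemma C2_bound_fourier:
  assumes "schwartz \<psi>"
  shows "\<exists>A. C2_bound UNIV A (fourier \<psi>)"
proof -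
  have [measurable]: "\<psi> \<in> borel_measurable borel" using integrable_schwartz_moments[OF assms, of 0] by simp
  define J where "J n = (LINT x|lborel. \<bar>x\<bar> ^ n * \<bar>\<psi> x\<bar>)" for n
  have int: "integrable lborel (\<lambda>x. \<bar>x\<bar> ^ n * \<bar>\<psi> x\<bar>)" if "n \<le> 2" for n
    by (rule integrable_schwartz_moments[OF assms that])
  have J0: "J n \<ge> 0" for n unfolding J_def by (intro integral_nonneg_AE) auto
  define s where "s = sqrt (2 * pi)"
  have s: "s > 0" by (simp add: s_def)
  have cm: "(\<lambda>x. cis (- (x * \<xi>))) \<in> borel_measurable borel" for \<xi>
    by (intro borel_measurable_continuous_onI continuous_intros)
  define c where "c \<xi> x = cis (- (x * \<xi>)) * complex_of_real (\<psi> x)" for \<xi> x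
  have ci: "integrable lborel (c \<xi>)" for \<xi>
    unfolding c_def
    by (rule Bochner_Integration.integrable_bound[OF int[of 0]]) (use cm in \<open>auto simp: norm_mult\<close>)
  have F: "fourier \<psi> \<xi> = (LINT x|lborel. c \<xi> x) / complex_of_real s" for \<xi>
    by (simp add: fourier_def s_def c_def)
  have bound: "norm ((LINT x|lborel. g x) / complex_of_real s) \<le> J n / s * K"
    if g: "integrable lborel g" and n: "n \<le> 2" and le: "\<And>x. norm (g x) \<le> K * (\<bar>x\<bar> ^ n * \<bar>\<psi> x\<bar>)" for g n K
  proof -
    have "norm (LINT x|lborel. g x) \<le> (LINT x|lborel. K * (\<bar>x\<bar> ^ n * \<bar>\<psi> x\<bar>))"
      by (rule Bochner_Integration.integral_norm_bound_integral[OF g integrable_mult_right[OF int[OF n]]]) (rule le)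
    also have "\<dots> = K * J n" by (simp add: J_def)
    finally show ?thesis using s by (simp add: norm_divide divide_right_mono mult_ac)
  qed
  have Jle: "J 0 / s \<le> (J 0 + J 1 + J 2) / s" "J 1 / s \<le> (J 0 + J 1 + J 2) / s" "J 2 / s \<le> (J 0 + J 1 + J 2) / s"
    using s J0[of 0] J0[of 1] J0[of 2] by (intro divide_right_mono; simp)+
  have "C2_bound UNIV ((J 0 + J 1 + J 2) / s) (fourier \<psi>)"
    unfolding C2_bound_def
  proof (intro conjI ballI allI impI)
    fix x y :: real
    have "norm (fourier \<psi> x) \<le> J 0 / s * 1"
      unfolding F by (rule bound[OF ci]) (auto simp: c_def norm_mult)
    then show "norm (fourier \<psi> x) \<le> (J 0 + J 1 + J 2) / s" using Jle by simp
    have "norm (fourier \<psi> x - fourier \<psi> y) = norm ((LINT z|lborel. c x z - c y z) / complex_of_real s)"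
      unfolding F by (simp add: Bochner_Integration.integral_diff[OF ci ci] diff_divide_distrib)
    also have "\<dots> \<le> J 1 / s * \<bar>x - y\<bar>"
    proof (rule bound[OF Bochner_Integration.integrable_diff[OF ci ci]])
      fix z
      have "norm (c x z - c y z) = norm (cis (- (z * x)) - cis (- (z * y))) * \<bar>\<psi> z\<bar>"
        unfolding c_def by (simp add: left_diff_distrib[symmetric] norm_mult)
      also have "\<dots> \<le> \<bar>- (z * x) - - (z * y)\<bar> * \<bar>\<psi> z\<bar>"
        by (intro mult_right_mono cis_diff_le) auto
      also have "\<bar>- (z * x) - - (z * y)\<bar> = \<bar>x - y\<bar> * \<bar>z\<bar>"
        by (simp add: abs_mult[symmetric] right_diff_distrib abs_minus_commute mult.commute)
      finally show "norm (c x z - c y z) \<le> \<bar>x - y\<bar> * (\<bar>z\<bar> ^ 1 * \<bar>\<psi> z\<bar>)" by (simp add: mult_ac)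
    qed simp
    also have "\<dots> \<le> (J 0 + J 1 + J 2) / s * \<bar>x - y\<bar>" by (intro mult_right_mono Jle) simp
    finally show "norm (fourier \<psi> x - fourier \<psi> y) \<le> (J 0 + J 1 + J 2) / s * \<bar>x - y\<bar>" .
  next
    fix x h :: real
    have ci2: "integrable lborel (\<lambda>z. c (x + h) z + c (x - h) z - 2 * c x z)"
      by (intro Bochner_Integration.integrable_diff Bochner_Integration.integrable_add integrable_mult_right ci)
    have "(LINT z|lborel. c (x + h) z + c (x - h) z - 2 * c x z)
        = (LINT z|lborel. c (x + h) z) + (LINT z|lborel. c (x - h) z) - 2 * (LINT z|lborel. c x z)"
      by (simp add: ci)
    then have eq: "fourier \<psi> (x + h) + fourier \<psi> (x - h) - 2 * fourier \<psi> x
        = (LINT z|lborel. c (x + h) z + c (x - h) z - 2 * c x z) / complex_of_real s"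
      unfolding F by (simp add: add_divide_distrib diff_divide_distrib)
    have "norm (fourier \<psi> (x + h) + fourier \<psi> (x - h) - 2 * fourier \<psi> x) \<le> J 2 / s * h\<^sup>2"
      unfolding eq
    proof (rule bound[OF ci2])
      fix z
      have "c (x + h) z + c (x - h) z - 2 * c x z
          = (cis (- (z * x) + - (z * h)) + cis (- (z * x) - - (z * h)) - 2 * cis (- (z * x))) * complex_of_real (\<psi> z)"
        unfolding c_def by (simp add: algebra_simps)
      then have "norm (c (x + h) z + c (x - h) z - 2 * c x z) \<le> (- (z * h))\<^sup>2 * \<bar>\<psi> z\<bar>"
        unfolding norm_mult norm_of_real by (simp only: norm_mult norm_of_real) (intro mult_right_mono cis_second_difference_le abs_ge_zero)
      then show "norm (c (x + h) z + c (x - h) z - 2 * c x z) \<le> h\<^sup>2 * (\<bar>z\<bar> ^ 2 * \<bar>\<psi> z\<bar>)"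
        by (simp add: power_mult_distrib mult_ac)
    qed simp
    also have "\<dots> \<le> (J 0 + J 1 + J 2) / s * h\<^sup>2" by (intro mult_right_mono Jle) simp
    finally show "norm (fourier \<psi> (x + h) + fourier \<psi> (x - h) - 2 * fourier \<psi> x) \<le> (J 0 + J 1 + J 2) / s * h\<^sup>2" .
  qed
  then show ?thesis by blast
qed

lemma C2_bound_measurable:
  assumes "C2_bound UNIV A f"
  shows "f \<in> borel_measurable borel"
proof -
  have "A-lipschitz_on UNIV f"
    using C2_boundD(2)[OF assms] C2_bound_nonneg[OF assms] by (auto intro!: lipschitz_onI simp: dist_norm)
  then show ?thesis by (intro borel_measurable_continuous_onI lipschitz_on_continuous_on)
qed

lemma C2_bound_add_one:
  assumes "C2_bound S A f" "0 \<le> A"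
  shows "C2_bound S (A + 1) (\<lambda>x. f x + 1)"
  unfolding C2_bound_def
proof (intro conjI ballI allI impI)
  note F = C2_boundD[OF assms(1)]
  fix x assume x: "x \<in> S"
  show "norm (f x + 1) \<le> A + 1" using norm_triangle_ineq[of "f x" 1] F(1)[OF x] by simp
  fix y assume y: "y \<in> S"
  show "norm (f x + 1 - (f y + 1)) \<le> (A + 1) * \<bar>x - y\<bar>"
    using F(2)[OF x y] mult_right_mono[of A "A + 1" "\<bar>x - y\<bar>"] by simp
next
  note F = C2_boundD[OF assms(1)]
  fix x h assume "x \<in> S \<and> x + h \<in> S \<and> x - h \<in> S"
  then have "norm (f (x + h) + f (x - h) - 2 * f x) \<le> A * h\<^sup>2" using F(3)[of x h] by blast
  also have "\<dots> \<le> (A + 1) * h\<^sup>2" by (intro mult_right_mono) auto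
  finally show "norm (f (x + h) + 1 + (f (x - h) + 1) - 2 * (f x + 1)) \<le> (A + 1) * h\<^sup>2"
    by (simp add: algebra_simps)
qed

lemma C2_bound_abs_powr:
  fixes Q u :: real
  assumes Q: "1 \<le> Q" and u: "\<bar>u\<bar> \<le> 2"
  shows "C2_bound {1 / Q..Q} (6 * Q ^ 4 * \<bar>u\<bar>) (\<lambda>x. complex_of_real (\<bar>x\<bar> powr (- u) - 1))"
    and "C2_bound {- Q..- (1 / Q)} (6 * Q ^ 4 * \<bar>u\<bar>) (\<lambda>x. complex_of_real (\<bar>x\<bar> powr (- u) - 1))"
proof -
  have r: "0 < 1 / Q" using Q by simp
  show 1: "C2_bound {1 / Q..Q} (6 * Q ^ 4 * \<bar>u\<bar>) (\<lambda>x. complex_of_real (\<bar>x\<bar> powr (- u) - 1))"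
  proof (rule C2_bound_cong[OF C2_bound_powr[OF Q u]])
    fix x assume "x \<in> {1 / Q..Q}"
    then have "0 < x" using r by (meson atLeastAtMost_iff less_le_trans)
    then have "\<bar>x\<bar> = x" by simp
    then show "complex_of_real (x powr (- u) - 1) = complex_of_real (\<bar>x\<bar> powr (- u) - 1)" by simp
  qed
  have "{x. - x \<in> {1 / Q..Q}} = {- Q..- (1 / Q)}" by auto
  then show "C2_bound {- Q..- (1 / Q)} (6 * Q ^ 4 * \<bar>u\<bar>) (\<lambda>x. complex_of_real (\<bar>x\<bar> powr (- u) - 1))"
    using C2_bound_reflect[OF 1] by simp
qed

text \<open>Because \<open>\<Psi>(\<cdot>, \<theta>)\<close> is the integral of \<open>fourier \<psi> \<xi> \<bar>\<xi>\<bar>^(-\<theta> - 1/2)\<close> against characters and the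
  first factor vanishes near \<open>0\<close> and near infinity, the singular weight is only seen on a
  window. There it is the power function, and a difference of two weights is one of them times
  \<open>\<bar>\<xi>\<bar>^(\<theta>' - \<theta>) - 1\<close>.\<close>

theorem wavelet_profile_Psi:
  assumes lm: "lemarie_meyer \<psi>" and ab: "0 < a" "a \<le> b" "b < 1"
  shows "\<exists>C. wavelet_profile (\<lambda>x \<theta>. Re (Psi \<psi> x \<theta>)) C a b"
proof -
  define \<phi> where "\<phi> = fourier \<psi>"
  obtain A where A: "C2_bound UNIV A \<phi>"
    using C2_bound_fourier lm by (auto simp: lemarie_meyer_def \<phi>_def)
  have [measurable]: "\<phi> \<in> borel_measurable borel" by (rule C2_bound_measurable[OF A])
  have "bounded (closure {\<xi>. \<phi> \<xi> \<noteq> 0})"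
    using lm compact_imp_bounded by (auto simp: lemarie_meyer_def \<phi>_def)
  then have "bounded {\<xi>. \<phi> \<xi> \<noteq> 0}" by (rule bounded_subset) (rule closure_subset)
  then obtain R where R: "\<And>\<xi>. \<phi> \<xi> \<noteq> 0 \<Longrightarrow> \<bar>\<xi>\<bar> \<le> R" by (auto simp: bounded_iff)
  obtain \<eta> where \<eta>: "\<eta> > 0" "\<And>\<xi>. \<bar>\<xi>\<bar> < \<eta> \<Longrightarrow> \<phi> \<xi> = 0"
    using lm by (auto simp: lemarie_meyer_def \<phi>_def eventually_nhds_metric dist_real_def)
  \<comment> \<open>large enough for the support of \<open>\<phi>\<close> to lie in \<open>3/Q < \<bar>\<xi>\<bar> < Q - 2/Q\<close>\<close>
  define Q where "Q = \<bar>R\<bar> + 3 + 4 / \<eta>"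
  have Q: "1 \<le> Q" using \<eta> by (simp add: Q_def add_nonneg_nonneg)
  have Q0: "3 / Q < \<eta>"
  proof -
    have "3 < \<eta> * (4 / \<eta>)" using \<eta> by simp
    also have "\<dots> \<le> \<eta> * Q" using \<eta> by (intro mult_left_mono) (auto simp: Q_def)
    finally show ?thesis using Q by (simp add: field_simps)
  qed
  have QR: "R < Q - 2 / Q"
  proof -
    have "2 / Q \<le> 2" using Q by (simp add: field_simps)
    moreover have "4 / \<eta> > 0" using \<eta> by simp
    ultimately show ?thesis unfolding Q_def by linarith
  qed
  have \<phi>w: "windowed Q A \<phi>"
    unfolding windowed_def
  proof (intro conjI allI impI)
    fix \<xi> assume "\<bar>\<xi>\<bar> \<le> 3 / Q \<or> Q - 2 / Q \<le> \<bar>\<xi>\<bar>"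
    then show "\<phi> \<xi> = 0" using Q0 QR R[of \<xi>] \<eta>(2)[of \<xi>] by force
  qed (auto intro: C2_bound_mono[OF A])
  have A0: "A \<ge> 0" by (rule windowed_nonneg[OF \<phi>w Q])
  define w where "w \<theta> \<xi> = complex_of_real (\<bar>\<xi>\<bar> powr (- (\<theta> + 1/2)))" for \<theta> \<xi>
  define f where "f \<theta> \<xi> = \<phi> \<xi> * w \<theta> \<xi>" for \<theta> \<xi>
  define A1 where "A1 = 4 * A * (6 * Q ^ 4 * 2 + 1)"
  have A1: "A1 \<ge> 0" using A0 Q by (simp add: A1_def)
  have Q4: "0 \<le> 6 * Q ^ 4" using Q by simp
  have f: "windowed Q A1 (f \<theta>)" if "\<theta> \<in> {a..b}" for \<theta>
    unfolding f_def A1_def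
  proof (rule windowed_mult[OF \<phi>w])
    have u: "\<bar>\<theta> + 1/2\<bar> \<le> 2" using that ab by auto
    have le: "6 * Q ^ 4 * \<bar>\<theta> + 1/2\<bar> + 1 \<le> 6 * Q ^ 4 * 2 + 1"
      using u Q4 by (intro add_mono mult_left_mono) auto
    have e: "(\<lambda>x. complex_of_real (\<bar>x\<bar> powr (- (\<theta> + 1/2)) - 1) + 1) = w \<theta>"
      by (simp add: w_def fun_eq_iff)
    show "C2_bound {1 / Q..Q} (6 * Q ^ 4 * 2 + 1) (w \<theta>)" "C2_bound {- Q..- (1 / Q)} (6 * Q ^ 4 * 2 + 1) (w \<theta>)"
      by (rule C2_bound_mono[OF C2_bound_add_one[OF C2_bound_abs_powr(1)[OF Q u], unfolded e] le order_refl]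
               C2_bound_mono[OF C2_bound_add_one[OF C2_bound_abs_powr(2)[OF Q u], unfolded e] le order_refl],
          use Q4 in simp)+
    show "w \<theta> \<in> borel_measurable borel" unfolding w_def by measurable
  qed
  have Psi: "Psi \<psi> x \<theta> = osc (f \<theta>) x" for x \<theta>
    unfolding Psi_def osc_def f_def w_def \<phi>_def
    by (rule Bochner_Integration.integral_cong) (simp_all only: powr_minus of_real_inverse divide_inverse mult.assoc)
  have fdiff: "windowed Q (4 * A1 * (6 * Q ^ 4 * \<bar>\<theta> - \<theta>'\<bar>)) (\<lambda>\<xi>. f \<theta> \<xi> - f \<theta>' \<xi>)"
    if "\<theta> \<in> {a..b}" "\<theta>' \<in> {a..b}" for \<theta> \<theta>'
  proof -
    have u: "\<bar>\<theta> - \<theta>'\<bar> \<le> 2" using that ab by auto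
    have "windowed Q (4 * A1 * (6 * Q ^ 4 * \<bar>\<theta> - \<theta>'\<bar>)) (\<lambda>\<xi>. f \<theta>' \<xi> * complex_of_real (\<bar>\<xi>\<bar> powr (- (\<theta> - \<theta>')) - 1))"
      by (rule windowed_mult[OF f[OF that(2)] _ C2_bound_abs_powr[OF Q u]]) measurable
    also have "(\<lambda>\<xi>. f \<theta>' \<xi> * complex_of_real (\<bar>\<xi>\<bar> powr (- (\<theta> - \<theta>')) - 1)) = (\<lambda>\<xi>. f \<theta> \<xi> - f \<theta>' \<xi>)"
    proof
      fix \<xi>
      show "f \<theta>' \<xi> * complex_of_real (\<bar>\<xi>\<bar> powr (- (\<theta> - \<theta>')) - 1) = f \<theta> \<xi> - f \<theta>' \<xi>"
      proof (cases "\<xi> = 0")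
        case False
        then have "\<bar>\<xi>\<bar> powr (- (\<theta>' + 1/2)) * \<bar>\<xi>\<bar> powr (- (\<theta> - \<theta>')) = \<bar>\<xi>\<bar> powr (- (\<theta> + 1/2))"
          by (simp add: powr_add[symmetric] algebra_simps)
        then have "w \<theta> \<xi> = w \<theta>' \<xi> * complex_of_real (\<bar>\<xi>\<bar> powr (- (\<theta> - \<theta>')))"
          unfolding w_def by (simp only: of_real_mult[symmetric])
        then show ?thesis by (simp add: f_def algebra_simps)
      qed (simp add: f_def w_def)
    qed
    finally show ?thesis .
  qed
  define L where "L = 8 * Q\<^sup>2 * (1 + pi * Q)\<^sup>2"
  have L: "L \<ge> 0" using Q by (simp add: L_def)
  define C where "C = L * A1 + L * (4 * A1 * (6 * Q ^ 4))"
  have C1: "L * A1 \<le> C" "L * (4 * A1 * (6 * Q ^ 4)) \<le> C"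
    using L A1 Q4 by (auto simp: C_def intro!: mult_nonneg_nonneg)
  have C0: "0 \<le> C" using C1 L A1 by (meson mult_nonneg_nonneg order_trans)
  have m: "0 \<le> min 1 \<bar>x - y\<bar> * (decay x + decay y)" for x y
    using decay_pos[of x] decay_pos[of y] by simp
  have "wavelet_profile (\<lambda>x \<theta>. Re (Psi \<psi> x \<theta>)) C a b"
  proof
    show "0 < a" "a \<le> b" "b < 1" "0 \<le> C" by fact+
    fix x y \<theta> assume \<theta>: "\<theta> \<in> {a..b}"
    have "\<bar>Re (Psi \<psi> x \<theta>) - Re (Psi \<psi> y \<theta>)\<bar> \<le> norm (osc (f \<theta>) x - osc (f \<theta>) y)"
      using abs_Re_le_cmod[of "osc (f \<theta>) x - osc (f \<theta>) y"] by (simp add: Psi)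
    also have "\<dots> \<le> L * A1 * (min 1 \<bar>x - y\<bar> * (decay x + decay y))"
      using osc_increment[OF f[OF \<theta>] Q, of x y] by (simp add: L_def mult_ac)
    also have "\<dots> \<le> C * (min 1 \<bar>x - y\<bar> * (decay x + decay y))"
      by (intro mult_right_mono C1 m)
    finally show "\<bar>Re (Psi \<psi> x \<theta>) - Re (Psi \<psi> y \<theta>)\<bar> \<le> C * min 1 \<bar>x - y\<bar> * (decay x + decay y)"
      by (simp add: mult_ac)
    fix \<theta>' assume \<theta>': "\<theta>' \<in> {a..b}"
    have osc: "osc (\<lambda>\<xi>. f \<theta> \<xi> - f \<theta>' \<xi>) z = osc (f \<theta>) z - osc (f \<theta>') z" for z
      unfolding osc_def right_diff_distrib
      by (rule Bochner_Integration.integral_diff) (rule windowed_integrable[OF f[OF \<theta>] Q] windowed_integrable[OF f[OF \<theta>'] Q])+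
    have "\<bar>(Re (Psi \<psi> x \<theta>) - Re (Psi \<psi> y \<theta>)) - (Re (Psi \<psi> x \<theta>') - Re (Psi \<psi> y \<theta>'))\<bar>
       \<le> norm (osc (\<lambda>\<xi>. f \<theta> \<xi> - f \<theta>' \<xi>) x - osc (\<lambda>\<xi>. f \<theta> \<xi> - f \<theta>' \<xi>) y)"
      using abs_Re_le_cmod[of "osc (\<lambda>\<xi>. f \<theta> \<xi> - f \<theta>' \<xi>) x - osc (\<lambda>\<xi>. f \<theta> \<xi> - f \<theta>' \<xi>) y"]
      by (simp add: Psi osc algebra_simps)
    also have "\<dots> \<le> L * (4 * A1 * (6 * Q ^ 4)) * (\<bar>\<theta> - \<theta>'\<bar> * (min 1 \<bar>x - y\<bar> * (decay x + decay y)))"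
      using osc_increment[OF fdiff[OF \<theta> \<theta>'] Q, of x y] by (simp add: L_def mult_ac)
    also have "\<dots> \<le> C * (\<bar>\<theta> - \<theta>'\<bar> * (min 1 \<bar>x - y\<bar> * (decay x + decay y)))"
      by (intro mult_right_mono C1 mult_nonneg_nonneg[OF _ m]) simp
    finally show "\<bar>(Re (Psi \<psi> x \<theta>) - Re (Psi \<psi> y \<theta>)) - (Re (Psi \<psi> x \<theta>') - Re (Psi \<psi> y \<theta>'))\<bar>
       \<le> C * \<bar>\<theta> - \<theta>'\<bar> * min 1 \<bar>x - y\<bar> * (decay x + decay y)" by (simp add: mult_ac)
  qed
  then show ?thesis by blast
qed

section \<open>Moments and deviations of the Gaussian coefficients\<close>

lemma decay_summable_int: "(\<lambda>k::int. decay (real_of_int k)) summable_on UNIV"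
proof -
  have "summable (\<lambda>n. decay (real n))"
  proof -
    have "summable (\<lambda>n. 1 / (real (Suc n))\<^sup>2)"
      using summable_Suc_iff[of "\<lambda>n. 1 / (real n)\<^sup>2"] inverse_power_summable[of 2, where 'a = real]
      by (simp add: inverse_eq_divide)
    then show ?thesis by (simp add: decay_def add.commute)
  qed
  from summable_on_int_of_nat[OF this] have "(\<lambda>k::int. decay (real (nat \<bar>k\<bar>))) summable_on UNIV"
    using decay_pos less_imp_le by blast
  then show ?thesis by (simp add: decay_def)
qed

text \<open>Chebyshev's inequality. The variance of the weighted sum is at most \<open>A m2\<close> times the sum of
  the weights and hence of order \<open>N\<close>, whereas the deviation from the mean is of order \<open>N\<close>; this is
  where the factor \<open>1 / N\<close> comes from.\<close>

lemma (in prob_space) weighted_sum_deviation: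
  fixes Y :: "'i \<Rightarrow> 'a \<Rightarrow> real"
  assumes fin: "finite K" and ind: "indep_vars (\<lambda>_. borel) Y K"
    and int: "\<And>k. k \<in> K \<Longrightarrow> integrable M (Y k)" "\<And>k. k \<in> K \<Longrightarrow> integrable M (\<lambda>\<omega>. (Y k \<omega>)\<^sup>2)"
    and m1: "\<And>k. k \<in> K \<Longrightarrow> expectation (Y k) = m1" and m2: "\<And>k. k \<in> K \<Longrightarrow> expectation (\<lambda>\<omega>. (Y k \<omega>)\<^sup>2) \<le> m2"
    and w: "\<And>k. k \<in> K \<Longrightarrow> 0 \<le> w k" "\<And>k. k \<in> K \<Longrightarrow> w k \<le> A" "sum w K \<le> A * N"
    and A: "0 \<le> A" and m: "0 \<le> m1" "0 \<le> m2" and lam: "0 < lam" and N: "0 < N" and small: "A * m1 \<le> lam / 2"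
  shows "prob {\<omega> \<in> space M. lam * N < (\<Sum>k\<in>K. w k * Y k \<omega>)} \<le> 4 * A\<^sup>2 * m2 / lam\<^sup>2 / N"
proof -
  define Z where "Z k \<omega> = Y k \<omega> - m1" for k \<omega>
  have [measurable]: "Y k \<in> borel_measurable M" if "k \<in> K" for k using int(1)[OF that] by auto
  have Zint: "integrable M (Z k)" if "k \<in> K" for k
    unfolding Z_def using int(1)[OF that] by simp
  have Z0: "expectation (Z k) = 0" if "k \<in> K" for k
    unfolding Z_def using int(1)[OF that] m1[OF that] by (simp add: prob_space)
  have Zsq: "(Z k \<omega>)\<^sup>2 = (Y k \<omega>)\<^sup>2 - 2 * m1 * Y k \<omega> + m1\<^sup>2" for k \<omega>
    by (simp add: Z_def power2_diff algebra_simps)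
  have Zint2: "integrable M (\<lambda>\<omega>. (Z k \<omega>)\<^sup>2)" if "k \<in> K" for k
    unfolding Zsq using int[OF that] by simp
  have Zvar: "expectation (\<lambda>\<omega>. (Z k \<omega>)\<^sup>2) \<le> m2" if "k \<in> K" for k
  proof -
    have "expectation (\<lambda>\<omega>. (Z k \<omega>)\<^sup>2) = expectation (\<lambda>\<omega>. (Y k \<omega>)\<^sup>2) - m1\<^sup>2"
      unfolding Zsq using int[OF that] m1[OF that] by (simp add: prob_space power2_eq_square)
    then show ?thesis using m2[OF that] by (smt (verit) zero_le_power2)
  qed
  have indZ: "indep_vars (\<lambda>_. borel) Z K"
    unfolding Z_def by (rule indep_vars_compose2[OF ind]) simp
  have cross: "integrable M (\<lambda>\<omega>. Z i \<omega> * Z k \<omega>) \<and> expectation (\<lambda>\<omega>. Z i \<omega> * Z k \<omega>) = 0"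
    if "i \<in> K" "k \<in> K" "i \<noteq> k" for i k
  proof -
    have s: "indep_vars (\<lambda>_. borel) Z {i, k}" by (rule indep_vars_subset[OF indZ]) (use that in auto)
    have "(\<integral>\<omega>. (\<Prod>j\<in>{i, k}. Z j \<omega>) \<partial>M) = (\<Prod>j\<in>{i, k}. expectation (Z j))"
      by (rule indep_vars_lebesgue_integral[OF _ s]) (use that Zint in auto)
    moreover have "integrable M (\<lambda>\<omega>. \<Prod>j\<in>{i, k}. Z j \<omega>)"
      by (rule indep_vars_integrable[OF _ s]) (use that Zint in auto)
    ultimately show ?thesis using that Z0 by simp
  qed
  define D where "D \<omega> = (\<Sum>k\<in>K. w k * Z k \<omega>)" for \<omega>
  have Dsq: "(D \<omega>)\<^sup>2 = (\<Sum>i\<in>K. \<Sum>k\<in>K. w i * w k * (Z i \<omega> * Z k \<omega>))" for \<omega>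
    unfolding D_def power2_eq_square sum_product by (simp add: mult_ac)
  have ii: "integrable M (\<lambda>\<omega>. Z i \<omega> * Z k \<omega>)" if "i \<in> K" "k \<in> K" for i k
    using cross[OF that] Zint2[OF that(1)] by (cases "i = k") (auto simp: power2_eq_square)
  have Dint: "integrable M (\<lambda>\<omega>. (D \<omega>)\<^sup>2)"
    unfolding Dsq by (intro Bochner_Integration.integrable_sum integrable_mult_right ii)
  have "expectation (\<lambda>\<omega>. (D \<omega>)\<^sup>2) = (\<Sum>i\<in>K. \<Sum>k\<in>K. w i * w k * expectation (\<lambda>\<omega>. Z i \<omega> * Z k \<omega>))"
    unfolding Dsq using ii
    by (subst Bochner_Integration.integral_sum; (intro Bochner_Integration.integrable_sum integrable_mult_right ii)?; simp?)
  also have "\<dots> = (\<Sum>i\<in>K. \<Sum>k\<in>K. if i = k then (w i)\<^sup>2 * expectation (\<lambda>\<omega>. (Z i \<omega>)\<^sup>2) else 0)"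
    using cross by (intro sum.cong refl) (auto simp: power2_eq_square)
  also have "\<dots> = (\<Sum>i\<in>K. (w i)\<^sup>2 * expectation (\<lambda>\<omega>. (Z i \<omega>)\<^sup>2))"
    using fin by (simp add: sum.delta)
  also have "\<dots> \<le> (\<Sum>i\<in>K. (A * w i) * m2)"
    using w Zvar m A by (intro sum_mono mult_mono) (auto simp: power2_eq_square mult_right_mono)
  also have "\<dots> = A * m2 * sum w K" by (simp add: sum_distrib_left mult_ac)
  also have "\<dots> \<le> A * m2 * (A * N)" using w(3) A m by (intro mult_left_mono) auto
  finally have var: "expectation (\<lambda>\<omega>. (D \<omega>)\<^sup>2) \<le> A\<^sup>2 * m2 * N" by (simp add: power2_eq_square mult_ac)
  have [measurable]: "D \<in> borel_measurable M"
    unfolding D_def Z_def by (intro borel_measurable_sum) measurable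
  have "prob {\<omega> \<in> space M. lam * N < (\<Sum>k\<in>K. w k * Y k \<omega>)} \<le> prob {\<omega> \<in> space M. lam / 2 * N \<le> \<bar>D \<omega>\<bar>}"
  proof (rule finite_measure_mono)
    have Deq: "D \<omega> = (\<Sum>k\<in>K. w k * Y k \<omega>) - m1 * sum w K" for \<omega>
      by (simp add: D_def Z_def right_diff_distrib sum_subtractf sum_distrib_left mult.commute)
    have mean: "m1 * sum w K \<le> lam / 2 * N"
    proof -
      have "m1 * sum w K \<le> m1 * (A * N)" using w(3) m by (intro mult_left_mono)
      also have "\<dots> = (A * m1) * N" by simp
      also have "\<dots> \<le> lam / 2 * N" using small N by (intro mult_right_mono) auto
      finally show ?thesis .
    qed
    have "lam / 2 * N \<le> \<bar>D \<omega>\<bar>" if "lam * N < (\<Sum>k\<in>K. w k * Y k \<omega>)" for \<omega>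
    proof -
      have "lam * N = lam / 2 * N + lam / 2 * N" by simp
      then show ?thesis using that mean unfolding Deq by linarith
    qed
    then show "{\<omega> \<in> space M. lam * N < (\<Sum>k\<in>K. w k * Y k \<omega>)} \<subseteq> {\<omega> \<in> space M. lam / 2 * N \<le> \<bar>D \<omega>\<bar>}"
      by blast
  qed measurable
  also have "\<dots> \<le> expectation (\<lambda>\<omega>. (D \<omega>)\<^sup>2) / (lam / 2 * N)\<^sup>2"
    by (rule second_moment_method[OF _ Dint]) (use lam N in auto)
  also have "\<dots> \<le> A\<^sup>2 * m2 * N / (lam / 2 * N)\<^sup>2"
    using var by (intro divide_right_mono) auto
  also have "\<dots> = 4 * A\<^sup>2 * m2 / lam\<^sup>2 / N" using N lam by (simp add: power2_eq_square field_simps)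
  finally show ?thesis .
qed

definition normal_moment :: "nat \<Rightarrow> real" where
  "normal_moment n = fact (2 * n) / (2 ^ n * fact n)"

lemma normal_moment_nonneg: "0 \<le> normal_moment n"
  by (simp add: normal_moment_def)

locale gaussian_array = prob_space +
  fixes X :: "int \<times> int \<Rightarrow> 'a \<Rightarrow> real"
  assumes indep: "indep_vars (\<lambda>_. borel) X UNIV"
    and gauss: "\<And>z. distributed M lborel (X z) std_normal_density"
begin

lemma X_measurable [measurable]: "X z \<in> borel_measurable M"
  using distributed_measurable[OF gauss[of z]] by simp

lemma even_moment:
  "integrable M (\<lambda>\<omega>. X z \<omega> ^ (2 * n))" "expectation (\<lambda>\<omega>. X z \<omega> ^ (2 * n)) = normal_moment n"
proof -
  have i: "has_bochner_integral lborel (\<lambda>x. std_normal_density x * x ^ (2 * n)) (normal_moment n)"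
    using std_normal_moment_even[of n] by (simp add: normal_moment_def)
  have d: "distributed M lborel (X z) (\<lambda>x. ennreal (std_normal_density x))" by (rule gauss)
  show "integrable M (\<lambda>\<omega>. X z \<omega> ^ (2 * n))"
    using distributed_integrable[OF d, of "\<lambda>x. x ^ (2 * n)"] i by (auto simp: has_bochner_integral_iff)
  show "expectation (\<lambda>\<omega>. X z \<omega> ^ (2 * n)) = normal_moment n"
    using distributed_integral[OF d, of "\<lambda>x. x ^ (2 * n)"] i by (auto simp: has_bochner_integral_iff)
qed

text \<open>With \<open>n \<ge> 1/p\<close>, the \<open>2n\<close>-th powers of the quotients of the two sides have a finite expected sum
  over all \<open>(j, k)\<close>, so that almost surely their sum is finite and bounds each of them.\<close>

lemma AE_global_bound:
  assumes p: "0 < p"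
  shows "AE \<omega> in M. \<exists>B\<ge>0. \<forall>j k. \<bar>X (j, k) \<omega>\<bar> \<le> B * (1 + \<bar>real_of_int j\<bar>) * (1 + \<bar>real_of_int k\<bar>) powr p"
proof -
  obtain n :: nat where n: "real n \<ge> 1 / p" using real_arch_simple by blast
  have n1: "n \<ge> 1" using n p by (metis divide_pos_pos less_one linorder_not_less of_nat_0 zero_less_one)
  have np: "2 \<le> p * real (2 * n)" using n p by (simp add: field_simps)
  define b where "b z = (1 + \<bar>real_of_int (fst z)\<bar>) * (1 + \<bar>real_of_int (snd z)\<bar>) powr p" for z :: "int \<times> int"
  define d where "d z = decay (real_of_int (fst z)) * decay (real_of_int (snd z))" for z :: "int \<times> int"
  have b1: "b z \<ge> 1" for z
    unfolding b_def using mult_mono[of 1 "1 + \<bar>real_of_int (fst z)\<bar>" 1 "(1 + \<bar>real_of_int (snd z)\<bar>) powr p"] p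
    by (simp add: ge_one_powr_ge_zero)
  have bd: "1 / b z ^ (2 * n) \<le> d z" for z
  proof -
    let ?u = "1 + \<bar>real_of_int (fst z)\<bar>" and ?v = "1 + \<bar>real_of_int (snd z)\<bar>"
    have "?u\<^sup>2 * ?v\<^sup>2 \<le> ?u ^ (2 * n) * (?v powr p) ^ (2 * n)"
    proof (intro mult_mono)
      show "?u\<^sup>2 \<le> ?u ^ (2 * n)" using n1 by (intro power_increasing) auto
      have "?v\<^sup>2 = ?v powr 2" by (simp add: powr_numeral)
      also have "\<dots> \<le> ?v powr (p * real (2 * n))" using np by (intro powr_mono) auto
      also have "\<dots> = (?v powr p) ^ (2 * n)" unfolding powr_powr[symmetric] by (rule powr_realpow) simp
      finally show "?v\<^sup>2 \<le> (?v powr p) ^ (2 * n)" .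
    qed auto
    then have "?u\<^sup>2 * ?v\<^sup>2 \<le> b z ^ (2 * n)" by (simp add: b_def power_mult_distrib)
    moreover have "0 < ?u\<^sup>2 * ?v\<^sup>2" by (simp add: add_pos_nonneg)
    moreover have "0 < b z ^ (2 * n)" using b1[of z] by (intro zero_less_power) linarith
    ultimately have "1 / b z ^ (2 * n) \<le> 1 / (?u\<^sup>2 * ?v\<^sup>2)" by (intro divide_left_mono mult_pos_pos) auto
    then show ?thesis by (simp add: d_def decay_def)
  qed
  have d_sum: "d summable_on UNIV"
  proof -
    have "d summable_on (UNIV \<times> UNIV)"
    proof (rule summable_on_SigmaI)
      show "((\<lambda>y. d (x, y)) has_sum decay (real_of_int x) * (\<Sum>\<^sub>\<infinity>k::int. decay (real_of_int k))) UNIV" for x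
        unfolding d_def by (simp add: has_sum_cmult_right has_sum_infsum[OF decay_summable_int])
      show "(\<lambda>x::int. decay (real_of_int x) * (\<Sum>\<^sub>\<infinity>k::int. decay (real_of_int k))) summable_on UNIV"
        by (rule summable_on_cmult_left[OF decay_summable_int])
    qed (auto simp: d_def decay_def)
    then show ?thesis by simp
  qed
  have d0: "0 \<le> d z" for z by (simp add: d_def decay_def)
  have dint: "integrable (count_space UNIV) d"
    using d_sum d0 abs_summable_equivalent[of d UNIV] by (simp add: abs_summable_on_def)
  define Y where "Y z \<omega> = X z \<omega> ^ (2 * n) / b z ^ (2 * n)" for z \<omega>
  have Y0: "0 \<le> Y z \<omega>" for z \<omega> by (simp add: Y_def power_mult)
  have EY: "(\<integral>\<^sup>+\<omega>. ennreal (Y z \<omega>) \<partial>M) \<le> ennreal (normal_moment n * d z)" for z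
  proof -
    have "(\<integral>\<^sup>+\<omega>. ennreal (Y z \<omega>) \<partial>M) = ennreal (expectation (Y z))"
      by (rule nn_integral_eq_integral) (use even_moment(1) Y0 in \<open>auto simp: Y_def\<close>)
    also have "expectation (Y z) = normal_moment n * (1 / b z ^ (2 * n))"
      unfolding Y_def using even_moment(2) by simp
    also have "\<dots> \<le> normal_moment n * d z" using bd normal_moment_nonneg by (intro mult_left_mono)
    finally show ?thesis by (simp add: ennreal_leI)
  qed
  have "(\<integral>\<^sup>+\<omega>. \<integral>\<^sup>+z. ennreal (Y z \<omega>) \<partial>count_space UNIV \<partial>M) = (\<integral>\<^sup>+z. \<integral>\<^sup>+\<omega>. ennreal (Y z \<omega>) \<partial>M \<partial>count_space UNIV)"
    by (rule nn_integral_count_space_nn_integral) (auto simp: Y_def)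
  also have "\<dots> \<le> (\<integral>\<^sup>+z. ennreal (normal_moment n * d z) \<partial>count_space UNIV)"
    by (intro nn_integral_mono EY)
  also have "\<dots> < \<infinity>"
    using integrable_mult_right[OF dint, of "normal_moment n"] d0 normal_moment_nonneg
    by (subst nn_integral_eq_integral) auto
  finally have fin: "(\<integral>\<^sup>+\<omega>. \<integral>\<^sup>+z. ennreal (Y z \<omega>) \<partial>count_space UNIV \<partial>M) \<noteq> \<infinity>" by simp
  have meas: "(\<lambda>\<omega>. \<integral>\<^sup>+z. ennreal (Y z \<omega>) \<partial>count_space UNIV) \<in> borel_measurable M"
  proof -
    interpret C: sigma_finite_measure "count_space (UNIV :: (int \<times> int) set)"
      by (rule sigma_finite_measure_count_space)
    have "(\<lambda>(z, \<omega>). ennreal (Y z \<omega>)) \<in> borel_measurable (count_space UNIV \<Otimes>\<^sub>M M)"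
      by (rule measurable_pair_measure_countable1) (auto simp: Y_def)
    then have "(\<lambda>(\<omega>, z). ennreal (Y z \<omega>)) \<in> borel_measurable (M \<Otimes>\<^sub>M count_space UNIV)"
      by (subst measurable_pair_swap_iff) (simp add: case_prod_unfold)
    then show ?thesis by (rule C.borel_measurable_nn_integral)
  qed
  have "AE \<omega> in M. (\<integral>\<^sup>+z. ennreal (Y z \<omega>) \<partial>count_space UNIV) \<noteq> \<infinity>"
    by (rule nn_integral_PInf_AE[OF meas fin])
  then show ?thesis
  proof (rule AE_mp, intro AE_I2 impI)
    fix \<omega> assume f: "(\<integral>\<^sup>+z. ennreal (Y z \<omega>) \<partial>count_space UNIV) \<noteq> \<infinity>"
    define S where "S = max 1 (enn2real (\<integral>\<^sup>+z. ennreal (Y z \<omega>) \<partial>count_space UNIV))"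
    have YS: "Y z \<omega> \<le> S" for z
    proof -
      have "ennreal (Y z \<omega>) \<le> (\<integral>\<^sup>+z. ennreal (Y z \<omega>) \<partial>count_space UNIV)"
        by (rule nn_integral_ge_point) simp
      then have "enn2real (ennreal (Y z \<omega>)) \<le> enn2real (\<integral>\<^sup>+z. ennreal (Y z \<omega>) \<partial>count_space UNIV)"
        using f by (intro enn2real_mono) (auto simp: top.not_eq_extremum)
      then show ?thesis using Y0 by (simp add: S_def)
    qed
    have XS: "\<bar>X z \<omega>\<bar> \<le> S * b z" for z
    proof -
      have bp: "0 < b z ^ (2 * n)" using b1[of z] by (intro zero_less_power) linarith
      have "\<bar>X z \<omega>\<bar> ^ (2 * n) = X z \<omega> ^ (2 * n)" by (simp add: power_mult)
      also have "\<dots> \<le> S * b z ^ (2 * n)" using YS[of z] bp by (simp add: Y_def divide_le_eq)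
      also have "\<dots> \<le> S ^ (2 * n) * b z ^ (2 * n)"
        using bp n1 by (intro mult_right_mono self_le_power) (auto simp: S_def)
      also have "\<dots> = (S * b z) ^ (2 * n)" by (simp add: power_mult_distrib)
      finally show ?thesis
        using power_mono_iff[of "\<bar>X z \<omega>\<bar>" "S * b z" "2 * n"] n1 b1[of z] by (simp add: S_def)
    qed
    have "\<bar>X (j, k) \<omega>\<bar> \<le> S * (1 + \<bar>real_of_int j\<bar>) * (1 + \<bar>real_of_int k\<bar>) powr p" for j k
      using XS[of "(j, k)"] by (simp add: b_def mult.assoc)
    moreover have "0 \<le> S" by (simp add: S_def)
    ultimately show "\<exists>B\<ge>0. \<forall>j k. \<bar>X (j, k) \<omega>\<bar> \<le> B * (1 + \<bar>real_of_int j\<bar>) * (1 + \<bar>real_of_int k\<bar>) powr p"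
      by blast
  qed
qed

end

section \<open>A branching argument on dyadic intervals\<close>

lemma children_card:
  fixes A :: "int set"
  assumes "finite A"
  shows "finite {c. c div 2 \<in> A}" "card {c. c div 2 \<in> A} = 2 * card A"
proof -
  have eq: "{c::int. c div 2 \<in> A} = (\<lambda>(a, e). 2 * a + e) ` (A \<times> {0, 1})"
  proof (intro equalityI subsetI)
    fix c assume "c \<in> {c::int. c div 2 \<in> A}"
    then have "c = (\<lambda>(a, e). 2 * a + e) (c div 2, c mod 2)" "(c div 2, c mod 2) \<in> A \<times> {0, 1}" by auto
    then show "c \<in> (\<lambda>(a, e). 2 * a + e) ` (A \<times> {0, 1})" by (rule image_eqI)
  qed auto
  have inj: "inj_on (\<lambda>(a, e). 2 * a + e) (A \<times> {0, 1::int})"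
    by (auto simp: inj_on_def) presburger+
  show "finite {c. c div 2 \<in> A}" unfolding eq using assms by simp
  show "card {c. c div 2 \<in> A} = 2 * card A" unfolding eq card_image[OF inj] by (simp add: card_cartesian_product)
qed

definition decay_total :: real where
  "decay_total = (\<Sum>\<^sub>\<infinity>k::int. decay (real_of_int k))"

lemma decay_total_nonneg: "0 \<le> decay_total"
  unfolding decay_total_def by (intro infsum_nonneg less_imp_le decay_pos)

lemma sum_decay_le:
  assumes "finite (S :: int set)"
  shows "(\<Sum>l\<in>S. decay (real_of_int (k - l))) \<le> decay_total"
    and "(\<Sum>l\<in>S. decay (real_of_int (l - k))) \<le> decay_total"
proof -
  have "(\<Sum>l\<in>S. decay (real_of_int (l - k))) = sum (\<lambda>i. decay (real_of_int i)) ((\<lambda>l. l - k) ` S)"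
    by (subst sum.reindex) (auto simp: inj_on_def)
  also have "\<dots> \<le> decay_total"
    unfolding decay_total_def
    by (rule finite_sum_le_infsum[OF decay_summable_int]) (use assms decay_pos less_imp_le in auto)
  finally show 1: "(\<Sum>l\<in>S. decay (real_of_int (l - k))) \<le> decay_total" .
  have "decay (real_of_int (k - l)) = decay (real_of_int (l - k))" for l
    by (simp add: decay_def abs_minus_commute)
  then show "(\<Sum>l\<in>S. decay (real_of_int (k - l))) \<le> decay_total" using 1 by simp
qed

text \<open>The tree starts at level \<open>J\<close> with the dyadic intervals numbered by \<open>S0\<close>. At step \<open>n\<close>, i.e. at
  level \<open>J + n\<close>, only the finitely many coefficients with \<open>k \<in> K n\<close> are tested, so that what
  happens up to a given step depends on finitely many coefficients.\<close>

locale slow_tree =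
  fixes \<mu> p :: real and r J :: nat and S0 :: "int set" and K :: "nat \<Rightarrow> int set"
  assumes \<mu>: "0 < \<mu>" and p: "0 < p" and rp: "1 \<le> p * real r"
    and S0: "finite S0" "S0 \<noteq> {}" and K: "\<And>n. finite (K n)"
begin

definition level_indices :: "nat \<Rightarrow> (int \<times> int) set" where
  "level_indices n = {int (J + n)} \<times> K n"

definition tame :: "(int \<times> int \<Rightarrow> real) \<Rightarrow> nat \<Rightarrow> int \<Rightarrow> bool" where
  "tame x n l \<longleftrightarrow> (\<forall>z\<in>level_indices n. \<bar>x z\<bar> \<le> \<mu> * (1 + \<bar>real_of_int (snd z - l)\<bar>) powr p)"

text \<open>\<open>cells x n\<close> are the candidates at step \<open>n\<close>: intervals whose proper ancestors have passed the
  test, but which have not been tested themselves. They depend only on coefficients of earlier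
  levels, which makes them independent of the coefficients by which they are going to be
  tested.\<close>

primrec cells :: "(int \<times> int \<Rightarrow> real) \<Rightarrow> nat \<Rightarrow> int set" where
  "cells x 0 = S0"
| "cells x (Suc n) = {c. c div 2 \<in> cells x n \<and> tame x n (c div 2)}"

primrec reach :: "nat \<Rightarrow> int set" where
  "reach 0 = S0"
| "reach (Suc n) = {c. c div 2 \<in> reach n}"

definition weight :: "int set \<Rightarrow> int \<Rightarrow> real" where
  "weight S k = (\<Sum>l\<in>S. decay (real_of_int (k - l)))"

text \<open>The load of a set \<open>S\<close> of candidates is a majorant, up to the factor \<open>\<mu> ^ (2 * r)\<close>, of the number
  of elements of \<open>S\<close> that fail the test. Unlike this number it is a linear combination of
  independent variables.\<close>

definition load :: "(int \<times> int \<Rightarrow> real) \<Rightarrow> nat \<Rightarrow> int set \<Rightarrow> real" where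
  "load x n S = (\<Sum>z\<in>level_indices n. weight S (snd z) * x z ^ (2 * r))"

lemma finite_level_indices: "finite (level_indices n)"
  by (simp add: level_indices_def K)

lemma sum_level_indices: "(\<Sum>z\<in>level_indices n. f (snd z)) = (\<Sum>k\<in>K n. f k)"
  by (rule sum.reindex_bij_witness[of _ "\<lambda>k. (int (J + n), k)" snd]) (auto simp: level_indices_def)

lemma finite_reach: "finite (reach n)"
  by (induction n) (simp_all add: S0 children_card)

lemma cells_subset_reach: "cells x n \<subseteq> reach n"
  by (induction n) auto

lemma finite_cells: "finite (cells x n)"
  using finite_subset[OF cells_subset_reach finite_reach] .

text \<open>If \<open>l\<close> fails the test because of \<open>k\<close>, then \<open>\<bar>x\<^sub>k\<bar> > \<mu> (1 + \<bar>k - l\<bar>)^p\<close>, and since \<open>p r \<ge> 1\<close>, the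
  \<open>2r\<close>-th power of this inequality shows that the single term of \<open>(k, l)\<close> in the load is at least
  \<open>\<mu> ^ (2 * r)\<close>.\<close>

lemma wild_card_le_load:
  assumes "finite S"
  shows "\<mu> ^ (2 * r) * real (card {l \<in> S. \<not> tame x n l}) \<le> load x n S"
proof -
  have nn: "0 \<le> decay u * y ^ (2 * r)" for u y by (simp add: decay_def power_mult)
  have "\<mu> ^ (2 * r) \<le> (\<Sum>z\<in>level_indices n. decay (real_of_int (snd z - l)) * x z ^ (2 * r))" if l: "\<not> tame x n l" for l
  proof -
    obtain z where z: "z \<in> level_indices n" "\<mu> * (1 + \<bar>real_of_int (snd z - l)\<bar>) powr p < \<bar>x z\<bar>"
      using l by (auto simp: tame_def not_le)
    define u where "u = real_of_int (snd z - l)"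
    have "(1 + \<bar>u\<bar>)\<^sup>2 = (1 + \<bar>u\<bar>) powr 2" by (simp add: powr_numeral)
    also have "\<dots> \<le> (1 + \<bar>u\<bar>) powr (p * real (2 * r))" using rp by (intro powr_mono) auto
    also have "\<dots> = ((1 + \<bar>u\<bar>) powr p) ^ (2 * r)"
      unfolding powr_powr[symmetric] by (rule powr_realpow) simp
    finally have "\<mu> ^ (2 * r) * (1 + \<bar>u\<bar>)\<^sup>2 \<le> \<mu> ^ (2 * r) * ((1 + \<bar>u\<bar>) powr p) ^ (2 * r)"
      using \<mu> by (intro mult_left_mono) auto
    also have "\<dots> = (\<mu> * (1 + \<bar>u\<bar>) powr p) ^ (2 * r)" by (simp add: power_mult_distrib)
    also have "\<dots> \<le> \<bar>x z\<bar> ^ (2 * r)" using z(2) \<mu> by (intro power_mono) (auto simp: u_def)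
    also have "\<dots> = x z ^ (2 * r)" by (simp add: power_mult)
    finally have "\<mu> ^ (2 * r) \<le> decay u * x z ^ (2 * r)"
      unfolding decay_def by (simp add: field_simps add_pos_nonneg)
    also have "\<dots> \<le> (\<Sum>z\<in>level_indices n. decay (real_of_int (snd z - l)) * x z ^ (2 * r))"
      unfolding u_def using z(1) finite_level_indices nn by (intro member_le_sum) auto
    finally show ?thesis .
  qed
  then have "(\<Sum>l\<in>{l \<in> S. \<not> tame x n l}. \<mu> ^ (2 * r))
      \<le> (\<Sum>l\<in>{l \<in> S. \<not> tame x n l}. \<Sum>z\<in>level_indices n. decay (real_of_int (snd z - l)) * x z ^ (2 * r))"
    by (intro sum_mono) auto
  also have "\<dots> \<le> (\<Sum>l\<in>S. \<Sum>z\<in>level_indices n. decay (real_of_int (snd z - l)) * x z ^ (2 * r))"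
    using assms nn by (intro sum_mono2 sum_nonneg) auto
  also have "\<dots> = load x n S"
    unfolding load_def weight_def sum_distrib_right by (rule sum.swap)
  finally show ?thesis by (simp add: mult.commute)
qed

text \<open>At least three quarters of the candidates pass the test, and each of them has two children.\<close>

lemma cells_growth:
  assumes "load x n (cells x n) \<le> \<mu> ^ (2 * r) / 4 * real (card (cells x n))"
  shows "3 / 2 * real (card (cells x n)) \<le> real (card (cells x (Suc n)))"
proof -
  let ?C = "cells x n"
  have "\<mu> ^ (2 * r) * real (card {l \<in> ?C. \<not> tame x n l}) \<le> \<mu> ^ (2 * r) * (real (card ?C) / 4)"
    using wild_card_le_load[OF finite_cells, of x n x n] assms by simp
  then have wild: "real (card {l \<in> ?C. \<not> tame x n l}) \<le> real (card ?C) / 4"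
    using \<mu> by (simp add: mult_le_cancel_left_pos)
  have "card ?C = card {l \<in> ?C. tame x n l} + card {l \<in> ?C. \<not> tame x n l}"
    using finite_cells[of x n] by (subst card_Un_disjoint[symmetric]) (auto intro: arg_cong[where f = card])
  moreover have "card (cells x (Suc n)) = 2 * card {l \<in> ?C. tame x n l}"
    using children_card(2)[of "{l \<in> ?C. tame x n l}"] finite_cells[of x n] by simp
  ultimately show ?thesis using wild by linarith
qed

definition past_indices :: "nat \<Rightarrow> (int \<times> int) set" where
  "past_indices n = (\<Union>i<n. level_indices i)"

lemma past_indices_Suc: "past_indices (Suc n) = past_indices n \<union> level_indices n"
  by (auto simp: past_indices_def lessThan_Suc)

lemma past_disjoint_level_indices: "past_indices n \<inter> level_indices n = {}"
  by (auto simp: past_indices_def level_indices_def)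

lemma cells_cong: "(\<And>z. z \<in> past_indices n \<Longrightarrow> x z = y z) \<Longrightarrow> cells x n = cells y n"
proof (induction n)
  case (Suc n)
  have "cells x n = cells y n" by (rule Suc.IH) (use Suc.prems in \<open>auto simp: past_indices_Suc\<close>)
  moreover have "tame x n l = tame y n l" for l
    unfolding tame_def using Suc.prems by (auto simp: past_indices_Suc)
  ultimately show ?case by simp
qed simp

lemma load_cong: "(\<And>z. z \<in> level_indices n \<Longrightarrow> x z = y z) \<Longrightarrow> load x n S = load y n S"
  unfolding load_def by (intro sum.cong) auto

lemma cells_pred_measurable:
  "past_indices n \<subseteq> A \<Longrightarrow> Measurable.pred (PiM A (\<lambda>_. borel :: real measure)) (\<lambda>x. c \<in> cells x n)"
proof (induction n arbitrary: c)
  case (Suc n)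
  have [measurable]: "Measurable.pred (PiM A (\<lambda>_. borel :: real measure)) (\<lambda>x. c \<in> cells x n)" for c
    by (rule Suc.IH) (use Suc.prems in \<open>auto simp: past_indices_Suc\<close>)
  have "(\<lambda>x. x z) \<in> borel_measurable (PiM A (\<lambda>_. borel :: real measure))" if "z \<in> level_indices n" for z
    by (rule measurable_component_singleton) (use that Suc.prems in \<open>auto simp: past_indices_Suc\<close>)
  then have [measurable]: "Measurable.pred (PiM A (\<lambda>_. borel :: real measure)) (\<lambda>x. tame x n l)" for l
    unfolding tame_def using finite_level_indices by (intro pred_intros_finite(3)) auto
  show ?case by simp
qed simp

lemma cells_eq_measurable:
  assumes "past_indices n \<subseteq> A"
  shows "{x \<in> space (PiM A (\<lambda>_. borel :: real measure)). cells x n = S} \<in> sets (PiM A (\<lambda>_. borel))"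
proof -
  have *: "cells x n = S \<longleftrightarrow> S \<subseteq> reach n \<and> (\<forall>c\<in>reach n. c \<in> cells x n \<longleftrightarrow> c \<in> S)" for x
    using cells_subset_reach[of x n] by blast
  have [measurable]: "Measurable.pred (PiM A (\<lambda>_. borel :: real measure)) (\<lambda>x. c \<in> cells x n)" for c
    by (rule cells_pred_measurable[OF assms])
  have "Measurable.pred (PiM A (\<lambda>_. borel :: real measure)) (\<lambda>x. cells x n = S)"
    unfolding * using finite_reach by measurable
  then show ?thesis by (simp add: pred_def)
qed

lemma load_measurable: "(\<lambda>x. load x n S) \<in> borel_measurable (PiM (level_indices n) (\<lambda>_. borel :: real measure))"
  unfolding load_def by (intro borel_measurable_sum) measurable

end

text \<open>By the last hypothesis the mean load of \<open>N\<close> candidates is at most half the value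
  \<open>\<mu> ^ (2 * r) / 4 * N\<close> beyond which the tree may stop growing.\<close>

locale gaussian_slow_tree = gaussian_array M X + slow_tree \<mu> p r J S0 K
  for M :: "'a measure" and X and \<mu> p r J S0 K +
  assumes large: "decay_total * normal_moment r \<le> \<mu> ^ (2 * r) / 8"
begin

definition coeffs :: "'a \<Rightarrow> int \<times> int \<Rightarrow> real" where
  "coeffs \<omega> z = X z \<omega>"

text \<open>The constant of \<open>weighted_sum_deviation\<close> for the \<open>2r\<close>-th powers of the coefficients, with total
  weight \<open>decay_total\<close> and threshold \<open>lam = \<mu> ^ (2 * r) / 4\<close>.\<close>

definition failure_constant :: real where
  "failure_constant = 4 * decay_total\<^sup>2 * normal_moment (2 * r) / (\<mu> ^ (2 * r) / 4)\<^sup>2"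

lemma failure_constant_nonneg: "0 \<le> failure_constant"
  by (simp add: failure_constant_def normal_moment_nonneg)

lemma restrict_measurable: "(\<lambda>\<omega>. restrict (coeffs \<omega>) A) \<in> measurable M (PiM A (\<lambda>_. borel))"
  unfolding coeffs_def by (intro measurable_restrict) measurable

lemma cells_restrict: "cells (restrict (coeffs \<omega>) (past_indices n)) n = cells (coeffs \<omega>) n"
  by (rule cells_cong) simp

lemma load_restrict: "load (restrict (coeffs \<omega>) (level_indices n)) n S = load (coeffs \<omega>) n S"
  by (rule load_cong) simp

lemma cells_event: "{\<omega> \<in> space M. cells (coeffs \<omega>) n = S} \<in> events"
proof -
  have "(\<lambda>\<omega>. restrict (coeffs \<omega>) (past_indices n)) -` {x \<in> space (PiM (past_indices n) (\<lambda>_. borel)). cells x n = S} \<inter> space M \<in> events"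
    by (rule measurable_sets[OF restrict_measurable cells_eq_measurable]) simp
  also have "(\<lambda>\<omega>. restrict (coeffs \<omega>) (past_indices n)) -` {x \<in> space (PiM (past_indices n) (\<lambda>_. borel)). cells x n = S} \<inter> space M
     = {\<omega> \<in> space M. cells (coeffs \<omega>) n = S}"
    using measurable_space[OF restrict_measurable] by (auto simp: cells_restrict)
  finally show ?thesis .
qed

lemma load_event: "{\<omega> \<in> space M. c < load (coeffs \<omega>) n S} \<in> events"
  unfolding load_def coeffs_def by measurable

lemma prob_overload_fixed:
  assumes S: "finite S" "S \<noteq> {}"
  shows "prob {\<omega> \<in> space M. \<mu> ^ (2 * r) / 4 * real (card S) < load (coeffs \<omega>) n S} \<le> failure_constant / real (card S)"
  unfolding failure_constant_def load_def coeffs_def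
proof (rule weighted_sum_deviation[OF finite_level_indices])
  show "indep_vars (\<lambda>_. borel) (\<lambda>z \<omega>. X z \<omega> ^ (2 * r)) (level_indices n)"
    by (rule indep_vars_compose2[OF indep_vars_subset[OF indep]]) auto
  fix z
  have sq: "(X z \<omega> ^ (2 * r))\<^sup>2 = X z \<omega> ^ (2 * (2 * r))" for \<omega>
    by (simp add: power_mult[symmetric] mult.commute)
  show "integrable M (\<lambda>\<omega>. X z \<omega> ^ (2 * r))" "expectation (\<lambda>\<omega>. X z \<omega> ^ (2 * r)) = normal_moment r"
    by (rule even_moment)+
  show "integrable M (\<lambda>\<omega>. (X z \<omega> ^ (2 * r))\<^sup>2)" "expectation (\<lambda>\<omega>. (X z \<omega> ^ (2 * r))\<^sup>2) \<le> normal_moment (2 * r)"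
    unfolding sq even_moment(2) by (rule even_moment order_refl)+
  show "0 \<le> weight S (snd z)" unfolding weight_def by (intro sum_nonneg less_imp_le decay_pos)
  show "weight S (snd z) \<le> decay_total" unfolding weight_def by (rule sum_decay_le[OF S(1)])
next
  have "(\<Sum>z\<in>level_indices n. weight S (snd z)) = (\<Sum>l\<in>S. \<Sum>k\<in>K n. decay (real_of_int (k - l)))"
    unfolding sum_level_indices[of "weight S" n] unfolding weight_def by (rule sum.swap)
  also have "\<dots> \<le> (\<Sum>l\<in>S. decay_total)" by (intro sum_mono sum_decay_le K)
  finally show "(\<Sum>z\<in>level_indices n. weight S (snd z)) \<le> decay_total * real (card S)" by (simp add: mult.commute)
qed (use S \<mu> large decay_total_nonneg normal_moment_nonneg in \<open>auto simp: card_gt_0_iff\<close>)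

text \<open>The event that the tree, having grown as it should so far, may cease to do so at step \<open>n\<close>.\<close>

definition overload :: "nat \<Rightarrow> 'a set" where
  "overload n = {\<omega> \<in> space M. real (card S0) * (3 / 2) ^ n \<le> real (card (cells (coeffs \<omega>) n))
     \<and> \<mu> ^ (2 * r) / 4 * real (card (cells (coeffs \<omega>) n)) < load (coeffs \<omega>) n (cells (coeffs \<omega>) n)}"

text \<open>Decompose according to the random set of candidates, which is a function of the past and
  hence independent of the load of any fixed set of candidates at the present level.\<close>

lemma overload_bound:
  "overload n \<in> events" "prob (overload n) \<le> failure_constant / real (card S0) * (2 / 3) ^ n"
proof -
  define N where "N = real (card S0) * (3 / 2) ^ n"
  have N: "N > 0" using S0 by (simp add: N_def card_gt_0_iff)
  define \<S> where "\<S> = {S \<in> Pow (reach n). N \<le> real (card S)}"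
  have fin: "finite \<S>" using finite_reach by (simp add: \<S>_def)
  define E where "E S = {\<omega> \<in> space M. cells (coeffs \<omega>) n = S}" for S
  define F where "F S = {\<omega> \<in> space M. \<mu> ^ (2 * r) / 4 * real (card S) < load (coeffs \<omega>) n S}" for S
  have ev [measurable]: "E S \<in> events" "F S \<in> events" for S
    unfolding E_def F_def by (rule cells_event load_event)+
  have eq: "overload n = (\<Union>S\<in>\<S>. E S \<inter> F S)"
    using cells_subset_reach by (auto simp: overload_def \<S>_def E_def F_def N_def)
  show "overload n \<in> events" unfolding eq using fin by (intro sets.finite_UN sets.Int ev)
  have EF: "prob (E S \<inter> F S) = prob (E S) * prob (F S)" for S
  proof -
    have iv: "indep_var (PiM (past_indices n) (\<lambda>_. borel)) (\<lambda>\<omega>. restrict (\<lambda>z. X z \<omega>) (past_indices n))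
                (PiM (level_indices n) (\<lambda>_. borel)) (\<lambda>\<omega>. restrict (\<lambda>z. X z \<omega>) (level_indices n))"
      by (rule indep_var_restrict[OF indep past_disjoint_level_indices]) auto
    define E' where "E' = {x \<in> space (PiM (past_indices n) (\<lambda>_. borel :: real measure)). cells x n = S}"
    define F' where "F' = {x \<in> space (PiM (level_indices n) (\<lambda>_. borel :: real measure)). \<mu> ^ (2 * r) / 4 * real (card S) < load x n S}"
    have "E' \<in> sets (PiM (past_indices n) (\<lambda>_. borel))" unfolding E'_def by (rule cells_eq_measurable) simp
    moreover have "F' \<in> sets (PiM (level_indices n) (\<lambda>_. borel))" 
      unfolding F'_def using load_measurable[of n S] by measurable
    ultimately have "prob ((\<lambda>\<omega>. (restrict (\<lambda>z. X z \<omega>) (past_indices n), restrict (\<lambda>z. X z \<omega>) (level_indices n))) -` (E' \<times> F') \<inter> space M)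
      = prob ((\<lambda>\<omega>. restrict (\<lambda>z. X z \<omega>) (past_indices n)) -` E' \<inter> space M) * prob ((\<lambda>\<omega>. restrict (\<lambda>z. X z \<omega>) (level_indices n)) -` F' \<inter> space M)"
      by (rule indep_varD[OF iv])
    moreover have "(\<lambda>\<omega>. restrict (\<lambda>z. X z \<omega>) (past_indices n)) -` E' \<inter> space M = E S"
      using measurable_space[OF restrict_measurable[of "past_indices n"]] cells_restrict
      unfolding E'_def E_def coeffs_def by auto
    moreover have "(\<lambda>\<omega>. restrict (\<lambda>z. X z \<omega>) (level_indices n)) -` F' \<inter> space M = F S"
      using measurable_space[OF restrict_measurable[of "level_indices n"]] load_restrict
      unfolding F'_def F_def coeffs_def by auto
    moreover have "(\<lambda>\<omega>. (restrict (\<lambda>z. X z \<omega>) (past_indices n), restrict (\<lambda>z. X z \<omega>) (level_indices n))) -` (E' \<times> F') \<inter> space M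
       = ((\<lambda>\<omega>. restrict (\<lambda>z. X z \<omega>) (past_indices n)) -` E' \<inter> space M) \<inter> ((\<lambda>\<omega>. restrict (\<lambda>z. X z \<omega>) (level_indices n)) -` F' \<inter> space M)"
      by auto
    ultimately show ?thesis by simp
  qed
  have "prob (overload n) \<le> (\<Sum>S\<in>\<S>. prob (E S \<inter> F S))"
    unfolding eq using fin by (intro finite_measure_subadditive_finite) auto
  also have "\<dots> \<le> (\<Sum>S\<in>\<S>. prob (E S) * (failure_constant / N))"
  proof (rule sum_mono)
    fix S assume S: "S \<in> \<S>"
    then have cS: "N \<le> real (card S)" "finite S" using finite_subset[OF _ finite_reach] by (auto simp: \<S>_def)
    then have "S \<noteq> {}" using N by auto
    then have "prob (F S) \<le> failure_constant / real (card S)"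
      unfolding F_def using cS by (intro prob_overload_fixed)
    also have "\<dots> \<le> failure_constant / N"
      using cS N failure_constant_nonneg by (intro divide_left_mono) auto
    finally show "prob (E S \<inter> F S) \<le> prob (E S) * (failure_constant / N)"
      unfolding EF by (intro mult_left_mono) auto
  qed
  also have "\<dots> = prob (\<Union>S\<in>\<S>. E S) * (failure_constant / N)"
    unfolding sum_distrib_right[symmetric]
    by (subst finite_measure_finite_Union) (use fin in \<open>auto simp: E_def disjoint_family_on_def intro: cells_event\<close>)
  also have "\<dots> \<le> 1 * (failure_constant / N)"
    using failure_constant_nonneg N by (intro mult_right_mono) auto
  also have "\<dots> = failure_constant / real (card S0) * (2 / 3) ^ n"
    by (simp add: N_def power_divide field_simps)
  finally show "prob (overload n) \<le> failure_constant / real (card S0) * (2 / 3) ^ n" .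
qed

text \<open>Outside all overload events the number of candidates grows at least like \<open>(3/2)^n\<close> and never
  vanishes; the probabilities of these events form a geometric series.\<close>

theorem extinction_bound:
  "{\<omega> \<in> space M. \<exists>n. cells (coeffs \<omega>) n = {}} \<in> events"
  "prob {\<omega> \<in> space M. \<exists>n. cells (coeffs \<omega>) n = {}} \<le> 3 * failure_constant / real (card S0)"
proof -
  have "{\<omega> \<in> space M. \<exists>n. cells (coeffs \<omega>) n = {}} = (\<Union>n. {\<omega> \<in> space M. cells (coeffs \<omega>) n = {}})" by auto
  also have "\<dots> \<in> events" using cells_event by (intro sets.countable_UN) auto
  finally show "{\<omega> \<in> space M. \<exists>n. cells (coeffs \<omega>) n = {}} \<in> events" .
  have sub: "{\<omega> \<in> space M. \<exists>n. cells (coeffs \<omega>) n = {}} \<subseteq> (\<Union>n. overload n)"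
  proof (rule subsetI, rule ccontr)
    fix \<omega> assume \<omega>: "\<omega> \<in> {\<omega> \<in> space M. \<exists>n. cells (coeffs \<omega>) n = {}}" "\<omega> \<notin> (\<Union>n. overload n)"
    have grow: "real (card S0) * (3 / 2) ^ n \<le> real (card (cells (coeffs \<omega>) n))" for n
    proof (induction n)
      case (Suc n)
      then have "load (coeffs \<omega>) n (cells (coeffs \<omega>) n) \<le> \<mu> ^ (2 * r) / 4 * real (card (cells (coeffs \<omega>) n))"
        using \<omega> by (auto simp: overload_def not_less)
      from cells_growth[OF this] Suc show ?case by simp
    qed simp
    obtain n where "cells (coeffs \<omega>) n = {}" using \<omega>(1) by auto
    moreover have "0 < real (card S0) * (3 / 2) ^ n" using S0 by (simp add: card_gt_0_iff)
    ultimately show False using grow[of n] by simp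
  qed
  let ?c = "failure_constant / real (card S0)"
  have geo: "(\<lambda>n. ?c * (2 / 3) ^ n) sums (?c * (1 / (1 - 2 / 3)))"
    by (intro sums_mult geometric_sums) simp
  have sm: "summable (\<lambda>n. prob (overload n))"
    by (rule summable_comparison_test'[OF sums_summable[OF geo], of 0]) (use overload_bound in auto)
  have "prob {\<omega> \<in> space M. \<exists>n. cells (coeffs \<omega>) n = {}} \<le> prob (\<Union>n. overload n)"
    using sub overload_bound(1) by (intro finite_measure_mono sets.countable_UN) auto
  also have "\<dots> \<le> (\<Sum>n. prob (overload n))"
    by (rule finite_measure_subadditive_countably[OF _ sm]) (use overload_bound(1) in auto)
  also have "\<dots> \<le> (\<Sum>n. ?c * (2 / 3) ^ n)"
    by (rule suminf_le[OF overload_bound(2) sm sums_summable[OF geo]])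
  also have "\<dots> = 3 * failure_constant / real (card S0)"
    using sums_unique[OF geo] by (simp add: mult.commute)
  finally show "prob {\<omega> \<in> space M. \<exists>n. cells (coeffs \<omega>) n = {}} \<le> 3 * failure_constant / real (card S0)" .
qed

end

section \<open>Almost sure existence of slow points\<close>

context slow_tree
begin

text \<open>The unions of the closed candidate intervals are nonempty nested compact sets. A common
  point lies, at every step \<open>n\<close>, in a candidate of step \<open>n + 1\<close>, whose parent has passed the test
  at step \<open>n\<close>.\<close>

lemma surviving_point:
  assumes ne: "\<And>n. cells x n \<noteq> {}"
  shows "\<exists>t. (\<exists>c\<in>S0. t \<in> {real_of_int c / 2 ^ J..(real_of_int c + 1) / 2 ^ J}) \<and>
     (\<forall>n. \<exists>l. tame x n l \<and> real_of_int l \<le> 2 ^ (J + n) * t \<and> 2 ^ (J + n) * t \<le> real_of_int l + 1)"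
proof -
  define I where "I n c = {real_of_int c / 2 ^ (J + n)..(real_of_int c + 1) / 2 ^ (J + n)}" for n c
  define F where "F n = (\<Union>c\<in>cells x n. I n c)" for n
  have I: "t \<in> I n c \<longleftrightarrow> real_of_int c \<le> 2 ^ (J + n) * t \<and> 2 ^ (J + n) * t \<le> real_of_int c + 1" for t n c
    by (simp add: I_def field_simps)
  have child: "I (Suc n) c \<subseteq> I n (c div 2)" for n c
  proof
    fix t assume "t \<in> I (Suc n) c"
    then have "real_of_int c \<le> 2 * (2 ^ (J + n) * t)" "2 * (2 ^ (J + n) * t) \<le> real_of_int c + 1"
      by (auto simp: I)
    moreover have "2 * (c div 2) \<le> c" "c \<le> 2 * (c div 2) + 1" by linarith+
    then have "2 * real_of_int (c div 2) \<le> real_of_int c" "real_of_int c \<le> 2 * real_of_int (c div 2) + 1"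
      by linarith+
    ultimately show "t \<in> I n (c div 2)" unfolding I by linarith
  qed
  have "\<Inter>(range F) \<noteq> {}"
  proof (rule compact_nest)
    show "compact (F n)" for n
      unfolding F_def I_def using finite_cells by (intro compact_UN) auto
    show "F n \<noteq> {}" for n
    proof -
      obtain c where "c \<in> cells x n" using ne by blast
      moreover have "real_of_int c / 2 ^ (J + n) \<in> I n c" by (simp add: I_def divide_right_mono)
      ultimately show ?thesis by (auto simp: F_def)
    qed
    have "F (Suc n) \<subseteq> F n" for n
      using child by (fastforce simp: F_def)
    then show "F n \<subseteq> F m" if "m \<le> n" for m n
      using that by (rule lift_Suc_antimono_le)
  qed
  then obtain t where t: "\<And>n. t \<in> F n" by auto
  show ?thesis
  proof (intro exI[of _ t] conjI allI)
    show "\<exists>c\<in>S0. t \<in> {real_of_int c / 2 ^ J..(real_of_int c + 1) / 2 ^ J}"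
      using t[of 0] by (auto simp: F_def I_def)
    fix n
    obtain c where c: "c \<in> cells x (Suc n)" "t \<in> I (Suc n) c" using t[of "Suc n"] by (auto simp: F_def)
    then have "tame x n (c div 2)" "t \<in> I n (c div 2)" using child by auto
    then show "\<exists>l. tame x n l \<and> real_of_int l \<le> 2 ^ (J + n) * t \<and> 2 ^ (J + n) * t \<le> real_of_int l + 1"
      unfolding I by blast
  qed
qed

end

lemma powr_double_le:
  fixes u v p :: real
  assumes "0 \<le> v" "v \<le> 2 * u" "0 \<le> p" "p \<le> 1"
  shows "v powr p \<le> 2 * u powr p"
proof -
  have "v powr p \<le> (2 * u) powr p" using assms by (intro powr_mono2) auto
  also have "\<dots> = 2 powr p * u powr p" by (simp add: powr_mult)
  also have "\<dots> \<le> 2 powr 1 * u powr p" using assms by (intro mult_right_mono powr_mono) auto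
  finally show ?thesis by simp
qed

text \<open>Three kinds of coefficients have to be compared with \<open>(1 + \<bar>k - 2^j t\<bar>)^p\<close>. Those tested by
  the tree are fine up to a factor, as \<open>l\<close> and \<open>2^j t\<close> differ by at most \<open>1\<close>. For \<open>j < J\<close> the global
  bound suffices, because \<open>2^j \<bar>t\<bar>\<close> stays bounded. The others have \<open>\<bar>k\<bar> \<ge> 2^(j+1) T\<close>; then \<open>\<bar>k\<bar>\<close> is
  comparable to \<open>\<bar>k - 2^j t\<bar>\<close> and so large that the factor \<open>1 + j\<close> of the global bound is
  \<open>O((1 + \<bar>k\<bar>)^(p/2))\<close>.\<close>

lemma slow_at_of_tame:
  fixes e :: "int \<Rightarrow> int \<Rightarrow> real" and t T p B \<mu> :: real
  assumes p: "0 < p" "p \<le> 1" and \<mu>: "0 \<le> \<mu>" and B: "0 \<le> B" and T: "1 \<le> T" "\<bar>t\<bar> \<le> T"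
    and glob: "\<And>j k. \<bar>e j k\<bar> \<le> B * (1 + \<bar>real_of_int j\<bar>) * (1 + \<bar>real_of_int k\<bar>) powr (p / 2)"
    and tame: "\<And>n. J \<le> n \<Longrightarrow> \<exists>l. real_of_int l \<le> 2 ^ n * t \<and> 2 ^ n * t \<le> real_of_int l + 1 \<and>
       (\<forall>k. \<bar>real_of_int k\<bar> \<le> 2 ^ (n + 1) * T \<longrightarrow> \<bar>e (int n) k\<bar> \<le> \<mu> * (1 + \<bar>real_of_int (k - l)\<bar>) powr p)"
  shows "\<exists>\<mu>'\<ge>0. slow_at e p \<mu>' t"
proof -
  \<comment> \<open>chosen such that \<open>1 + n \<le> D * 2^(n p / 2)\<close>\<close>
  define D where "D = max 1 (2 / (p * ln 2))"
  have D: "D \<ge> 1" "1 \<le> D * (p * ln 2 / 2)"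
    using p mult_right_mono[of "2 / (p * ln 2)" D "p * ln 2 / 2"] by (auto simp: D_def)
  have log_growth: "1 + real n \<le> D * (2 ^ n) powr (p / 2)" for n
  proof -
    have "1 + real n \<le> D * 1 + D * (p * ln 2 / 2) * real n"
      using D mult_right_mono[OF D(2), of "real n"] by (intro add_mono) auto
    also have "\<dots> = D * (1 + p / 2 * (real n * ln 2))" by (simp add: algebra_simps)
    also have "\<dots> \<le> D * exp (p / 2 * (real n * ln 2))"
      using D by (intro mult_left_mono exp_ge_add_one_self) auto
    also have "exp (p / 2 * (real n * ln 2)) = (2 ^ n) powr (p / 2)"
      by (simp add: powr_def ln_realpow)
    finally show ?thesis .
  qed
  define \<mu>1 where "\<mu>1 = B * (1 + real J) * (1 + 2 ^ J * T)"
  have \<mu>1: "0 \<le> \<mu>1" using B T by (simp add: \<mu>1_def)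
  have BD: "0 \<le> B * D" using B D by simp
  define \<mu>' where "\<mu>' = \<mu>1 + 2 * \<mu> + 2 * (B * D)"
  have \<mu>': "\<mu>1 \<le> \<mu>'" "2 * \<mu> \<le> \<mu>'" "2 * (B * D) \<le> \<mu>'" "0 \<le> \<mu>'"
    using \<mu>1 \<mu> BD by (auto simp: \<mu>'_def)
  have "\<bar>e j k\<bar> \<le> \<mu>' * (1 + real_of_int (max 0 (- j))) * (1 + \<bar>real_of_int k - 2 powi j * t\<bar>) powr p" for j k
  proof (cases "j < int J")
    case True
    define u where "u = 1 + \<bar>real_of_int k - 2 powi j * t\<bar>"
    have u: "u \<ge> 1" by (simp add: u_def)
    have j1: "1 + \<bar>real_of_int j\<bar> \<le> (1 + real J) * (1 + real_of_int (max 0 (- j)))"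
    proof (cases "0 \<le> j")
      case False
      have "1 * (1 + real_of_int (max 0 (- j))) \<le> (1 + real J) * (1 + real_of_int (max 0 (- j)))"
        by (intro mult_right_mono) auto
      then show ?thesis using False by simp
    qed (use True in auto)
    have "2 powi j * \<bar>t\<bar> \<le> 2 powi (int J) * T"
      using True T by (intro mult_mono power_int_increasing) auto
    then have "\<bar>2 powi j * t\<bar> \<le> 2 ^ J * T" by (simp add: abs_mult)
    then have "1 + \<bar>real_of_int k\<bar> \<le> u + 2 ^ J * T" unfolding u_def by linarith
    also have "\<dots> \<le> (1 + 2 ^ J * T) * u"
      using u T mult_left_mono[of 1 u "2 ^ J * T"] by (simp add: distrib_right)
    finally have k1: "1 + \<bar>real_of_int k\<bar> \<le> (1 + 2 ^ J * T) * u" .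
    have "(1 + \<bar>real_of_int k\<bar>) powr (p / 2) \<le> (1 + \<bar>real_of_int k\<bar>) powr p"
      using p by (intro powr_mono) auto
    also have "\<dots> \<le> ((1 + 2 ^ J * T) * u) powr p" using k1 p by (intro powr_mono2) auto
    also have "\<dots> = (1 + 2 ^ J * T) powr p * u powr p" using T u by (simp add: powr_mult)
    also have "\<dots> \<le> (1 + 2 ^ J * T) powr 1 * u powr p"
      using T p by (intro mult_right_mono powr_mono) auto
    finally have k2: "(1 + \<bar>real_of_int k\<bar>) powr (p / 2) \<le> (1 + 2 ^ J * T) * u powr p"
      using T by (simp add: add_nonneg_nonneg)
    have "\<bar>e j k\<bar> \<le> B * (1 + \<bar>real_of_int j\<bar>) * (1 + \<bar>real_of_int k\<bar>) powr (p / 2)" by (rule glob)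
    also have "\<dots> \<le> B * ((1 + real J) * (1 + real_of_int (max 0 (- j)))) * ((1 + 2 ^ J * T) * u powr p)"
      using B T by (intro mult_mono j1 k2 order_refl mult_nonneg_nonneg) auto
    also have "\<dots> = \<mu>1 * (1 + real_of_int (max 0 (- j))) * u powr p" by (simp only: \<mu>1_def mult_ac)
    also have "\<dots> \<le> \<mu>' * (1 + real_of_int (max 0 (- j))) * u powr p"
      by (intro mult_right_mono \<mu>') auto
    finally show ?thesis by (simp only: u_def)
  next
    case False
    then obtain n where n: "j = int n" "J \<le> n" by (metis linorder_not_less nat_int of_nat_le_iff zero_le_imp_eq_int order_trans of_nat_0_le_iff)
    define u where "u = 1 + \<bar>real_of_int k - 2 ^ n * t\<bar>"
    obtain l where l: "real_of_int l \<le> 2 ^ n * t" "2 ^ n * t \<le> real_of_int l + 1"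
       "\<And>k. \<bar>real_of_int k\<bar> \<le> 2 ^ (n + 1) * T \<Longrightarrow> \<bar>e (int n) k\<bar> \<le> \<mu> * (1 + \<bar>real_of_int (k - l)\<bar>) powr p"
      using tame[OF n(2)] by blast
    have "\<bar>e j k\<bar> \<le> \<mu>' * u powr p"
    proof (cases "\<bar>real_of_int k\<bar> \<le> 2 ^ (n + 1) * T")
      case True
      have "1 + \<bar>x - y\<bar> \<le> 2 * (1 + \<bar>x - q\<bar>)" if "y \<le> q" "q \<le> y + 1" for x y q :: real
      proof -
        have "\<bar>x - y\<bar> \<le> \<bar>x - q\<bar> + 1" using that abs_triangle_ineq[of "x - q" "q - y"] by simp
        from add_mono[OF this abs_ge_zero[of "x - q"]] show ?thesis by simp
      qed
      from this[OF l(1,2), of "real_of_int k"] have "1 + \<bar>real_of_int (k - l)\<bar> \<le> 2 * u"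
        by (simp add: u_def)
      then have "(1 + \<bar>real_of_int (k - l)\<bar>) powr p \<le> 2 * u powr p"
        using p by (intro powr_double_le) auto
      then have "\<mu> * (1 + \<bar>real_of_int (k - l)\<bar>) powr p \<le> \<mu> * (2 * u powr p)" by (rule mult_left_mono[OF _ \<mu>])
      also have "\<dots> = 2 * \<mu> * u powr p" by simp
      also have "\<dots> \<le> \<mu>' * u powr p" by (intro mult_right_mono \<mu>') auto
      finally show ?thesis using l(3)[OF True] by (simp add: n)
    next
      case False
      have big: "2 * (2 ^ n * T) < \<bar>real_of_int k\<bar>" using False by simp
      have "2 * \<bar>2 ^ n * t\<bar> = 2 * (2 ^ n * \<bar>t\<bar>)" by (simp add: abs_mult)
      also have "\<dots> \<le> 2 * (2 ^ n * T)" using T by (intro mult_left_mono) auto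
      finally have far: "2 * \<bar>2 ^ n * t\<bar> \<le> \<bar>real_of_int k\<bar>" using big by (rule order_trans[OF _ less_imp_le])
      have "1 + v \<le> 2 * (1 + w)" if "v \<le> w + q" "2 * q \<le> v" for v w q :: real
        using that by simp
      from this[OF _ far] have ku: "1 + \<bar>real_of_int k\<bar> \<le> 2 * u"
        using abs_triangle_ineq[of "real_of_int k - 2 ^ n * t" "2 ^ n * t"] by (simp add: u_def)
      have "2 ^ n * 1 \<le> 2 ^ n * T" using T by (intro mult_left_mono) auto
      moreover have "(0::real) \<le> 2 ^ n" by simp
      ultimately have k2: "2 ^ n \<le> 1 + \<bar>real_of_int k\<bar>" using big by linarith
      have "1 + \<bar>real_of_int j\<bar> \<le> D * (2 ^ n) powr (p / 2)" using log_growth[of n] n by simp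
      also have "\<dots> \<le> D * (1 + \<bar>real_of_int k\<bar>) powr (p / 2)"
        using k2 p D by (intro mult_left_mono powr_mono2) auto
      finally have j1: "1 + \<bar>real_of_int j\<bar> \<le> D * (1 + \<bar>real_of_int k\<bar>) powr (p / 2)" .
      have "\<bar>e j k\<bar> \<le> B * (1 + \<bar>real_of_int j\<bar>) * (1 + \<bar>real_of_int k\<bar>) powr (p / 2)" by (rule glob)
      also have "\<dots> \<le> B * (D * (1 + \<bar>real_of_int k\<bar>) powr (p / 2)) * (1 + \<bar>real_of_int k\<bar>) powr (p / 2)"
        by (intro mult_right_mono mult_left_mono j1 B) auto
      also have "\<dots> = B * D * (1 + \<bar>real_of_int k\<bar>) powr p" by (simp add: mult.assoc powr_add[symmetric])
      also have "\<dots> \<le> B * D * (2 * u powr p)"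
        using ku p by (intro mult_left_mono[OF powr_double_le BD]) auto
      also have "\<dots> = 2 * (B * D) * u powr p" by simp
      also have "\<dots> \<le> \<mu>' * u powr p" by (intro mult_right_mono \<mu>') auto
      finally show ?thesis .
    qed
    then show ?thesis by (simp add: n u_def)
  qed
  then show ?thesis using \<mu>'(4) by (auto simp: slow_at_def)
qed

context gaussian_array
begin

text \<open>The \<open>i\<close>-th tree starts with the \<open>2^i\<close> dyadic subintervals of level \<open>J0 + i\<close>. All of these trees
  die out with probability at most \<open>O(2^(-i))\<close> for every \<open>i\<close>, hence with probability zero.\<close>

theorem AE_slow_point_in_dyadic_interval:
  fixes m :: int and J0 :: nat
  assumes p: "0 < p" "p \<le> 1"
  shows "AE \<omega> in M. \<exists>t\<in>{real_of_int m / 2 ^ J0..(real_of_int m + 1) / 2 ^ J0}.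
           \<exists>\<mu>\<ge>0. slow_at (\<lambda>j k. X (j, k) \<omega>) p \<mu> t"
proof -
  obtain r :: nat where r: "real r \<ge> 1 / p" using real_arch_simple by blast
  then have rp: "1 \<le> p * real r" using p by (simp add: field_simps)
  then have r1: "1 \<le> r" using p by (cases r) auto
  define \<mu> where "\<mu> = max 1 (8 * (decay_total * normal_moment r))"
  have \<mu>: "\<mu> \<ge> 1" "0 < \<mu>" by (simp_all add: \<mu>_def)
  have large: "decay_total * normal_moment r \<le> \<mu> ^ (2 * r) / 8"
  proof -
    have "8 * (decay_total * normal_moment r) \<le> \<mu>" by (simp add: \<mu>_def)
    also have "\<mu> \<le> \<mu> ^ (2 * r)" using \<mu> r1 by (intro self_le_power) auto
    finally show ?thesis by simp
  qed
  define T where "T = \<bar>m\<bar> + 1"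
  define S where "S i = {m * 2 ^ i..<(m + 1) * 2 ^ i}" for i :: nat
  define K where "K i n = {- (2 ^ (J0 + i + n + 1) * T)..2 ^ (J0 + i + n + 1) * T}" for i n :: nat
  have S_card: "card (S i) = 2 ^ i" for i
  proof -
    have "(m + 1) * 2 ^ i - m * 2 ^ i = 2 ^ i" by (simp add: algebra_simps)
    then have "card (S i) = nat (2 ^ i)" by (simp add: S_def)
    then show ?thesis by (simp add: nat_power_eq)
  qed
  have tree: "gaussian_slow_tree M X \<mu> p r (S i) (K i)" for i
  proof (unfold_locales)
    show "S i \<noteq> {}" using S_card[of i] by force
  qed (use \<mu> p rp large in \<open>auto simp: S_def K_def\<close>)
  have tree': "slow_tree \<mu> p r (S i) (K i)" for i using tree by (simp add: gaussian_slow_tree_def)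
  define fc where "fc = gaussian_slow_tree.failure_constant \<mu> r"
  define fail where "fail i = {\<omega> \<in> space M. \<exists>n. slow_tree.cells \<mu> p (J0 + i) (S i) (K i) (\<lambda>z. X z \<omega>) n = {}}" for i
  have fail: "fail i \<in> events" "prob (fail i) \<le> 3 * fc / 2 ^ i" for i
    using gaussian_slow_tree.extinction_bound[OF tree[of i], of "J0 + i"] S_card[of i]
    unfolding fail_def fc_def gaussian_slow_tree.coeffs_def[OF tree] by auto
  have "prob (\<Inter>i. fail i) = 0"
  proof -
    have "(\<lambda>i. 3 * fc * (1 / 2) ^ i) \<longlonglongrightarrow> 3 * fc * 0"
      by (intro tendsto_mult tendsto_const LIMSEQ_power_zero) simp
    moreover have "prob (\<Inter>i. fail i) \<le> 3 * fc * (1 / 2) ^ i" for i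
    proof -
      have "prob (\<Inter>i. fail i) \<le> prob (fail i)" using fail(1) by (intro finite_measure_mono) auto
      then show ?thesis using fail(2)[of i] by (simp add: power_divide)
    qed
    ultimately have "prob (\<Inter>i. fail i) \<le> 3 * fc * 0" by (intro LIMSEQ_le_const) auto
    then show ?thesis by (simp add: measure_le_0_iff)
  qed
  then have "(\<Inter>i. fail i) \<in> null_sets M"
    using fail(1) by (auto simp: null_sets_def emeasure_eq_measure)
  then have "AE \<omega> in M. \<omega> \<notin> (\<Inter>i. fail i)" by (rule AE_not_in)
  moreover have "AE \<omega> in M. \<exists>B\<ge>0. \<forall>j k. \<bar>X (j, k) \<omega>\<bar> \<le> B * (1 + \<bar>real_of_int j\<bar>) * (1 + \<bar>real_of_int k\<bar>) powr (p / 2)"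
    using p by (intro AE_global_bound) auto
  moreover have "AE \<omega> in M. \<omega> \<in> space M" by (rule AE_space)
  ultimately show ?thesis
  proof eventually_elim
    fix \<omega> assume \<omega>: "\<omega> \<notin> (\<Inter>i. fail i)" "\<omega> \<in> space M"
      and "\<exists>B\<ge>0. \<forall>j k. \<bar>X (j, k) \<omega>\<bar> \<le> B * (1 + \<bar>real_of_int j\<bar>) * (1 + \<bar>real_of_int k\<bar>) powr (p / 2)"
    then obtain B where B: "B \<ge> 0" "\<And>j k. \<bar>X (j, k) \<omega>\<bar> \<le> B * (1 + \<bar>real_of_int j\<bar>) * (1 + \<bar>real_of_int k\<bar>) powr (p / 2)"
      by auto
    obtain i where i: "\<And>n. slow_tree.cells \<mu> p (J0 + i) (S i) (K i) (\<lambda>z. X z \<omega>) n \<noteq> {}"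
      using \<omega> by (auto simp: fail_def)
    obtain t c where t: "c \<in> S i" "t \<in> {real_of_int c / 2 ^ (J0 + i)..(real_of_int c + 1) / 2 ^ (J0 + i)}"
      "\<And>n. \<exists>l. slow_tree.tame \<mu> p (J0 + i) (K i) (\<lambda>z. X z \<omega>) n l \<and>
         real_of_int l \<le> 2 ^ (J0 + i + n) * t \<and> 2 ^ (J0 + i + n) * t \<le> real_of_int l + 1"
      using slow_tree.surviving_point[OF tree' i] by blast
    have "m * 2 ^ i \<le> c" "c + 1 \<le> (m + 1) * 2 ^ i" using t(1) by (auto simp: S_def)
    then have "real_of_int (m * 2 ^ i) \<le> real_of_int c" "real_of_int (c + 1) \<le> real_of_int ((m + 1) * 2 ^ i)"
      by (simp_all only: of_int_le_iff)
    then have c: "real_of_int m * 2 ^ i \<le> real_of_int c" "real_of_int c + 1 \<le> (real_of_int m + 1) * 2 ^ i" by simp_all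
    have tI: "t \<in> {real_of_int m / 2 ^ J0..(real_of_int m + 1) / 2 ^ J0}"
    proof -
      have "real_of_int m / 2 ^ J0 = real_of_int m * 2 ^ i / 2 ^ (J0 + i)" by (simp add: power_add)
      also have "\<dots> \<le> real_of_int c / 2 ^ (J0 + i)" using c by (intro divide_right_mono) auto
      finally have 1: "real_of_int m / 2 ^ J0 \<le> t" using t(2) by auto
      have "(real_of_int c + 1) / 2 ^ (J0 + i) \<le> (real_of_int m + 1) * 2 ^ i / 2 ^ (J0 + i)"
        using c by (intro divide_right_mono) auto
      also have "\<dots> = (real_of_int m + 1) / 2 ^ J0" by (simp add: power_add)
      finally show ?thesis using 1 t(2) by auto
    qed
    have tT: "\<bar>t\<bar> \<le> real_of_int T"
    proof -
      have one: "\<bar>y / 2 ^ J0\<bar> \<le> \<bar>y\<bar>" for y :: real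
        by (simp add: abs_divide divide_le_eq mult_le_cancel_left1)
      have "real_of_int m / 2 ^ J0 \<le> t" "t \<le> (real_of_int m + 1) / 2 ^ J0" using tI by auto
      then have "\<bar>t\<bar> \<le> \<bar>real_of_int m\<bar> + 1"
        using one[of "real_of_int m"] one[of "real_of_int m + 1"] by linarith
      then show ?thesis by (simp add: T_def)
    qed
    have "\<exists>\<mu>'\<ge>0. slow_at (\<lambda>j k. X (j, k) \<omega>) p \<mu>' t"
    proof (rule slow_at_of_tame[OF p _ B(1) _ tT B(2)])
      show "0 \<le> \<mu>" "1 \<le> real_of_int T" using \<mu> by (auto simp: T_def)
      fix n assume n: "J0 + i \<le> n"
      then obtain n' where n': "n = J0 + i + n'" by (metis le_Suc_ex)
      obtain l where l: "slow_tree.tame \<mu> p (J0 + i) (K i) (\<lambda>z. X z \<omega>) n' l"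
         "real_of_int l \<le> 2 ^ n * t" "2 ^ n * t \<le> real_of_int l + 1"
        using t(3)[of n'] n' by auto
      have "\<bar>X (int n, k) \<omega>\<bar> \<le> \<mu> * (1 + \<bar>real_of_int (k - l)\<bar>) powr p"
        if k: "\<bar>real_of_int k\<bar> \<le> 2 ^ (n + 1) * real_of_int T" for k
      proof -
        have "\<bar>real_of_int k\<bar> \<le> real_of_int (2 ^ (n + 1) * T)" using k by simp
        then have "\<bar>k\<bar> \<le> 2 ^ (n + 1) * T" by linarith
        then have "(int n, k) \<in> slow_tree.level_indices (J0 + i) (K i) n'"
          unfolding slow_tree.level_indices_def[OF tree'] K_def n' by (auto simp: abs_le_iff)
        then show ?thesis using l(1) unfolding slow_tree.tame_def[OF tree'] by auto
      qed
      then show "\<exists>l. real_of_int l \<le> 2 ^ n * t \<and> 2 ^ n * t \<le> real_of_int l + 1 \<and>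
         (\<forall>k. \<bar>real_of_int k\<bar> \<le> 2 ^ (n + 1) * real_of_int T \<longrightarrow> \<bar>X (int n, k) \<omega>\<bar> \<le> \<mu> * (1 + \<bar>real_of_int (k - l)\<bar>) powr p)"
        using l by blast
    qed
    then show "\<exists>t\<in>{real_of_int m / 2 ^ J0..(real_of_int m + 1) / 2 ^ J0}.
           \<exists>\<mu>\<ge>0. slow_at (\<lambda>j k. X (j, k) \<omega>) p \<mu> t" using tI by blast
  qed
qed

end

section \<open>Slow points of multifractional Brownian motion\<close>

lemma open_contains_dyadic_interval:
  fixes I :: "real set"
  assumes "open I" "I \<noteq> {}"
  shows "\<exists>(m::int) (J::nat). {real_of_int m / 2 ^ J..(real_of_int m + 1) / 2 ^ J} \<subseteq> I"
proof -
  obtain x where "x \<in> I" using assms by blast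
  then obtain d where d: "d > 0" "\<And>y. \<bar>y - x\<bar> < d \<Longrightarrow> y \<in> I"
    using assms(1) by (auto simp: open_dist dist_real_def)
  obtain J where J: "(1 / 2) ^ J < d" using real_arch_pow_inv[of d "1/2"] d by auto
  define m where "m = \<lfloor>x * 2 ^ J\<rfloor>"
  have m: "real_of_int m \<le> x * 2 ^ J" "x * 2 ^ J < real_of_int m + 1" by (auto simp: m_def)
  then have mx: "real_of_int m / 2 ^ J \<le> x" "x < (real_of_int m + 1) / 2 ^ J" by (simp_all add: field_simps)
  have len: "(real_of_int m + 1) / 2 ^ J = real_of_int m / 2 ^ J + (1 / 2) ^ J"
    by (simp add: add_divide_distrib power_divide)
  have "y \<in> I" if "y \<in> {real_of_int m / 2 ^ J..(real_of_int m + 1) / 2 ^ J}" for y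
    by (rule d(2)) (use that mx len J in \<open>unfold atLeastAtMost_iff, linarith\<close>)
  then show ?thesis by blast
qed

text \<open>Write \<open>B(s, H s) - B(t, H t)\<close> as \<open>B(s, H s) - B(s, H t)\<close> plus \<open>B(s, H t) - B(t, H t)\<close>: the first
  difference is \<open>O(\<bar>H s - H t\<bar>)\<close> by the Lipschitz bound and the second \<open>O(\<bar>s - t\<bar>^(H t))\<close> by
  slowness.\<close>

lemma slow_point_bound:
  fixes P :: "real \<Rightarrow> real \<Rightarrow> real" and H :: "real \<Rightarrow> real"
  assumes prof: "wavelet_profile P C a b"
    and p: "0 \<le> p" "p \<le> 1/2" "p < a" and \<mu>: "0 \<le> \<mu>" and slow: "slow_at e p \<mu> t"
    and H: "\<And>s. H s \<in> {a..b}"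
    and \<gamma>: "\<gamma> \<ge> H t" "R > 0" "c > 0" "\<And>s. \<bar>s - t\<bar> \<le> R \<Longrightarrow> \<bar>H s - H t\<bar> \<le> c * \<bar>s - t\<bar> powr \<gamma>"
  shows "\<exists>L. \<forall>\<^sub>F s in at t. \<bar>wavelet_profile.field P e s (H s) - wavelet_profile.field P e t (H t)\<bar> / \<bar>s - t\<bar> powr H t \<le> L"
proof -
  interpret wavelet_profile P C a b by (rule prof)
  obtain k where k: "k \<ge> 0" "\<And>s \<theta>. \<bar>s - t\<bar> \<le> 1 \<Longrightarrow> \<theta> \<in> {a..b} \<Longrightarrow> \<bar>field e s \<theta> - field e t \<theta>\<bar> \<le> k * \<bar>s - t\<bar> powr \<theta>"
    "\<And>s \<theta> \<theta>'. \<bar>s - t\<bar> \<le> 1 \<Longrightarrow> \<theta> \<in> {a..b} \<Longrightarrow> \<theta>' \<in> {a..b} \<Longrightarrow> \<bar>field e s \<theta> - field e s \<theta>'\<bar> \<le> k * \<bar>\<theta> - \<theta>'\<bar>"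
    using field_at_slow_point[OF p \<mu> slow] by blast
  have bound: "\<bar>field e s (H s) - field e t (H t)\<bar> / \<bar>s - t\<bar> powr H t \<le> k * c + k"
    if s: "s \<noteq> t" "\<bar>s - t\<bar> < min 1 R" for s
  proof -
    have "\<bar>field e s (H s) - field e t (H t)\<bar> \<le> \<bar>field e s (H s) - field e s (H t)\<bar> + \<bar>field e s (H t) - field e t (H t)\<bar>"
      by linarith
    also have "\<dots> \<le> k * \<bar>H s - H t\<bar> + k * \<bar>s - t\<bar> powr H t"
      using s by (intro add_mono k H) auto
    also have "\<dots> \<le> k * (c * \<bar>s - t\<bar> powr H t) + k * \<bar>s - t\<bar> powr H t"
    proof (intro add_right_mono mult_left_mono k(1))
      have "\<bar>H s - H t\<bar> \<le> c * \<bar>s - t\<bar> powr \<gamma>" using s by (intro \<gamma>) auto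
      also have "\<dots> \<le> c * \<bar>s - t\<bar> powr H t" using s \<gamma> by (intro mult_left_mono powr_mono') auto
      finally show "\<bar>H s - H t\<bar> \<le> c * \<bar>s - t\<bar> powr H t" .
    qed
    finally have "\<bar>field e s (H s) - field e t (H t)\<bar> \<le> (k * c + k) * \<bar>s - t\<bar> powr H t"
      by (simp add: distrib_right mult.assoc)
    then show ?thesis using s by (simp add: pos_divide_le_eq)
  qed
  show ?thesis
  proof (intro exI[of _ "k * c + k"])
    show "\<forall>\<^sub>F s in at t. \<bar>field e s (H s) - field e t (H t)\<bar> / \<bar>s - t\<bar> powr H t \<le> k * c + k"
      unfolding eventually_at using bound \<gamma>(2) by (intro exI[of _ "min 1 R"]) (auto simp: dist_real_def)
  qed
qed

theorem theorem1p4: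
  fixes M :: "'a measure"
    and \<epsilon> :: "int \<Rightarrow> int \<Rightarrow> 'a \<Rightarrow> real"
    and \<psi> H :: "real \<Rightarrow> real"
    and a b :: real
  assumes "prob_space M"
    and "iid_std_normal M \<epsilon>"
    and "lemarie_meyer \<psi>"
    and "0 < a" and "a < b" and "b < 1"
    and "\<forall>t. H t \<in> {a..b}"
    and "\<forall>t. \<exists>\<gamma> R c. \<gamma> \<ge> H t \<and> R > 0 \<and> c > 0 \<and>
           (\<forall>s. \<bar>s - t\<bar> \<le> R \<longrightarrow> \<bar>H s - H t\<bar> \<le> c * \<bar>s - t\<bar> powr \<gamma>)"
  shows "AE \<omega> in M. \<forall>I :: real set. I \<noteq> {} \<and> open I \<and> is_interval I \<longrightarrow>
           (\<exists>t\<in>I. Limsup (at t)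
              (\<lambda>s. ereal (\<bar>mBm \<psi> \<epsilon> H \<omega> s - mBm \<psi> \<epsilon> H \<omega> t\<bar> / \<bar>s - t\<bar> powr H t)) < \<infinity>)"
proof -
  interpret prob_space M by fact
  define X where "X z = \<epsilon> (fst z) (snd z)" for z
  have "gaussian_array M X"
  proof
    have "(\<lambda>(j, k). \<epsilon> j k) = X" by (auto simp: X_def)
    then show "indep_vars (\<lambda>_. borel) X UNIV" using assms(2) by (simp add: iid_std_normal_def)
    show "distributed M lborel (X z) (\<lambda>x. ennreal (std_normal_density x))" for z
      using assms(2) by (simp add: iid_std_normal_def X_def)
  qed
  then interpret gaussian_array M X .
  obtain C where prof: "wavelet_profile (\<lambda>x \<theta>. Re (Psi \<psi> x \<theta>)) C a b"
    using wavelet_profile_Psi[OF assms(3,4) less_imp_le[OF assms(5)] assms(6)] by blast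
  define p where "p = a / 2"
  have p: "0 < p" "p \<le> 1 / 2" "p < a" "p \<le> 1" using assms(4-6) by (auto simp: p_def)
  have mBm: "mBm \<psi> \<epsilon> H \<omega> t = wavelet_profile.field (\<lambda>x \<theta>. Re (Psi \<psi> x \<theta>)) (\<lambda>j k. \<epsilon> j k \<omega>) t (H t)" for \<omega> t
    unfolding mBm_def mBm_generator_def wavelet_profile.field_def[OF prof] by simp
  have "AE \<omega> in M. \<forall>m::int. \<forall>J::nat. \<exists>t\<in>{real_of_int m / 2 ^ J..(real_of_int m + 1) / 2 ^ J}.
      \<exists>\<mu>\<ge>0. slow_at (\<lambda>j k. X (j, k) \<omega>) p \<mu> t"
    unfolding AE_all_countable by (intro allI AE_slow_point_in_dyadic_interval p)
  then show ?thesis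
  proof (eventually_elim, intro allI impI)
    fix \<omega> and I :: "real set"
    assume slow: "\<forall>m::int. \<forall>J::nat. \<exists>t\<in>{real_of_int m / 2 ^ J..(real_of_int m + 1) / 2 ^ J}.
      \<exists>\<mu>\<ge>0. slow_at (\<lambda>j k. X (j, k) \<omega>) p \<mu> t"
      and I: "I \<noteq> {} \<and> open I \<and> is_interval I"
    obtain m :: int and J :: nat where "{real_of_int m / 2 ^ J..(real_of_int m + 1) / 2 ^ J} \<subseteq> I"
      using open_contains_dyadic_interval I by blast
    then obtain t \<mu> where t: "t \<in> I" "0 \<le> \<mu>" "slow_at (\<lambda>j k. \<epsilon> j k \<omega>) p \<mu> t"
      using slow unfolding X_def fst_conv snd_conv by blast
    obtain \<gamma> R c where \<gamma>: "\<gamma> \<ge> H t" "R > 0" "c > 0" "\<And>s. \<bar>s - t\<bar> \<le> R \<Longrightarrow> \<bar>H s - H t\<bar> \<le> c * \<bar>s - t\<bar> powr \<gamma>"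
      using assms(8) by blast
    obtain L where L: "\<forall>\<^sub>F s in at t. \<bar>mBm \<psi> \<epsilon> H \<omega> s - mBm \<psi> \<epsilon> H \<omega> t\<bar> / \<bar>s - t\<bar> powr H t \<le> L"
      using slow_point_bound[OF prof less_imp_le[OF p(1)] p(2,3) t(2,3) _ \<gamma>] assms(7) unfolding mBm by blast
    have "Limsup (at t) (\<lambda>s. ereal (\<bar>mBm \<psi> \<epsilon> H \<omega> s - mBm \<psi> \<epsilon> H \<omega> t\<bar> / \<bar>s - t\<bar> powr H t)) \<le> ereal L"
      by (rule Limsup_bounded) (use L in \<open>simp add: eventually_mono\<close>)
    also have "\<dots> < \<infinity>" by simp
    finally show "\<exists>t\<in>I. Limsup (at t)
        (\<lambda>s. ereal (\<bar>mBm \<psi> \<epsilon> H \<omega> s - mBm \<psi> \<epsilon> H \<omega> t\<bar> / \<bar>s - t\<bar> powr H t)) < \<infinity>"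
      using t(1) by blast
  qed
qed

end
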